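(* (Upper tail) For every $\varepsilon>0$ there exist constants $c,C>0$ such that for any $n\ge1$, any $v\in[n]$ and any $S\in[1,c(n/v)^{1-\varepsilon}]$, $$c\,\frac{1+\log S}{S^2}\ \le\ \mathbb{P}\big(\widehat\sigma_2(v)\ge Sv\big)\ \le\ C\,\frac{1+\log S}{S^2}.$$ The upper bound holds for all $S\ge1$. (Lower tail) Moreover, there exist constants $c',C',\delta>0$ such that for any $n\ge1$, any $v\in[n/4]$ and any $S\in[1,\delta\sqrt v]$, $$\frac{c'}{S^2}\ \le\ \mathbb{P}\Big(\widehat\sigma_2(v)\le \frac1S v\Big)\ \le\ \frac{C'}{S^2}.$$ The upper bound holds for all $S\ge1$. Here $\widehat\sigma_2$ is the Jordan-2 ordering of the uniform random recursive tree $T_n$.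
   Context: For real $x$, $[x]$ is the set of integers $i$ with $1\le i\le x$. The uniform random recursive tree $T_n$ on vertex set $[n]$ is sampled recursively: $T_1$ is the single vertex $1$ (the root); given $T_n$, choose $u\in\{1,\dots,n\}$ uniformly at random, independently of $T_1,\dots,T_n$, and add a new vertex $n+1$ together with the edge $\{u,n+1\}$. For a finite tree $t$ and vertices $u,v$, let $(t,u)_{v\downarrow}$ be the subtree of $v$ in the tree $t$ rooted at $u$ (the vertices $w$ such that $v$ lies on the path from $u$ to $w$), and $|\cdot|$ its number of vertices. The Jordan centrality is $\phi_t(v)=\min_{u\sim v}|(t,u)_{v\downarrow}|$, the minimum being over neighbors $u$ of $v$ in $t$. Let $v^{(1)}=\arg\min_{u\sim v}|(t,u)_{v\downarrow}|$. The Jordan-2 centrality is $$\phi_t^{(2)}(v)=\phi_t(v)\cdot\max\big(\phi_t(v^{(1)}),\phi_t(v)\big);$$ if $v^{(1)}$ is not uniquely defined, it is chosen among the minimizers so that the resulting value of $\phi^{(2)}_t(v)$ is smallest. The Jordan-2 ordering $\widehat\sigma_2$ ranks the vertices of $T_n$ decreasingly by $\phi^{(2)}_{T_n}$ (the vertex with largest value gets rank $1$), breaking ties uniformly at random; $\widehat\sigma_2(v)\in[n]$ is the rank of $v$ (for $n=1$ the only vertex has rank $1$). *)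

theory Defs
  imports "HOL-Probability.Probability" "HOL-Combinatorics.Permutations"
begin

text \<open>
  A tree is given by its set of edges, an edge being a two-element set of vertices.
  The one-vertex tree has no edges; the vertex set of the recursive tree of size
  \<open>n\<close> is \<open>{1..n}\<close>.
\<close>

type_synonym tree = "nat set set"

text \<open>The value at \<open>0\<close> is junk.\<close>

fun recursive_tree :: "nat \<Rightarrow> tree pmf" where
  "recursive_tree 0 = return_pmf {}"
| "recursive_tree (Suc 0) = return_pmf {}"
| "recursive_tree (Suc (Suc n)) =
     bind_pmf (recursive_tree (Suc n)) (\<lambda>t.
       bind_pmf (pmf_of_set {1..Suc n}) (\<lambda>u.
         return_pmf (insert {u, Suc (Suc n)} t)))"

definition neighbors :: "tree \<Rightarrow> nat \<Rightarrow> nat set" where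
  "neighbors t v = {u. {u, v} \<in> t}"

definition path_between :: "tree \<Rightarrow> nat \<Rightarrow> nat \<Rightarrow> nat list \<Rightarrow> bool" where
  "path_between t u w p \<longleftrightarrow>
     p \<noteq> [] \<and> hd p = u \<and> last p = w \<and> distinct p \<and> successively (\<lambda>x y. {x, y} \<in> t) p"

definition subtree :: "tree \<Rightarrow> nat \<Rightarrow> nat \<Rightarrow> nat set" where
  "subtree t u v = {w. \<exists>p. path_between t u w p \<and> v \<in> set p}"

text \<open>
  On a vertex without neighbors (only the root of the one-vertex tree) the two centralities
  below are minima of the empty set, hence unspecified; the orderings of a one-vertex tree
  do not depend on them.
\<close>

definition jordan :: "tree \<Rightarrow> nat \<Rightarrow> nat" where
  "jordan t v = Min ((\<lambda>u. card (subtree t u v)) ` neighbors t v)"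

definition jordan_minimizers :: "tree \<Rightarrow> nat \<Rightarrow> nat set" where
  "jordan_minimizers t v = {u \<in> neighbors t v. card (subtree t u v) = jordan t v}"

text \<open>The outer minimum runs over the possible choices of \<open>v\<^sup>(\<^sup>1\<^sup>)\<close>.\<close>

definition jordan2 :: "tree \<Rightarrow> nat \<Rightarrow> nat" where
  "jordan2 t v = Min ((\<lambda>u. jordan t v * max (jordan t u) (jordan t v)) ` jordan_minimizers t v)"

text \<open>
  All rankings of \<open>{1..n}\<close> that are decreasing in the Jordan-2 centrality; breaking ties
  uniformly at random means choosing one of them uniformly.
\<close>

definition jordan2_rankings :: "nat \<Rightarrow> tree \<Rightarrow> (nat \<Rightarrow> nat) set" where
  "jordan2_rankings n t =
     {\<sigma>. \<sigma> permutes {1..n} \<and>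
         (\<forall>u\<in>{1..n}. \<forall>v\<in>{1..n}. jordan2 t u > jordan2 t v \<longrightarrow> \<sigma> u < \<sigma> v)}"

definition jordan2_ordering :: "nat \<Rightarrow> (nat \<Rightarrow> nat) pmf" where
  "jordan2_ordering n = bind_pmf (recursive_tree n) (\<lambda>t. pmf_of_set (jordan2_rankings n t))"

text \<open>The uniform distribution above is always taken over a finite nonempty set.\<close>

lemma finite_jordan2_rankings: "finite (jordan2_rankings n t)"
  by (rule finite_subset[OF _ finite_permutations[of "{1..n}"]]) (auto simp: jordan2_rankings_def)

lemma jordan2_rankings_nonempty: "jordan2_rankings n t \<noteq> {}"
proof -
  let ?f = "jordan2 t"
  define B where "B v = {w \<in> {1..n}. ?f w > ?f v \<or> (?f w = ?f v \<and> w \<le> v)}" for v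
  define \<sigma> where "\<sigma> v = (if v \<in> {1..n} then card (B v) else v)" for v
  have fin: "finite (B v)" for v
    by (auto simp: B_def)
  have less: "card (B u) < card (B v)"
    if "u \<in> {1..n}" "v \<in> {1..n}" "?f u > ?f v \<or> (?f u = ?f v \<and> u < v)" for u v
  proof (rule psubset_card_mono[OF fin])
    have "v \<in> B v" "v \<notin> B u" "B u \<subseteq> B v"
      using that by (auto simp: B_def)
    then show "B u \<subset> B v" by blast
  qed
  have inj: "inj_on \<sigma> {1..n}"
  proof (rule inj_onI, rule ccontr)
    fix u v assume uv: "u \<in> {1..n}" "v \<in> {1..n}" "\<sigma> u = \<sigma> v" "u \<noteq> v"
    then have "card (B u) < card (B v) \<or> card (B v) < card (B u)"
      using less[of u v] less[of v u] by (meson linorder_neqE_nat)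
    with uv show False by (auto simp: \<sigma>_def)
  qed
  have sub: "\<sigma> ` {1..n} \<subseteq> {1..n}"
  proof
    fix k assume "k \<in> \<sigma> ` {1..n}"
    then obtain v where v: "v \<in> {1..n}" "k = card (B v)"
      by (auto simp: \<sigma>_def)
    have "v \<in> B v" using v by (auto simp: B_def)
    then have "card (B v) > 0" using fin[of v] card_gt_0_iff by blast
    moreover have "card (B v) \<le> card {1..n}"
      by (rule card_mono) (auto simp: B_def)
    ultimately show "k \<in> {1..n}" using v by auto
  qed
  have "\<sigma> permutes {1..n}"
  proof (rule bij_imp_permutes)
    show "bij_betw \<sigma> {1..n} {1..n}"
      using inj sub by (simp add: bij_betw_def endo_inj_surj)
    show "\<sigma> x = x" if "x \<notin> {1..n}" for x
      using that by (auto simp: \<sigma>_def)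
  qed
  moreover have "\<sigma> u < \<sigma> v" if "u \<in> {1..n}" "v \<in> {1..n}" "?f u > ?f v" for u v
    using less[of u v] that by (auto simp: \<sigma>_def)
  ultimately have "\<sigma> \<in> jordan2_rankings n t"
    by (simp add: jordan2_rankings_def)
  then show ?thesis by blast
qed

end

theory Submission
  imports Defs
begin

text \<open>
  Code a recursive tree by its parent function \<open>f\<close> and write \<open>D v\<close> for the number of descendants
  of \<open>v\<close>. Seen from its parent, \<open>v\<close> has a subtree of \<open>D v\<close> vertices, so the Jordan-2 centrality of
  a vertex \<open>v\<close> other than the root is at most \<open>D v * D (f v)\<close> (\<open>jordan2_le_parent\<close>), and it is of
  this order unless one branch holds almost all of the tree. The sizes \<open>D v\<close> and \<open>D (f v)\<close> are
  read off a Polya urn: \<open>D v\<close> is of order \<open>n / v\<close>, and \<open>(n / v) * (n / f v) \<ge> (n / K)\<^sup>2\<close> holds for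
  about \<open>K\<close> vertices \<open>v\<close>. So a vertex of Jordan-2 centrality \<open>(n / K)\<^sup>2\<close> should have a rank of
  order \<open>K\<close>, and the theorem is about how far the centrality of \<open>v\<close> deviates from \<open>(n / v)\<^sup>2\<close>.

  Upper tail: a rank above \<open>S * v\<close> means a centrality below \<open>y\<^sup>2\<close> with \<open>y\<close> of order \<open>n / (S * v)\<close>.
  The joint law of \<open>k = D v\<close> and of the size \<open>l\<close> of the rest of the subtree of the parent is flat,
  of density of order \<open>(v / n)\<^sup>2\<close> (\<open>urn_density2\<close>, \<open>urn_density_lower\<close>). The pairs with
  \<open>k * (k + l) \<le> y\<^sup>2\<close> lie under a hyperbola, cut off at \<open>l\<close> of order \<open>n / v\<close>; there are about
  \<open>y\<^sup>2 * (1 + ln S)\<close> of them, and \<open>(v / n)\<^sup>2 * y\<^sup>2 = 1 / S\<^sup>2\<close>. This is the source of the logarithm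
  (\<open>pr_product_small\<close>, \<open>jordan2_small_prob_lower\<close>). The condition \<open>S \<le> c * (n / v) powr (1 - \<epsilon>)\<close>
  keeps a fixed part of the logarithm within the range \<open>k \<ge> 1\<close>.

  Lower tail: the cheapest way for \<open>v\<close> to reach rank \<open>v / S\<close> is a parent among the first \<open>v / S\<^sup>2\<close>
  vertices, which has probability \<open>1 / S\<^sup>2\<close> and raises the centrality to \<open>(S * n / v)\<^sup>2\<close>
  (\<open>good_parent\<close>). That nothing else contributes follows from high moments of \<open>D v * D (f v)\<close> for
  a given parent, which are summable over the parents (\<open>DD_moment\<close>).

  Both parts need the number of vertices above a given level. Too many vertices above \<open>(n / K)\<^sup>2\<close>:
  a product over all vertices is used as an exponential moment; its mean satisfies a recursion
  because a recursive tree splits into two independent recursive trees of uniform sizes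
  (\<open>shape_ev_split\<close>), and explicit supersolutions bound the mean (\<open>heavy_count_bound\<close>). Too few:
  then \<open>K\<close> of the clusters grown from the first \<open>M\<close> vertices hold three quarters of the tree, and
  a union bound with moments of order \<open>4 * K\<close> shows that this has probability at most
  \<open>(12 * K / M) ^ (3 * K)\<close> (\<open>few_central_prob\<close>). Each of the four inequalities combines the law of
  the centrality of \<open>v\<close> with one of these two counts.
\<close>

section \<open>Expectations over parent functions\<close>

text \<open>
  The expectation over parent functions \<open>f\<close>: the parent of vertex \<open>k + 1\<close> is uniform on \<open>1..k\<close>,
  and the values of \<open>f\<close> outside of \<open>2..n\<close> are \<open>0\<close>. With a recursion on \<open>n\<close> instead of a measure, a
  computation that adds one vertex is a rewriting step.
\<close>

fun ev :: "nat \<Rightarrow> ((nat \<Rightarrow> nat) \<Rightarrow> real) \<Rightarrow> real" where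
  "ev 0 g = g (\<lambda>_. 0)"
| "ev (Suc 0) g = g (\<lambda>_. 0)"
| "ev (Suc (Suc n)) g = ev (Suc n) (\<lambda>f. (\<Sum>u=1..Suc n. g (f(Suc (Suc n) := u))) / real (Suc n))"

declare ev.simps(3) [simp del]

definition valid :: "nat \<Rightarrow> (nat \<Rightarrow> nat) \<Rightarrow> bool" where
  "valid n f \<longleftrightarrow> (\<forall>i\<in>{2..n}. 1 \<le> f i \<and> f i < i)"

text \<open>
  Measurability with respect to the parents of the first \<open>m\<close> vertices.
\<close>

definition local_at :: "nat \<Rightarrow> ((nat \<Rightarrow> nat) \<Rightarrow> 'a) \<Rightarrow> bool" where
  "local_at m H \<longleftrightarrow> (\<forall>f k u. m < k \<longrightarrow> H (f(k := u)) = H f)"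

lemma local_atD: "local_at m H \<Longrightarrow> m < k \<Longrightarrow> H (f(k := u)) = H f"
  by (simp add: local_at_def)

lemma local_at_mono: "local_at m H \<Longrightarrow> m \<le> n \<Longrightarrow> local_at n H"
  by (simp add: local_at_def)

lemma local_at_const [simp]: "local_at m (\<lambda>_. c)"
  by (simp add: local_at_def)

lemma valid_upd: "valid n f \<Longrightarrow> u \<in> {1..n} \<Longrightarrow> valid (Suc n) (f(Suc n := u))"
  unfolding valid_def by (auto simp: le_Suc_eq)

lemma validD: "valid n f \<Longrightarrow> 2 \<le> i \<Longrightarrow> i \<le> n \<Longrightarrow> 1 \<le> f i \<and> f i < i"
  by (simp add: valid_def)

lemma valid_mono: "valid n f \<Longrightarrow> m \<le> n \<Longrightarrow> valid m f"
  by (simp add: valid_def)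

lemma size_induct:
  assumes "P 0" "P (Suc 0)" "\<And>n. P (Suc n) \<Longrightarrow> P (Suc (Suc n))"
  shows "P (n :: nat)"
proof -
  have "P n \<and> P (Suc n)" by (induction n) (use assms in auto)
  then show ?thesis by simp
qed

lemma ev_Suc: "1 \<le> n \<Longrightarrow> ev (Suc n) g = ev n (\<lambda>f. (\<Sum>u=1..n. g (f(Suc n := u))) / real n)"
  by (cases n) (simp_all add: ev.simps(3))

lemma ev_mono:
  assumes "\<And>f. valid n f \<Longrightarrow> g f \<le> h f"
  shows "ev n g \<le> ev n h"
  using assms
proof (induction n arbitrary: g h rule: size_induct)
  case (3 n g' h)
  show ?case unfolding ev.simps(3)
  proof (rule "3.IH")
    fix f assume "valid (Suc n) f"
    then show "(\<Sum>u=1..Suc n. g' (f(Suc (Suc n) := u))) / real (Suc n)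
            \<le> (\<Sum>u=1..Suc n. h (f(Suc (Suc n) := u))) / real (Suc n)"
      by (intro divide_right_mono sum_mono "3.prems" valid_upd) auto
  qed
qed (auto simp: valid_def)

lemma ev_cong: "(\<And>f. valid n f \<Longrightarrow> g f = h f) \<Longrightarrow> ev n g = ev n h"
  by (intro antisym ev_mono) auto

lemma ev_add: "ev n (\<lambda>f. g f + h f) = ev n g + ev n h"
proof (induction n arbitrary: g h rule: size_induct)
  case (3 n)
  show ?case unfolding ev.simps(3) "3.IH"[symmetric] by (simp only: sum.distrib add_divide_distrib)
qed auto

lemma ev_cmult: "ev n (\<lambda>f. c * g f) = c * ev n g"
proof (induction n arbitrary: g rule: size_induct)
  case (3 n)
  show ?case unfolding ev.simps(3) "3.IH"[symmetric] by (simp only: sum_distrib_left times_divide_eq_right)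
qed auto

lemma ev_divide: "ev n (\<lambda>f. g f / c) = ev n g / c"
  using ev_cmult[of n "inverse c" g] by (simp add: divide_inverse mult.commute)

lemma ev_const [simp]: "ev n (\<lambda>_. c) = c"
  by (induction n arbitrary: c rule: size_induct) (auto simp: ev.simps(3))

lemma ev_sum: "finite I \<Longrightarrow> ev n (\<lambda>f. \<Sum>i\<in>I. g i f) = (\<Sum>i\<in>I. ev n (g i))"
  by (induction I rule: finite_induct) (auto simp: ev_add)

lemma ev_nonneg: "(\<And>f. valid n f \<Longrightarrow> 0 \<le> g f) \<Longrightarrow> 0 \<le> ev n g"
  using ev_mono[of n "\<lambda>_. 0" g] by simp

abbreviation pr :: "nat \<Rightarrow> ((nat \<Rightarrow> nat) \<Rightarrow> bool) \<Rightarrow> real" where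
  "pr n A \<equiv> ev n (\<lambda>f. of_bool (A f))"

lemma pr_nonneg: "0 \<le> pr n A" by (rule ev_nonneg) auto

lemma pr_le_1: "pr n A \<le> 1"
  using ev_mono[of n "\<lambda>f. of_bool (A f)" "\<lambda>_. 1"] by auto

lemma pr_mono: "(\<And>f. valid n f \<Longrightarrow> A f \<Longrightarrow> B f) \<Longrightarrow> pr n A \<le> pr n B"
  by (rule ev_mono) auto

lemma pr_disj: "pr n (\<lambda>f. A f \<or> B f) \<le> pr n A + pr n B"
  unfolding ev_add[symmetric] by (rule ev_mono) auto

lemma pr_UN: "finite I \<Longrightarrow> (\<And>f. valid n f \<Longrightarrow> A f \<Longrightarrow> \<exists>i\<in>I. B i f) \<Longrightarrow> pr n A \<le> (\<Sum>i\<in>I. pr n (B i))"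
  unfolding ev_sum[symmetric]
proof (rule ev_mono)
  fix f assume I: "finite I" and *: "\<And>f. valid n f \<Longrightarrow> A f \<Longrightarrow> \<exists>i\<in>I. B i f" and f: "valid n f"
  show "of_bool (A f) \<le> (\<Sum>i\<in>I. of_bool (B i f) :: real)"
  proof (cases "A f")
    case True
    then obtain i where i: "i \<in> I" "B i f" using * f by blast
    have "of_bool (B i f) \<le> (\<Sum>i\<in>I. of_bool (B i f) :: real)"
      by (rule member_le_sum) (use i I in auto)
    then show ?thesis using i by auto
  qed (auto intro: sum_nonneg)
qed

lemma ev_extend:
  assumes "local_at m g" "m \<le> n" "1 \<le> m"
  shows "ev n g = ev m g"
  using assms(2)
proof (induction n rule: dec_induct)
  case (step k)
  have "ev (Suc k) g = ev k (\<lambda>f. (\<Sum>u=1..k. g f) / real k)"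
    using step assms by (subst ev_Suc) (auto simp: local_atD)
  then show ?case using step assms by auto
qed auto

section \<open>Clusters and the Polya urn\<close>

text \<open>
  The last vertex up to \<open>m\<close> on the way from \<open>x\<close> to the root, that is, the vertex of the tree at
  time \<open>m\<close> from which \<open>x\<close> descends. The test \<open>x \<le> f x\<close> makes the recursion terminate for arbitrary
  \<open>f\<close>.
\<close>

function anc :: "(nat \<Rightarrow> nat) \<Rightarrow> nat \<Rightarrow> nat \<Rightarrow> nat" where
  "anc f m x = (if x \<le> m \<or> x \<le> f x then x else anc f m (f x))"
  by auto
termination by (relation "Wellfounded.measure (\<lambda>(f, m, x). x)") auto

declare anc.simps [simp del]

lemma anc_le [simp]: "x \<le> m \<Longrightarrow> anc f m x = x"
  by (simp add: anc.simps)

lemma anc_step: "valid n f \<Longrightarrow> m < x \<Longrightarrow> 1 \<le> m \<Longrightarrow> x \<le> n \<Longrightarrow> anc f m x = anc f m (f x)"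
  using validD[of n f x] by (subst anc.simps) auto

lemma anc_upd: "x < k \<Longrightarrow> anc (f(k := u)) m x = anc f m x"
proof (induction x rule: less_induct)
  case (less x)
  then show ?case by (cases "x \<le> m \<or> x \<le> f x") (simp_all add: anc.simps[of _ _ x])
qed

lemma anc_range: "valid n f \<Longrightarrow> 1 \<le> m \<Longrightarrow> 1 \<le> x \<Longrightarrow> x \<le> n \<Longrightarrow> 1 \<le> anc f m x \<and> anc f m x \<le> m"
proof (induction x rule: less_induct)
  case (less x)
  show ?case
  proof (cases "x \<le> m")
    case False
    then have "1 \<le> f x" "f x < x" using validD[of n f x] less.prems by auto
    then show ?thesis using less False by (subst (1 2) anc_step[where n = n]) auto
  qed (use less in auto)
qed

lemma anc_anc: "valid n f \<Longrightarrow> 1 \<le> m \<Longrightarrow> m \<le> k \<Longrightarrow> x \<le> n \<Longrightarrow> anc f m (anc f k x) = anc f m x"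
proof (induction x rule: less_induct)
  case (less x)
  show ?case
  proof (cases "x \<le> k")
    case False
    then have "1 \<le> f x" "f x < x" using validD[of n f x] less.prems by auto
    then show ?thesis using less False anc_step[of n f m x] anc_step[of n f k x] by auto
  qed auto
qed

text \<open>
  The vertices descending from a set \<open>C\<close> of vertices of the tree at time \<open>m\<close>. If the vertices are
  coloured by their ancestors at time \<open>m\<close>, a new vertex takes the colour of its parent, so the
  colour classes form a Polya urn. Subtrees, their complements and unions of subtrees are all of
  this form.
\<close>

definition cluster :: "(nat \<Rightarrow> nat) \<Rightarrow> nat \<Rightarrow> nat set \<Rightarrow> nat \<Rightarrow> nat set" where
  "cluster f m C n = {x \<in> {1..n}. anc f m x \<in> C}"

lemma finite_cluster [simp]: "finite (cluster f m C n)"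
  by (simp add: cluster_def)

lemma cluster_subset: "cluster f m C n \<subseteq> {1..n}"
  by (auto simp: cluster_def)

lemma cluster_disjoint: "C \<inter> C' = {} \<Longrightarrow> cluster f m C n \<inter> cluster f m C' n = {}"
  by (auto simp: cluster_def)

lemma cluster_Un: "cluster f m (C \<union> C') n = cluster f m C n \<union> cluster f m C' n"
  by (auto simp: cluster_def)

lemma cluster_self: "cluster f m C m = C \<inter> {1..m}"
  by (auto simp: cluster_def)

lemma cluster_upd: "n < k \<Longrightarrow> cluster (f(k := u)) m C n = cluster f m C n"
  by (auto simp: cluster_def anc_upd)

text \<open>
  The urn can be restarted at an intermediate time \<open>k\<close>, which serves to condition on the parent
  chosen at that time.
\<close>

lemma cluster_cluster:
  assumes "valid n f" "1 \<le> m" "m \<le> k" "k \<le> n"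
  shows "cluster f k (cluster f m C k) n = cluster f m C n"
  using assms anc_anc[of n f m k] anc_range[of n f k] by (auto simp: cluster_def)

lemma cluster_Suc:
  assumes "valid (Suc n) f" "1 \<le> m" "m \<le> n"
  shows "cluster f m C (Suc n) = (if f (Suc n) \<in> cluster f m C n then insert (Suc n) (cluster f m C n) else cluster f m C n)"
proof -
  have "1 \<le> f (Suc n)" "f (Suc n) \<le> n" using validD[of "Suc n" f "Suc n"] assms by auto
  then show ?thesis using assms anc_step[of "Suc n" f m "Suc n"]
    by (auto simp: cluster_def le_Suc_eq)
qed

lemma cluster_Suc_upd:
  assumes "valid n f" "1 \<le> m" "m \<le> n" "u \<in> {1..n}"
  shows "cluster (f(Suc n := u)) m C (Suc n) = (if u \<in> cluster f m C n then insert (Suc n) (cluster f m C n) else cluster f m C n)"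
  using cluster_Suc[OF valid_upd, of n f u m C] assms by (simp add: cluster_upd)

lemma local_at_cluster: "local_at m C \<Longrightarrow> m \<le> n \<Longrightarrow> local_at n (\<lambda>f. cluster f m (C f) n)"
  by (simp add: local_at_def cluster_upd)

text \<open>
  One draw of the urn: the new vertex joins a cluster of size \<open>k\<close> with probability \<open>k / n\<close>. The
  factor \<open>H\<close> stands for an event, or a weight, of the past, and the initial sets may depend on the
  past as well.
\<close>

lemma urn_step:
  assumes m: "1 \<le> m" "m \<le> n" and loc: "local_at m H" "local_at m C" "local_at m C'"
    and disj: "\<And>f. C f \<inter> C' f = {}"
  shows "ev (Suc n) (\<lambda>f. H f * g (card (cluster f m (C f) (Suc n))) (card (cluster f m (C' f) (Suc n)))) =
    ev n (\<lambda>f. H f * ((\<lambda>k l. (real k * g (Suc k) l + real l * g k (Suc l) + (real n - real k - real l) * g k l) / real n)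
        (card (cluster f m (C f) n)) (card (cluster f m (C' f) n))))"
proof -
  have "(\<Sum>u=1..n. H (f(Suc n := u)) * g (card (cluster (f(Suc n := u)) m (C (f(Suc n := u))) (Suc n))) (card (cluster (f(Suc n := u)) m (C' (f(Suc n := u))) (Suc n))))
     = H f * (real k * g (Suc k) l + real l * g k (Suc l) + (real n - real k - real l) * g k l)"
    if f: "valid n f" and k: "k = card (cluster f m (C f) n)" and l: "l = card (cluster f m (C' f) n)" for f k l
  proof -
    define A B where "A = cluster f m (C f) n" and "B = cluster f m (C' f) n"
    have AB: "A \<inter> B = {}" "A \<subseteq> {1..n}" "B \<subseteq> {1..n}"
      unfolding A_def B_def using cluster_disjoint[OF disj] cluster_subset by auto
    have fin: "finite A" "finite B" by (auto simp: A_def B_def)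
    have nin: "Suc n \<notin> A" "Suc n \<notin> B" using AB by auto
    have "(\<Sum>u=1..n. H (f(Suc n := u)) * g (card (cluster (f(Suc n := u)) m (C (f(Suc n := u))) (Suc n))) (card (cluster (f(Suc n := u)) m (C' (f(Suc n := u))) (Suc n))))
        = (\<Sum>u=1..n. H f * (if u \<in> A then g (Suc k) l else if u \<in> B then g k (Suc l) else g k l))"
    proof (rule sum.cong)
      fix u assume u: "u \<in> {1..n}"
      show "H (f(Suc n := u)) * g (card (cluster (f(Suc n := u)) m (C (f(Suc n := u))) (Suc n))) (card (cluster (f(Suc n := u)) m (C' (f(Suc n := u))) (Suc n)))
        = H f * (if u \<in> A then g (Suc k) l else if u \<in> B then g k (Suc l) else g k l)"
        using u f m loc AB fin nin
        by (auto simp: cluster_Suc_upd local_atD k l A_def[symmetric] B_def[symmetric])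
    qed auto
    also have "\<dots> = H f * (\<Sum>u=1..n. (if u \<in> A then g (Suc k) l else if u \<in> B then g k (Suc l) else g k l))"
      by (simp add: sum_distrib_left)
    also have "(\<Sum>u=1..n. (if u \<in> A then g (Suc k) l else if u \<in> B then g k (Suc l) else g k l))
       = (\<Sum>u\<in>A. g (Suc k) l) + (\<Sum>u\<in>B. g k (Suc l)) + (\<Sum>u\<in>{1..n} - A - B. g k l)"
    proof -
      have eq: "{1..n} = A \<union> B \<union> ({1..n} - A - B)" using AB by auto
      show ?thesis
        apply (subst eq)
        apply (subst sum.union_disjoint)
        using fin AB apply auto[3]
        apply (subst sum.union_disjoint)
        using fin AB apply auto[3]
        apply (intro arg_cong2[where f = "(+)"] sum.cong)
        using AB by auto
    qed
    also have "\<dots> = real k * g (Suc k) l + real l * g k (Suc l) + (real n - real k - real l) * g k l"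
    proof -
      have "card ({1..n} - A - B) = n - card A - card B"
        using AB fin by (subst card_Diff_subset, auto)+
      moreover have "card A + card B \<le> n"
        using card_mono[of "{1..n}" "A \<union> B"] card_Un_disjoint[of A B] AB fin by auto
      ultimately show ?thesis by (simp add: k l A_def[symmetric] B_def[symmetric] of_nat_diff)
    qed
    finally show ?thesis .
  qed
  note * = this
  show ?thesis
    apply (subst ev_Suc)
    using m apply simp
    apply (rule ev_cong)
    apply (subst *)
       apply (assumption, rule refl, rule refl)
    apply simp
    done
qed

lemma card_cluster_le:
  assumes "C \<inter> C' = {}"
  shows "card (cluster f m C n) + card (cluster f m C' n) \<le> n"
  using card_mono[of "{1..n}" "cluster f m C n \<union> cluster f m C' n"] cluster_subset[of f m C n] cluster_subset[of f m C' n]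
    card_Un_disjoint[OF finite_cluster finite_cluster cluster_disjoint[OF assms, of f m n]] by simp

text \<open>
  Products of rising factorials are eigenfunctions of the urn: one draw multiplies their
  expectation by \<open>(n + r + s) / n\<close>, and these factors telescope.
\<close>

lemma urn_moments:
  assumes m: "1 \<le> m" "m \<le> n" and loc: "local_at m H" "local_at m C" "local_at m C'"
    and disj: "\<And>f. C f \<inter> C' f = {}"
  shows "ev n (\<lambda>f. H f * (pochhammer (real (card (cluster f m (C f) n))) r * pochhammer (real (card (cluster f m (C' f) n))) s)) =
     pochhammer (real n) (r + s) / pochhammer (real m) (r + s) *
     ev m (\<lambda>f. H f * (pochhammer (real (card (cluster f m (C f) m))) r * pochhammer (real (card (cluster f m (C' f) m))) s))"
  using m(2)
proof (induction n rule: dec_induct)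
  case base
  have "pochhammer (real m) (r + s) \<noteq> 0" using pochhammer_pos[of "real m" "r + s"] m by simp
  then show ?case by simp
next
  case (step n)
  have 1: "(real k * (pochhammer (real (Suc k)) r * pochhammer (real l) s) + real l * (pochhammer (real k) r * pochhammer (real (Suc l)) s)
      + (real n - real k - real l) * (pochhammer (real k) r * pochhammer (real l) s)) / real n
     = (real n + real (r + s)) / real n * (pochhammer (real k) r * pochhammer (real l) s)" for k l
  proof -
    have "x * pochhammer (1 + x) j = (x + real j) * pochhammer x j" for x :: real and j
      using pochhammer_rec[of x j] pochhammer_Suc[of x j] by (simp add: mult.commute add.commute)
    then have "real k * (pochhammer (real (Suc k)) r * pochhammer (real l) s) = (real k + real r) * (pochhammer (real k) r * pochhammer (real l) s)"
       "real l * (pochhammer (real k) r * pochhammer (real (Suc l)) s) = (real l + real s) * (pochhammer (real k) r * pochhammer (real l) s)"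
      by (metis of_nat_Suc mult.assoc mult.left_commute)+
    then show ?thesis by (simp add: algebra_simps)
  qed
  have "pochhammer (1 + real n) (r + s) = (real n + real (r + s)) / real n * pochhammer (real n) (r + s)"
    using pochhammer_rec[of "real n" "r+s"] pochhammer_Suc[of "real n" "r+s"] step m by (simp add: field_simps)
  then show ?case
    using step m
    by (subst urn_step[OF m(1) _ loc disj, where g = "\<lambda>k l. pochhammer (real k) r * pochhammer (real l) s"])
       (simp_all only: 1 mult.left_commute[of _ "(real n + real (r + s)) / real n"] ev_cmult, simp add: mult.assoc)
qed

text \<open>
  The forward equation of the urn.
\<close>

lemma urn_pmf_step:
  fixes H C C' m
  defines "P \<equiv> \<lambda>n k l. ev n (\<lambda>f. H f * of_bool (card (cluster f m (C f) n) = k \<and> card (cluster f m (C' f) n) = l))"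
  assumes m: "1 \<le> m" "m \<le> n" and loc: "local_at m H" "local_at m C" "local_at m C'"
    and disj: "\<And>f. C f \<inter> C' f = {}"
  shows "P (Suc n) k l = (real (k - 1) * P n (k - 1) l + real (l - 1) * P n k (l - 1) + real (n - k - l) * P n k l) / real n"
proof -
  have 1: "H f * ((real k' * of_bool (Suc k' = k \<and> l' = l) + real l' * of_bool (k' = k \<and> Suc l' = l) + (real n - real k' - real l') * of_bool (k' = k \<and> l' = l)) / real n)
      = (real (k - 1) * (H f * of_bool (k' = k - 1 \<and> l' = l)) + real (l - 1) * (H f * of_bool (k' = k \<and> l' = l - 1)) + real (n - k - l) * (H f * of_bool (k' = k \<and> l' = l))) / real n"
    if "k' + l' \<le> n" for k' l' f
    using that by (cases k; cases l) (auto simp: of_bool_def of_nat_diff)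
  show ?thesis
    unfolding P_def ev_cmult[symmetric] ev_add[symmetric] ev_divide[symmetric]
    by (subst urn_step[OF m loc disj, where g = "\<lambda>k' l'. of_bool (k' = k \<and> l' = l)"])
       (intro ev_cong 1 card_cluster_le disj)
qed

text \<open>
  In the forward equation the weights \<open>(k - 1) / n\<close> and \<open>(n - k) / n\<close> add up to \<open>(n - 1) / n\<close>. A
  bound that is uniform in \<open>k\<close> is therefore multiplied by \<open>(n - 1) / n\<close> at each draw.
\<close>

lemma urn_density1:
  assumes m: "2 \<le> m" "m \<le> n" and loc: "local_at m H" "local_at m C"
    and q: "\<And>k. ev m (\<lambda>f. H f * of_bool (card (cluster f m (C f) m) = k)) \<le> q"
    and k: "1 \<le> k" "k < n"
  shows "ev n (\<lambda>f. H f * of_bool (card (cluster f m (C f) n) = k)) \<le> q * (real m - 1) / (real n - 1)"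
proof -
  let ?P = "\<lambda>n k l. ev n (\<lambda>f. H f * of_bool (card (cluster f m (C f) n) = k \<and> card (cluster f m {} n) = l))"
  have [simp]: "card (cluster f m {} n) = 0" for f n by (simp add: cluster_def)
  have "?P n k 0 \<le> q * (real m - 1) / (real n - 1)"
    using m(2) k
  proof (induction n arbitrary: k rule: dec_induct)
    case base
    show ?case using m q[of k] by simp
  next
    case (step n)
    let ?M = "q * (real m - 1) / (real n - 1)"
    have "?P (Suc n) k 0 = (real (k - 1) * ?P n (k - 1) 0 + real (n - k) * ?P n k 0) / real n"
      using urn_pmf_step[of m n H C "\<lambda>_. {}" k 0] step m loc by simp
    also have "\<dots> \<le> (real (k - 1) * ?M + real (n - k) * ?M) / real n"
    proof (intro divide_right_mono add_mono)
      show "real (k - 1) * ?P n (k - 1) 0 \<le> real (k - 1) * ?M"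
        using step by (cases "k = 1") (simp, intro mult_left_mono step.IH, auto)
      show "real (n - k) * ?P n k 0 \<le> real (n - k) * ?M"
        using step by (cases "k = n") (simp, intro mult_left_mono step.IH, auto)
    qed auto
    also have "\<dots> = (real (k - 1) + real (n - k)) * ?M / real n"
      by (simp only: distrib_right)
    also have "real (k - 1) + real (n - k) = real n - 1"
      using step by (simp add: of_nat_diff)
    also have "(real n - 1) * ?M / real n = q * (real m - 1) / (real (Suc n) - 1)"
      using step m by simp
    finally show ?case .
  qed
  then show ?thesis by simp
qed

text \<open>
  As for one colour; now the three weights of the forward equation add up to \<open>(n - 2) / n\<close>.
\<close>

lemma urn_density2:
  assumes m: "3 \<le> m" "m \<le> n" and loc: "local_at m H" "local_at m C" "local_at m C'"
    and disj: "\<And>f. C f \<inter> C' f = {}"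
    and q: "\<And>k l. ev m (\<lambda>f. H f * of_bool (card (cluster f m (C f) m) = k \<and> card (cluster f m (C' f) m) = l)) \<le> q"
    and k: "1 \<le> k" "1 \<le> l" "k + l < n"
  shows "ev n (\<lambda>f. H f * of_bool (card (cluster f m (C f) n) = k \<and> card (cluster f m (C' f) n) = l))
      \<le> q * ((real m - 1) * (real m - 2) / ((real n - 1) * (real n - 2)))"
proof -
  let ?P = "\<lambda>n k l. ev n (\<lambda>f. H f * of_bool (card (cluster f m (C f) n) = k \<and> card (cluster f m (C' f) n) = l))"
  show "?P n k l \<le> q * ((real m - 1) * (real m - 2) / ((real n - 1) * (real n - 2)))"
    using m(2) k
  proof (induction n arbitrary: k l rule: dec_induct)
    case base
    show ?case using m q[of k l] by simp
  next
    case (step n)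
    let ?M = "q * ((real m - 1) * (real m - 2) / ((real n - 1) * (real n - 2)))"
    have "?P (Suc n) k l = (real (k - 1) * ?P n (k - 1) l + real (l - 1) * ?P n k (l - 1) + real (n - k - l) * ?P n k l) / real n"
      using urn_pmf_step[of m n H C C' k l] step m loc disj by simp
    also have "\<dots> \<le> (real (k - 1) * ?M + real (l - 1) * ?M + real (n - k - l) * ?M) / real n"
    proof (intro divide_right_mono add_mono)
      show "real (k - 1) * ?P n (k - 1) l \<le> real (k - 1) * ?M"
        using step by (cases "k = 1") (simp, intro mult_left_mono step.IH, auto)
      show "real (l - 1) * ?P n k (l - 1) \<le> real (l - 1) * ?M"
        using step by (cases "l = 1") (simp, intro mult_left_mono step.IH, auto)
      show "real (n - k - l) * ?P n k l \<le> real (n - k - l) * ?M"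
        using step by (cases "k + l = n") (simp, intro mult_left_mono step.IH, auto)
    qed auto
    also have "\<dots> = (real (k - 1) + real (l - 1) + real (n - k - l)) * ?M / real n"
      by (simp only: distrib_right)
    also have "real (k - 1) + real (l - 1) + real (n - k - l) = real n - 2"
      using step by (simp add: of_nat_diff)
    also have "(real n - 2) * ?M / real n = q * ((real m - 1) * (real m - 2) / ((real (Suc n) - 1) * (real (Suc n) - 2)))"
      using step m by simp
    finally show ?case .
  qed
qed

text \<open>
  Two colours that start with one vertex each have a flat joint law in the bulk: the profile
  \<open>1 - (m - 2) * (k + l - 2) / (n - 2)\<close>, times the factor of the upper bound, is a subsolution of
  the forward equation, and it is an equality for \<open>k = l = 1\<close> at time \<open>m\<close>.
\<close>

lemma urn_density_lower:
  assumes m: "3 \<le> m" "m \<le> n" and loc: "local_at m H" "local_at m C" "local_at m C'"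
    and disj: "\<And>f. C f \<inter> C' f = {}"
    and H0: "\<And>f. 0 \<le> H f"
    and H: "\<And>f. valid m f \<Longrightarrow> H f \<noteq> 0 \<Longrightarrow> card (cluster f m (C f) m) = 1 \<and> card (cluster f m (C' f) m) = 1"
    and k: "1 \<le> k" "1 \<le> l"
  shows "ev n (\<lambda>f. H f * of_bool (card (cluster f m (C f) n) = k \<and> card (cluster f m (C' f) n) = l))
      \<ge> ev m H * ((real m - 1) * (real m - 2) / ((real n - 1) * (real n - 2)))
           * (1 - (real m - 2) * (real k + real l - 2) / (real n - 2))"
proof -
  let ?P = "\<lambda>n k l. ev n (\<lambda>f. H f * of_bool (card (cluster f m (C f) n) = k \<and> card (cluster f m (C' f) n) = l))"
  define a where "a n = ev m H * ((real m - 1) * (real m - 2) / ((real n - 1) * (real n - 2)))" for n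
  define b where "b n = (real m - 2) / (real n - 2)" for n
  have h0: "0 \<le> ev m H" by (rule ev_nonneg) (rule H0)
  have P0: "0 \<le> ?P n k l" for n k l by (rule ev_nonneg) (use H0 in auto)
  have "a n * (1 - b n * (real k + real l - 2)) \<le> ?P n k l"
    using m(2) k
  proof (induction n arbitrary: k l rule: dec_induct)
    case base
    have am: "a m = ev m H" "b m = 1" using m by (auto simp: a_def b_def)
    show ?case
    proof (cases "k = 1 \<and> l = 1")
      case True
      have "?P m 1 1 = ev m H" using H by (intro ev_cong) auto
      then show ?thesis using True am by simp
    next
      case False
      then have "a m * (1 - b m * (real k + real l - 2)) \<le> 0"
        unfolding am using base h0 by (intro mult_nonneg_nonpos) auto
      then show ?thesis using P0[of m k l] by linarith
    qed
  next
    case (step n)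
    have n3: "3 \<le> n" using step m by simp
    have a0: "0 \<le> a n" "0 \<le> a (Suc n)" unfolding a_def using h0 m n3 by (auto intro!: mult_nonneg_nonneg divide_nonneg_nonneg)
    show ?case
    proof (cases "k + l \<le> n")
      case False
      then have "real k + real l - 2 \<ge> real n - 1" by linarith
      then have "1 \<le> b (Suc n) * (real k + real l - 2)"
        unfolding b_def using m n3 mult_mono[of 1 "real m - 2" "real n - 1" "real k + real l - 2"] by (simp add: field_simps)
      then have "a (Suc n) * (1 - b (Suc n) * (real k + real l - 2)) \<le> 0"
        using a0 by (intro mult_nonneg_nonpos) auto
      then show ?thesis using P0[of "Suc n" k l] by linarith
    next
      case True
      have e: "?P (Suc n) k l = (real (k - 1) * ?P n (k - 1) l + real (l - 1) * ?P n k (l - 1) + real (n - k - l) * ?P n k l) / real n"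
        using urn_pmf_step[of m n H C C' k l] step m loc disj by simp
      define s where "s = real k + real l"
      let ?L = "a n * (1 - b n * (s - 3))"
      have "(real (k - 1) * ?L + real (l - 1) * ?L + real (n - k - l) * (a n * (1 - b n * (s - 2)))) / real n \<le> ?P (Suc n) k l"
        unfolding e
      proof (intro divide_right_mono add_mono)
        show "real (k - 1) * ?L \<le> real (k - 1) * ?P n (k - 1) l"
        proof (cases "k = 1")
          case False
          then have "real (k - 1) + real l - 2 = s - 3" "1 \<le> k - 1" using step.prems by (auto simp: s_def of_nat_diff)
          then show ?thesis using step.IH[of "k - 1" l] step.prems by (intro mult_left_mono) auto
        qed simp
        show "real (l - 1) * ?L \<le> real (l - 1) * ?P n k (l - 1)"
        proof (cases "l = 1")
          case False
          then have "real k + real (l - 1) - 2 = s - 3" "1 \<le> l - 1" using step.prems by (auto simp: s_def of_nat_diff)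
          then show ?thesis using step.IH[of k "l - 1"] step.prems by (intro mult_left_mono) auto
        qed simp
        show "real (n - k - l) * (a n * (1 - b n * (s - 2))) \<le> real (n - k - l) * ?P n k l"
          using step.IH[of k l] step.prems unfolding s_def by (auto intro!: mult_left_mono)
      qed auto
      moreover have "(real (k - 1) * ?L + real (l - 1) * ?L + real (n - k - l) * (a n * (1 - b n * (s - 2)))) / real n
          = a n / real n * ((real n - 2) - b n * (s - 2) * (real n - 3))"
        using True step.prems n3 by (simp add: s_def of_nat_diff field_simps)
      moreover have aS: "a (Suc n) = a n / real n * (real n - 2)"
        using n3 by (simp add: a_def)
      moreover have "b n * (s - 2) * (real n - 3) \<le> b (Suc n) * (s - 2) * (real n - 2)"
      proof -
        have "(real n - 3) * (real n - 1) \<le> (real n - 2)\<^sup>2" by (simp add: power2_eq_square algebra_simps)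
        then have "b n * (real n - 3) \<le> b (Suc n) * (real n - 2)"
          unfolding b_def using n3 m mult_left_mono[of "(real n - 3) * (real n - 1)" "(real n - 2)\<^sup>2" "real m - 2"]
          by (simp add: field_simps power2_eq_square)
        moreover have "0 \<le> s - 2" using step.prems by (simp add: s_def)
        ultimately show ?thesis using mult_right_mono[of "b n * (real n - 3)" "b (Suc n) * (real n - 2)" "s - 2"]
          by (simp add: mult.commute mult.left_commute)
      qed
      ultimately have "(a n / real n) * ((real n - 2) - (b (Suc n) * (s - 2)) * (real n - 2)) \<le> ?P (Suc n) k l"
        using mult_left_mono[of "(real n - 2) - b (Suc n) * (s - 2) * (real n - 2)" "(real n - 2) - b n * (s - 2) * (real n - 3)" "a n / real n"] a0
        by (simp add: algebra_simps)
      moreover have "c * (x - y * x) = (c * x) * (1 - y)" for c x y :: real by (simp add: algebra_simps)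
      ultimately have "a (Suc n) * (1 - b (Suc n) * (s - 2)) \<le> ?P (Suc n) k l"
        unfolding aS by metis
      then show ?thesis by (simp add: s_def)
    qed
  qed
  then show ?thesis by (simp add: a_def b_def)
qed

section \<open>Subtrees and centralities in terms of parents\<close>

definition tree_of :: "(nat \<Rightarrow> nat) \<Rightarrow> nat \<Rightarrow> tree" where
  "tree_of f n = (\<lambda>i. {f i, i}) ` {2..n}"

text \<open>
  A vertex counts as its own descendant.
\<close>

abbreviation desc :: "(nat \<Rightarrow> nat) \<Rightarrow> nat \<Rightarrow> nat \<Rightarrow> nat set" where
  "desc f n w \<equiv> cluster f w {w} n"

abbreviation D :: "(nat \<Rightarrow> nat) \<Rightarrow> nat \<Rightarrow> nat \<Rightarrow> nat" where
  "D f n w \<equiv> card (desc f n w)"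

lemma edge_iff: "{x, y} \<in> tree_of f n \<longleftrightarrow> (y \<in> {2..n} \<and> x = f y) \<or> (x \<in> {2..n} \<and> y = f x)"
  by (auto simp: tree_of_def doubleton_eq_iff)

lemma edge_range:
  assumes "valid n f" "{x, y} \<in> tree_of f n"
  shows "x \<in> {1..n} \<and> y \<in> {1..n}"
  using assms(2) validD[OF assms(1), of x] validD[OF assms(1), of y] by (auto simp: edge_iff)

lemma desc_ge:
  assumes "valid n f" "1 \<le> w" "x \<in> desc f n w"
  shows "w \<le> x" "x \<le> n"
proof -
  show "x \<le> n" using assms by (auto simp: cluster_def)
  show "w \<le> x"
  proof (rule ccontr)
    assume "\<not> w \<le> x"
    then show False using assms by (auto simp: cluster_def)
  qed
qed

lemma desc_self: "1 \<le> w \<Longrightarrow> w \<le> n \<Longrightarrow> w \<in> desc f n w"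
  by (auto simp: cluster_def)

lemma desc_parent:
  assumes "valid n f" "1 \<le> w" "x \<in> {2..n}" "x \<noteq> w"
  shows "x \<in> desc f n w \<longleftrightarrow> f x \<in> desc f n w"
proof (cases "x \<le> w")
  case True
  have "1 \<le> f x \<and> f x < x" using assms(3) by (intro validD[OF assms(1)]) simp_all
  then have "f x < w" "x < w" using True assms(4) by linarith+
  then have "anc f w x = x" "anc f w (f x) = f x" by simp_all
  then show ?thesis unfolding cluster_def using \<open>f x < w\<close> \<open>x < w\<close> by simp
next
  case False
  have "anc f w x = anc f w (f x)" using False assms by (intro anc_step[OF assms(1)]) auto
  moreover have "1 \<le> f x \<and> f x < x" using assms(3) by (intro validD[OF assms(1)]) simp_all
  moreover have "1 \<le> x" "x \<le> n" using assms(3) by simp_all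
  ultimately show ?thesis unfolding cluster_def by simp
qed

lemma desc_1:
  assumes "valid n f"
  shows "desc f n 1 = {1..n}"
proof -
  have "anc f 1 x = 1" if "1 \<le> x" "x \<le> n" for x
    using anc_range[OF assms _ that, of 1] by linarith
  then show ?thesis by (auto simp: cluster_def)
qed

lemma desc_trans:
  assumes "valid n f" "1 \<le> w" "c \<in> desc f n w"
  shows "desc f n c \<subseteq> desc f n w"
proof
  fix x assume x: "x \<in> desc f n c"
  have "w \<le> c" using desc_ge assms by blast
  then have "anc f w x = anc f w (anc f c x)" using anc_anc[OF assms(1,2), of c x] x by (auto simp: cluster_def)
  then show "x \<in> desc f n w" using x assms by (auto simp: cluster_def)
qed

text \<open>
  Two ancestors of a vertex are comparable.
\<close>

lemma desc_meet:
  assumes "valid n f" "1 \<le> w" "w \<le> c" "c \<le> n" "x \<in> desc f n c" "x \<in> desc f n w"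
  shows "c \<in> desc f n w"
  using anc_anc[OF assms(1,2,3), of x] assms by (auto simp: cluster_def)

lemma desc_disjoint:
  assumes "valid n f" "1 \<le> w" "w \<le> c" "c \<le> n" "c \<notin> desc f n w"
  shows "desc f n c \<inter> desc f n w = {}"
  using desc_meet[OF assms(1-4)] assms(5) by blast

lemma desc_child:
  assumes "valid n f" "c \<in> {2..n}"
  shows "desc f n c \<subseteq> desc f n (f c)"
proof -
  have "1 \<le> f c" "f c < c" using validD[of n f c] assms by auto
  then have "f c \<in> desc f n (f c)" "c \<noteq> f c" using assms by (auto intro: desc_self)
  then have "c \<in> desc f n (f c)" using desc_parent[OF assms(1) \<open>1 \<le> f c\<close> assms(2)] by blast
  then show ?thesis by (rule desc_trans[OF assms(1) \<open>1 \<le> f c\<close>])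
qed

lemma D_child: "valid n f \<Longrightarrow> c \<in> {2..n} \<Longrightarrow> D f n c \<le> D f n (f c)"
  by (intro card_mono desc_child) auto

lemma D_le: "D f n w \<le> n"
  using card_mono[OF _ cluster_subset[of f w "{w}" n]] by simp

lemma D_1: "valid n f \<Longrightarrow> D f n 1 = n"
  by (simp add: desc_1 del: One_nat_def)

lemma D_add_le:
  assumes "desc f n u \<inter> desc f n m = {}"
  shows "D f n u + D f n m \<le> n"
  using card_mono[of "{1..n}" "desc f n u \<union> desc f n m"] cluster_subset[of f u "{u}" n] cluster_subset[of f m "{m}" n]
    card_Un_disjoint[OF finite_cluster finite_cluster assms] by simp

lemma D_pos: "1 \<le> w \<Longrightarrow> w \<le> n \<Longrightarrow> 1 \<le> D f n w"
  using desc_self[of w n f] card_gt_0_iff[of "desc f n w"] by fastforce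

lemma siblings_disjoint:
  assumes "valid n f" "c \<in> {2..n}" "c' \<in> {2..n}" "f c = f c'" "c \<noteq> c'"
  shows "desc f n c \<inter> desc f n c' = {}"
proof -
  have *: "desc f n c \<inter> desc f n c' = {}" if "c \<in> {2..n}" "c' \<in> {2..n}" "f c = f c'" "c' < c" for c c'
  proof (rule desc_disjoint)
    have "f c < c'" using validD[OF assms(1), of c'] that by auto
    then have "f c \<notin> desc f n c'" using desc_ge[OF assms(1), of c' "f c"] that by auto
    then show "c \<notin> desc f n c'" using desc_parent[OF assms(1), of c' c] that by auto
  qed (use that assms in auto)
  show ?thesis using *[of c c'] *[of c' c] assms by (cases "c' < c") auto
qed

text \<open>
  Loop erasure: whenever a walk returns to a vertex of the path built so far, the path is cut back
  there.
\<close>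

lemma path_in_set:
  assumes "(v, w) \<in> {(x, y). E x y \<and> x \<in> X \<and> y \<in> X}\<^sup>*" "v \<in> X"
  shows "\<exists>p. p \<noteq> [] \<and> hd p = v \<and> last p = w \<and> distinct p \<and> successively E p \<and> set p \<subseteq> X"
  using assms(1)
proof (induction rule: rtrancl_induct)
  case base
  show ?case using assms(2) by (intro exI[of _ "[v]"]) auto
next
  case (step y z)
  then obtain p where p: "p \<noteq> []" "hd p = v" "last p = y" "distinct p" "successively E p" "set p \<subseteq> X" by blast
  show ?case
  proof (cases "z \<in> set p")
    case True
    then obtain a b where ab: "p = a @ z # b" by (meson split_list)
    have "successively E (a @ [z])" using p(5) by (auto simp: ab successively_append_iff)
    then show ?thesis using p unfolding ab by (intro exI[of _ "a @ [z]"]) (cases a; auto)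
  next
    case False
    then show ?thesis using p step by (intro exI[of _ "p @ [z]"]) (auto simp: successively_append_iff)
  qed
qed

lemma path_stays:
  assumes "successively E (x # ys)" "x \<in> X" "u \<notin> set ys" "\<And>x y. E x y \<Longrightarrow> x \<in> X \<Longrightarrow> y \<notin> X \<Longrightarrow> y = u"
  shows "set ys \<subseteq> X"
  using assms(1-3)
proof (induction ys arbitrary: x)
  case (Cons y ys)
  then have "y \<in> X" using assms(4)[of x y] by auto
  then show ?case using Cons by auto
qed auto

text \<open>
  A simple path that starts at \<open>u\<close> and has entered \<open>X\<close> cannot leave it, since it could only do so
  through \<open>u\<close>; so the subtree of \<open>v\<close> is contained in \<open>X\<close>. Connectedness of \<open>X\<close> gives the converse.
\<close>

lemma subtree_eqI:
  assumes uv: "{u, v} \<in> t" and X: "v \<in> X" "u \<notin> X"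
    and cut: "\<And>x y. {x, y} \<in> t \<Longrightarrow> x \<in> X \<Longrightarrow> y \<notin> X \<Longrightarrow> y = u"
    and conn: "\<And>w. w \<in> X \<Longrightarrow> (v, w) \<in> {(x, y). {x, y} \<in> t \<and> x \<in> X \<and> y \<in> X}\<^sup>*"
  shows "subtree t u v = X"
proof (intro equalityI subsetI)
  fix w assume "w \<in> X"
  from path_in_set[OF conn[OF this] X(1)] obtain p where p: "p \<noteq> []" "hd p = v" "last p = w" "distinct p"
    "successively (\<lambda>x y. {x, y} \<in> t) p" "set p \<subseteq> X" by blast
  have "path_between t u w (u # p)" using p X uv unfolding path_between_def
    by (auto simp: successively_Cons)
  moreover have "v \<in> set (u # p)" using p hd_in_set[of p] by auto
  ultimately show "w \<in> subtree t u v" unfolding subtree_def by blast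
next
  fix w assume "w \<in> subtree t u v"
  then obtain p where p: "path_between t u w p" "v \<in> set p" by (auto simp: subtree_def)
  then obtain xs ys where xy: "p = xs @ v # ys" by (meson split_list)
  have "u \<noteq> v" using X by auto
  then have "u \<in> set xs" using p xy by (cases xs) (auto simp: path_between_def)
  then have "u \<notin> set ys" using p xy by (auto simp: path_between_def)
  moreover have "successively (\<lambda>x y. {x, y} \<in> t) (v # ys)"
    using p xy by (auto simp: path_between_def successively_append_iff)
  ultimately have "set ys \<subseteq> X" using X cut by (intro path_stays[where x = v and E = "\<lambda>x y. {x, y} \<in> t" and u = u]) auto
  then have "last (v # ys) \<in> X" using X last_in_set[of "v # ys"] by auto
  then show "w \<in> X" using p xy by (auto simp: path_between_def)
qed

lemma desc_cut:
  assumes "valid n f" "w \<in> {2..n}" "{x, y} \<in> tree_of f n" "x \<in> desc f n w" "y \<notin> desc f n w"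
  shows "x = w \<and> y = f w"
  using assms desc_parent[OF assms(1), of w x] desc_parent[OF assms(1), of w y] desc_self[of w n f]
  by (cases "y = w"; cases "x = w") (auto simp: edge_iff)

text \<open>
  Removing the edge between a vertex and its parent separates the descendants of the vertex from
  all other vertices. This and the next fact express the centralities through the numbers \<open>D\<close>.
\<close>

lemma subtree_parent:
  assumes v: "valid n f" "w \<in> {2..n}"
  shows "subtree (tree_of f n) (f w) w = desc f n w"
proof (rule subtree_eqI)
  let ?R = "{(x, y). {x, y} \<in> tree_of f n \<and> x \<in> desc f n w \<and> y \<in> desc f n w}"
  show "{f w, w} \<in> tree_of f n" "w \<in> desc f n w"
    using v by (auto simp: edge_iff intro!: desc_self)
  show "f w \<notin> desc f n w"
    using validD[OF v(1), of w] desc_ge[OF v(1), of w "f w"] v(2) by auto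
  show "y = f w" if "{x, y} \<in> tree_of f n" "x \<in> desc f n w" "y \<notin> desc f n w" for x y
    using desc_cut[OF v that] by simp
  show "(w, x) \<in> ?R\<^sup>*" if "x \<in> desc f n w" for x
    using that
  proof (induction x rule: less_induct)
    case (less x)
    show ?case
    proof (cases "x = w")
      case False
      then have x: "x \<in> {2..n}" "x \<noteq> w" using desc_ge[OF v(1) _ less.prems] v(2) by auto
      then have "f x \<in> desc f n w" "f x < x" "{f x, x} \<in> tree_of f n" using desc_parent[OF v(1), of w x] validD[OF v(1), of x] v(2) less.prems
        by (auto simp: edge_iff)
      then have "(f x, x) \<in> ?R" using less.prems by blast
      then show ?thesis using less.IH[OF \<open>f x < x\<close> \<open>f x \<in> desc f n w\<close>] rtrancl_into_rtrancl[of w "f x" ?R x] by blast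
    qed auto
  qed
qed

lemma subtree_child:
  assumes v: "valid n f" "c \<in> {2..n}"
  shows "subtree (tree_of f n) c (f c) = {1..n} - desc f n c"
proof (rule subtree_eqI)
  let ?X = "{1..n} - desc f n c"
  let ?R = "{(x, y). {x, y} \<in> tree_of f n \<and> x \<in> ?X \<and> y \<in> ?X}"
  have fc: "1 \<le> f c" "f c < c" using validD[OF v(1), of c] v by auto
  show "{c, f c} \<in> tree_of f n" "c \<notin> ?X"
    using v by (auto simp: edge_iff desc_self)
  show fX: "f c \<in> ?X" using fc desc_ge[OF v(1), of c "f c"] v(2) by auto
  show "y = c" if "{x, y} \<in> tree_of f n" "x \<in> ?X" "y \<notin> ?X" for x y
    using desc_cut[OF v, of y x] that edge_range[OF v(1) that(1)] by (auto simp: insert_commute)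
  have sym: "sym (?R\<^sup>*)" by (intro sym_rtrancl) (auto simp: sym_def insert_commute)
  have root: "(x, 1) \<in> ?R\<^sup>*" if "x \<in> ?X" for x
    using that
  proof (induction x rule: less_induct)
    case (less x)
    show ?case
    proof (cases "x = 1")
      case False
      then have x: "x \<in> {2..n}" "x \<noteq> c" using less.prems desc_self[of c n f] v by auto
      then have "f x \<notin> desc f n c" "1 \<le> f x" "f x < x" "{x, f x} \<in> tree_of f n"
        using desc_parent[OF v(1), of c x] validD[OF v(1), of x] v(2) less.prems by (auto simp: edge_iff)
      then have fx: "f x \<in> ?X" "f x < x" "(x, f x) \<in> ?R" using x less.prems by auto
      then show ?thesis using less.IH[OF fx(2,1)] converse_rtrancl_into_rtrancl[of x "f x" ?R 1] by blast
    qed auto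
  qed
  show "(f c, x) \<in> ?R\<^sup>*" if "x \<in> ?X" for x
    using rtrancl_trans[OF root[OF fX] symD[OF sym root[OF that]]] .
qed

lemma card_subtree_child:
  assumes "valid n f" "c \<in> {2..n}"
  shows "card (subtree (tree_of f n) c (f c)) = n - D f n c"
  unfolding subtree_child[OF assms] using cluster_subset[of f c "{c}" n] by (subst card_Diff_subset) auto

lemma neighbors_iff:
  "u \<in> neighbors (tree_of f n) v \<longleftrightarrow> (v \<in> {2..n} \<and> u = f v) \<or> (u \<in> {2..n} \<and> f u = v)"
  by (auto simp: neighbors_def edge_iff)

lemma finite_neighbors: "finite (neighbors (tree_of f n) v)"
  by (rule finite_subset[of _ "insert (f v) {2..n}"]) (auto simp: neighbors_iff)

lemma neighbors_nonempty:
  assumes "valid n f" "2 \<le> n" "v \<in> {1..n}"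
  shows "neighbors (tree_of f n) v \<noteq> {}"
proof (cases "v = 1")
  case True
  have "f 2 = 1" using validD[OF assms(1), of 2] assms by auto
  then have "2 \<in> neighbors (tree_of f n) v" using True assms by (auto simp: neighbors_iff)
  then show ?thesis by blast
next
  case False
  then have "f v \<in> neighbors (tree_of f n) v" using assms by (auto simp: neighbors_iff)
  then show ?thesis by blast
qed

context
  fixes n :: nat and f :: "nat \<Rightarrow> nat"
  assumes vf: "valid n f" and n2: "2 \<le> n"
begin

abbreviation "J \<equiv> jordan (tree_of f n)"
abbreviation "J2 \<equiv> jordan2 (tree_of f n)"

lemma jordan_le_desc: "w \<in> {2..n} \<Longrightarrow> J w \<le> D f n w"
  unfolding jordan_def subtree_parent[OF vf, symmetric]
  by (rule Min_le) (auto simp: finite_neighbors neighbors_iff)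

lemma jordan_le_child: "c \<in> {2..n} \<Longrightarrow> J (f c) \<le> n - D f n c"
  unfolding jordan_def card_subtree_child[OF vf, symmetric]
  by (rule Min_le) (auto simp: finite_neighbors neighbors_iff)

text \<open>
  The neighbors are the parent and the children, so the Jordan centrality is the minimum of
  \<open>n - D c\<close> over the children \<open>c\<close> and, for a vertex other than the root, of \<open>D w\<close>.
\<close>

lemma jordan_ge:
  assumes w: "w \<in> {1..n}" and "w \<noteq> 1 \<Longrightarrow> z \<le> D f n w" "\<And>c. c \<in> {2..n} \<Longrightarrow> f c = w \<Longrightarrow> z \<le> n - D f n c"
  shows "z \<le> J w"
proof -
  have "z \<le> card (subtree (tree_of f n) u w)" if "u \<in> neighbors (tree_of f n) w" for u
    using that assms subtree_parent[OF vf, of w] card_subtree_child[OF vf, of u] by (auto simp: neighbors_iff)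
  then show ?thesis unfolding jordan_def
    using neighbors_nonempty[OF vf n2 w] finite_neighbors by (subst Min_ge_iff) auto
qed

lemma jordan_le_n: "w \<in> {1..n} \<Longrightarrow> J w \<le> n"
proof (cases "w = 1")
  case True
  have "f 2 = 1" using validD[OF vf, of 2] n2 by auto
  then show ?thesis using jordan_le_child[of 2] n2 True by auto
next
  case False
  assume "w \<in> {1..n}"
  then show ?thesis using jordan_le_desc[of w] D_le[where f = f and n = n and w = w] False by auto
qed

lemma finite_minimizers: "finite (jordan_minimizers (tree_of f n) w)"
  by (simp add: jordan_minimizers_def finite_neighbors)

lemma minimizers_nonempty:
  assumes "w \<in> {1..n}" shows "jordan_minimizers (tree_of f n) w \<noteq> {}"
proof -
  have "J w \<in> (\<lambda>u. card (subtree (tree_of f n) u w)) ` neighbors (tree_of f n) w"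
    unfolding jordan_def using neighbors_nonempty[OF vf n2 assms] finite_neighbors by (intro Min_in) auto
  then show ?thesis by (auto simp: jordan_minimizers_def)
qed

lemma jordan2_geI:
  assumes "w \<in> {1..n}" "\<And>u. u \<in> jordan_minimizers (tree_of f n) w \<Longrightarrow> z \<le> J w * max (J u) (J w)"
  shows "z \<le> J2 w"
  unfolding jordan2_def using assms minimizers_nonempty[OF assms(1)] finite_minimizers by (subst Min_ge_iff) auto

lemma jordan2_ge_square: "w \<in> {1..n} \<Longrightarrow> J w * J w \<le> J2 w"
  by (rule jordan2_geI) auto

lemma jordan2_le:
  assumes w: "w \<in> {1..n}" and "J w \<le> z" "\<And>u. u \<in> neighbors (tree_of f n) w \<Longrightarrow> J u \<le> z"
  shows "J2 w \<le> J w * z"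
proof -
  obtain u where u: "u \<in> jordan_minimizers (tree_of f n) w" using minimizers_nonempty[OF w] by blast
  have "J2 w \<le> J w * max (J u) (J w)" unfolding jordan2_def
    using finite_minimizers u by (intro Min_le) auto
  also have "\<dots> \<le> J w * z" using assms u by (intro mult_left_mono) (auto simp: jordan_minimizers_def)
  finally show ?thesis .
qed

text \<open>
  The neighbor in the definition may be replaced by any other neighbor \<open>u\<close> in a lower bound. If
  \<open>m\<close> is a minimizer other than \<open>u\<close>, then the branch of \<open>u\<close> away from \<open>w\<close> is contained in the part
  of the tree on the side of \<open>w\<close> that \<open>m\<close> sees, and this part has \<open>jordan w\<close> vertices.
\<close>

lemma jordan2_ge_neighbor:
  assumes w: "w \<in> {1..n}" and u: "u \<in> neighbors (tree_of f n) w"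
  shows "J w * J u \<le> J2 w"
proof (rule jordan2_geI[OF w])
  fix m assume m: "m \<in> jordan_minimizers (tree_of f n) w"
  then have m': "m \<in> neighbors (tree_of f n) w" "card (subtree (tree_of f n) m w) = J w"
    by (auto simp: jordan_minimizers_def)
  have "J u \<le> max (J m) (J w)"
  proof (cases "u = m")
    case False
    have "J u \<le> J w"
    proof (cases "w \<in> {2..n} \<and> u = f w")
      case True
      then have "m \<in> {2..n}" "f m = w" using m' False by (auto simp: neighbors_iff)
      then have "J w = n - D f n m" "D f n m \<le> D f n w" using m' card_subtree_child[OF vf, of m] D_child[OF vf, of m] by auto
      then show ?thesis using jordan_le_child[of w] True by auto
    next
      case F: False
      then have u': "u \<in> {2..n}" "f u = w" using u by (auto simp: neighbors_iff)
      show ?thesis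
      proof (cases "w \<in> {2..n} \<and> m = f w")
        case True
        then show ?thesis using m' subtree_parent[OF vf, of w] D_child[OF vf, of u] jordan_le_desc[of u] u' by auto
      next
        case F2: False
        then have m2: "m \<in> {2..n}" "f m = w" using m' by (auto simp: neighbors_iff)
        have "desc f n u \<inter> desc f n m = {}" using siblings_disjoint[OF vf, of u m] u' m2 False by auto
        then have "D f n u \<le> n - D f n m"
          using D_add_le[of f u n m] by auto
        then show ?thesis using m' card_subtree_child[OF vf, of m] jordan_le_desc[of u] u' m2 by auto
      qed
    qed
    then show ?thesis by simp
  qed simp
  then show "J w * J u \<le> J w * max (J m) (J w)" by simp
qed

lemma jordan2_ge_parent: "w \<in> {2..n} \<Longrightarrow> J w * J (f w) \<le> J2 w"
  by (rule jordan2_ge_neighbor) (auto simp: neighbors_iff)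

text \<open>
  The second factor is at most \<open>D (f w)\<close> for each neighbor: children of \<open>w\<close> have fewer descendants
  than \<open>w\<close>, and \<open>w\<close> has fewer than its parent.
\<close>

lemma jordan2_le_parent:
  assumes w: "w \<in> {2..n}"
  shows "J2 w \<le> D f n w * D f n (f w)"
proof -
  have fw: "1 \<le> f w" "f w < w" using validD[OF vf, of w] w by auto
  have "J (f w) \<le> D f n (f w)"
    using jordan_le_desc[of "f w"] jordan_le_n[of "f w"] D_1[OF vf] fw w by (cases "f w = 1") auto
  moreover have "J u \<le> D f n (f w)" if "u \<in> {2..n}" "f u = w" for u
    using jordan_le_desc[OF that(1)] D_child[OF vf that(1)] D_child[OF vf w] that(2) by auto
  moreover have "J w \<le> D f n (f w)"
    using jordan_le_desc[OF w] D_child[OF vf w] by auto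
  ultimately have "J2 w \<le> J w * D f n (f w)"
    using w by (intro jordan2_le) (auto simp: neighbors_iff)
  also have "\<dots> \<le> D f n w * D f n (f w)" using jordan_le_desc[OF w] by simp
  finally show ?thesis .
qed

text \<open>
  A child of \<open>p\<close> is either a descendant of \<open>2\<close> or has no descendant in common with it, so the
  complement of its subtree contains one of the two sides of the edge between \<open>1\<close> and \<open>2\<close>. Hence
  \<open>D p\<close> measures the centrality of \<open>p\<close> whenever this edge is balanced.
\<close>

lemma jordan_ge_min:
  assumes p: "p \<in> {1..n}"
  shows "min (D f n p) (min (D f n 2) (n - D f n 2)) \<le> J p"
proof (rule jordan_ge[OF p])
  fix c assume c: "c \<in> {2..n}" "f c = p"
  show "min (D f n p) (min (D f n 2) (n - D f n 2)) \<le> n - D f n c"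
  proof (cases "c \<in> desc f n 2")
    case True
    then have "D f n c \<le> D f n 2" using desc_trans[OF vf, of 2 c] by (intro card_mono) auto
    then show ?thesis by auto
  next
    case False
    then have "desc f n c \<inter> desc f n 2 = {}" using c by (intro desc_disjoint[OF vf]) auto
    then have "D f n 2 + D f n c \<le> n"
      using D_add_le[of f c n 2] by auto
    then show ?thesis by auto
  qed
qed auto

end

section \<open>Ranks and the law of the ordering\<close>

text \<open>
  However ties are broken, the vertices strictly above \<open>v\<close> precede it, and in the next fact only
  vertices not below \<open>v\<close> can do so.
\<close>

lemma rank_ge:
  assumes "\<sigma> \<in> jordan2_rankings n t" "v \<in> {1..n}"
  shows "card {w \<in> {1..n}. jordan2 t v < jordan2 t w} < \<sigma> v"
proof -
  have p: "\<sigma> permutes {1..n}" and s: "\<And>u v. u \<in> {1..n} \<Longrightarrow> v \<in> {1..n} \<Longrightarrow> jordan2 t u > jordan2 t v \<Longrightarrow> \<sigma> u < \<sigma> v"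
    using assms by (auto simp: jordan2_rankings_def)
  let ?A = "{w \<in> {1..n}. jordan2 t v < jordan2 t w}"
  have "card (\<sigma> ` ?A) = card ?A" by (intro card_image) (use permutes_inj[OF p] inj_on_subset in blast)
  moreover have "1 \<le> \<sigma> w" if "w \<in> {1..n}" for w using permutes_in_image[OF p, of w] that by auto
  then have "\<sigma> ` ?A \<subseteq> {1..<\<sigma> v}" using s assms(2) by auto
  then have "card (\<sigma> ` ?A) \<le> card {1..<\<sigma> v}" by (intro card_mono) auto
  moreover have "1 \<le> \<sigma> v" using permutes_in_image[OF p, of v] assms(2) by auto
  ultimately show ?thesis by auto
qed

lemma rank_le:
  assumes "\<sigma> \<in> jordan2_rankings n t" "v \<in> {1..n}"
  shows "\<sigma> v \<le> card {w \<in> {1..n}. jordan2 t v \<le> jordan2 t w}"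
proof -
  have p: "\<sigma> permutes {1..n}" and s: "\<And>u v. u \<in> {1..n} \<Longrightarrow> v \<in> {1..n} \<Longrightarrow> jordan2 t u > jordan2 t v \<Longrightarrow> \<sigma> u < \<sigma> v"
    using assms by (auto simp: jordan2_rankings_def)
  let ?A = "{w \<in> {1..n}. jordan2 t v \<le> jordan2 t w}"
  have "{1..\<sigma> v} \<subseteq> \<sigma> ` ?A"
  proof
    fix k assume k: "k \<in> {1..\<sigma> v}"
    have "\<sigma> v \<in> {1..n}" using permutes_in_image[OF p] assms(2) by blast
    then have "k \<in> \<sigma> ` {1..n}" using permutes_image[OF p] k by auto
    then obtain w where w: "w \<in> {1..n}" "k = \<sigma> w" by blast
    then have "\<not> jordan2 t w < jordan2 t v" using s[of v w] assms(2) k by auto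
    then show "k \<in> \<sigma> ` ?A" using w by auto
  qed
  then have "card {1..\<sigma> v} \<le> card (\<sigma> ` ?A)" by (intro card_mono) auto
  also have "\<dots> \<le> card ?A" by (intro card_image_le) auto
  finally show ?thesis by simp
qed

lemma finite_recursive_tree: "finite (set_pmf (recursive_tree n))"
proof (induction n rule: size_induct)
  case (3 n)
  then show ?case by (auto simp: set_pmf_of_set)
qed auto

lemma expectation_bind_finite:
  fixes h :: "'b \<Rightarrow> real"
  assumes "finite (set_pmf M)" "\<And>x. finite (set_pmf (f x))"
  shows "measure_pmf.expectation (bind_pmf M f) h = measure_pmf.expectation M (\<lambda>x. measure_pmf.expectation (f x) h)"
  by (subst pmf_expectation_bind[OF assms(1)]) (use assms in \<open>auto simp: integral_measure_pmf[OF assms(1)]\<close>)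

text \<open>
  Parent functions give the law of the recursive tree: adding vertex \<open>n + 1\<close> inserts the edge to
  its parent.
\<close>

lemma recursive_tree_ev:
  "measure_pmf.expectation (recursive_tree n) h = ev n (\<lambda>f. h (tree_of f n))"
proof (induction n arbitrary: h rule: size_induct)
  case (3 n)
  have *: "tree_of (f(Suc (Suc n) := u)) (Suc (Suc n)) = insert {u, Suc (Suc n)} (tree_of f (Suc n))" for f u
  proof -
    have "{2..Suc (Suc n)} = insert (Suc (Suc n)) {2..Suc n}" by auto
    then show ?thesis by (auto simp: tree_of_def image_def)
  qed
  have "measure_pmf.expectation (recursive_tree (Suc (Suc n))) h =
     measure_pmf.expectation (recursive_tree (Suc n)) (\<lambda>t. (\<Sum>u=1..Suc n. h (insert {u, Suc (Suc n)} t)) / real (Suc n))"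
    unfolding recursive_tree.simps(3) map_pmf_def[symmetric]
    by (subst expectation_bind_finite)
       (auto simp: finite_recursive_tree set_pmf_of_set integral_pmf_of_set simp del: recursive_tree.simps)
  then show ?case by (simp only: ev.simps(3) 3 *)
qed (auto simp: tree_of_def)

lemma ordering_prob:
  "measure_pmf.prob (jordan2_ordering n) A =
     ev n (\<lambda>f. measure_pmf.prob (pmf_of_set (jordan2_rankings n (tree_of f n))) A)"
proof -
  have "measure_pmf.prob (jordan2_ordering n) A = measure_pmf.expectation (jordan2_ordering n) (indicator A)"
    by simp
  also have "\<dots> = measure_pmf.expectation (recursive_tree n)
      (\<lambda>t. measure_pmf.expectation (pmf_of_set (jordan2_rankings n t)) (indicator A))"
    unfolding jordan2_ordering_def
    by (rule expectation_bind_finite)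
       (simp_all add: finite_recursive_tree set_pmf_of_set[OF jordan2_rankings_nonempty finite_jordan2_rankings] finite_jordan2_rankings)
  finally show ?thesis by (simp add: recursive_tree_ev)
qed

text \<open>
  Statements on the random rank follow from statements on the tree that hold for every way of
  breaking ties.
\<close>

lemma ordering_prob_le:
  assumes "\<And>f \<sigma>. valid n f \<Longrightarrow> \<sigma> \<in> jordan2_rankings n (tree_of f n) \<Longrightarrow> P \<sigma> \<Longrightarrow> Q f"
  shows "measure_pmf.prob (jordan2_ordering n) {\<sigma>. P \<sigma>} \<le> pr n Q"
  unfolding ordering_prob
proof (rule ev_mono)
  fix f assume f: "valid n f"
  let ?R = "jordan2_rankings n (tree_of f n)"
  show "measure_pmf.prob (pmf_of_set ?R) {\<sigma>. P \<sigma>} \<le> of_bool (Q f)"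
  proof (cases "Q f")
    case False
    then have "?R \<inter> {\<sigma>. P \<sigma>} = {}" using assms[OF f] by auto
    then show ?thesis by (simp add: measure_pmf_of_set[OF jordan2_rankings_nonempty finite_jordan2_rankings])
  qed (use measure_pmf.prob_le_1 in auto)
qed

lemma ordering_prob_ge:
  assumes "\<And>f \<sigma>. valid n f \<Longrightarrow> \<sigma> \<in> jordan2_rankings n (tree_of f n) \<Longrightarrow> Q f \<Longrightarrow> P \<sigma>"
  shows "pr n Q \<le> measure_pmf.prob (jordan2_ordering n) {\<sigma>. P \<sigma>}"
  unfolding ordering_prob
proof (rule ev_mono)
  fix f assume f: "valid n f"
  let ?R = "jordan2_rankings n (tree_of f n)"
  show "of_bool (Q f) \<le> measure_pmf.prob (pmf_of_set ?R) {\<sigma>. P \<sigma>}"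
  proof (cases "Q f")
    case True
    then have "?R \<inter> {\<sigma>. P \<sigma>} = ?R" using assms[OF f] by auto
    then show ?thesis using True jordan2_rankings_nonempty finite_jordan2_rankings by (simp add: measure_pmf_of_set)
  qed auto
qed

section \<open>High moments: scarcity of central vertices, and a vertex with its parent\<close>

lemma pow_le_pochhammer: "0 \<le> x \<Longrightarrow> x ^ r \<le> pochhammer (x :: real) r"
proof (induction r)
  case (Suc r)
  then show ?case unfolding pochhammer_Suc power_Suc2
    by (intro mult_mono) (auto intro: order_trans[OF zero_le_power])
qed auto

lemma pochhammer_le_pow: "0 \<le> x \<Longrightarrow> pochhammer (x :: real) r \<le> (x + real r) ^ r"
proof (induction r)
  case (Suc r)
  then have "pochhammer x r \<le> (x + real (Suc r)) ^ r" by (intro order_trans[OF Suc.IH] power_mono) auto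
  with Suc show ?case unfolding pochhammer_Suc power_Suc2 by (intro mult_mono) auto
qed auto

lemma pochhammer_nonneg': "0 \<le> x \<Longrightarrow> 0 \<le> pochhammer (x :: real) r"
  using pow_le_pochhammer[of x r] zero_le_power[of x r] by linarith

lemma pochhammer_ratio_le:
  assumes "0 < m" "m \<le> n"
  shows "pochhammer (n :: real) r / pochhammer m r \<le> (n / m) ^ r"
proof (induction r)
  case (Suc r)
  have "pochhammer n (Suc r) / pochhammer m (Suc r) = (pochhammer n r / pochhammer m r) * ((n + real r) / (m + real r))"
    by (simp add: pochhammer_Suc)
  also have "\<dots> \<le> (n / m) ^ r * (n / m)"
  proof (intro mult_mono Suc)
    show "(n + real r) / (m + real r) \<le> n / m" using assms mult_right_mono[of m n "real r"] by (simp add: field_simps)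
  qed (use assms in auto)
  finally show ?case by (simp only: power_Suc2)
qed auto

lemma pochhammer_scale:
  assumes "0 \<le> c" "c \<le> 1" "0 \<le> (x :: real)"
  shows "c ^ r * pochhammer x r \<le> pochhammer (c * x) r"
proof (induction r)
  case (Suc r)
  have "c * real r \<le> real r" using assms mult_right_mono[of c 1 "real r"] by simp
  then have "(c ^ r * pochhammer x r) * (c * (x + real r)) \<le> pochhammer (c * x) r * (c * x + real r)"
    using assms by (intro mult_mono Suc pochhammer_nonneg') (auto simp: distrib_left)
  then show ?case by (simp add: pochhammer_Suc mult_ac)
qed auto

text \<open>
  The early vertices \<open>1, 2, 3, \<dots>\<close> have Jordan centralities of order \<open>n, n / 2, n / 3, \<dots>\<close>, so this
  event is exceptional when \<open>M\<close> is a large multiple of \<open>K\<close>. The factor \<open>4\<close> leaves a quarter of the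
  vertices to the small clusters in the next lemma.
\<close>

definition few_central :: "nat \<Rightarrow> nat \<Rightarrow> nat \<Rightarrow> (nat \<Rightarrow> nat) \<Rightarrow> bool" where
  "few_central n M K f \<longleftrightarrow> card {w \<in> {1..n}. n \<le> 4 * M * jordan (tree_of f n) w} < K"

text \<open>
  Call a cluster grown from one of the vertices \<open>1..M\<close> big if it has at least \<open>n / (4 * M)\<close>
  vertices. If the clusters of \<open>i\<close> and \<open>j\<close> are big, then \<open>i\<close> has Jordan centrality at least
  \<open>n / (4 * M)\<close>, because each branch at \<open>i\<close> misses the cluster of \<open>i\<close> or that of \<open>j\<close>. So fewer
  than \<open>K\<close> clusters are big, and the others have at most \<open>M * (n / (4 * M)) = n / 4\<close> vertices
  together.
\<close>

lemma few_central_imp: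
  assumes f: "valid n f" and K: "2 \<le> K" "K \<le> M" "M \<le> n" and fl: "few_central n M K f"
  shows "\<exists>W\<subseteq>{1..M}. card W = K \<and> 3 * n \<le> 4 * card (cluster f M W n)"
proof -
  let ?J = "jordan (tree_of f n)"
  have n2: "2 \<le> n" using K by simp
  define Big where "Big = {i \<in> {1..M}. n \<le> 4 * M * card (cluster f M {i} n)}"
  have Big: "n \<le> 4 * M * ?J i" if ij: "i \<in> Big" "j \<in> Big" "i \<noteq> j" for i j
  proof -
    have i: "1 \<le> i" "i \<le> M" "i \<le> n" using ij K by (auto simp: Big_def)
    let ?z = "min (card (cluster f M {i} n)) (card (cluster f M {j} n))"
    have "?z \<le> ?J i"
    proof (rule jordan_ge[OF f n2])
      have "cluster f M {i} n \<subseteq> desc f n i"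
      proof
        fix x assume x: "x \<in> cluster f M {i} n"
        then show "x \<in> desc f n i" using anc_anc[OF f i(1,2), of x] by (auto simp: cluster_def)
      qed
      then show "?z \<le> D f n i" using card_mono[of "desc f n i" "cluster f M {i} n"] by auto
      fix c assume c: "c \<in> {2..n}" "f c = i"
      have ic: "i < c" using validD[OF f, of c] c by auto
      have disj_le: "card A \<le> n - D f n c" if "A \<inter> desc f n c = {}" "A \<subseteq> {1..n}" for A
      proof -
        have fin: "finite A" using that(2) finite_subset by blast
        show ?thesis using card_Un_disjoint[OF fin finite_cluster that(1)] card_mono[of "{1..n}" "A \<union> desc f n c"] that(2) cluster_subset[of f c "{c}" n]
          by auto
      qed
      show "?z \<le> n - D f n c"
      proof (cases "c \<le> M")
        case True
        have "x \<notin> desc f n c" if x: "x \<in> cluster f M {i} n" for x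
        proof
          assume "x \<in> desc f n c"
          then have "anc f c (anc f M x) = c" using anc_anc[OF f _ True, of x] c x by (auto simp: cluster_def)
          then show False using x ic by (auto simp: cluster_def)
        qed
        then have "card (cluster f M {i} n) \<le> n - D f n c" using cluster_subset by (intro disj_le) auto
        then show ?thesis by simp
      next
        case False
        have "anc f M x = i" if x: "x \<in> desc f n c" for x
        proof -
          have "anc f M x = anc f M (anc f c x)" using anc_anc[OF f _ _, of M c x] x False i by (auto simp: cluster_def)
          also have "\<dots> = anc f M c" using x by (auto simp: cluster_def)
          also have "\<dots> = anc f M (f c)" using anc_step[OF f, of M c] c False i by auto
          finally show ?thesis using c i by simp
        qed
        then have "card (cluster f M {j} n) \<le> n - D f n c" using cluster_subset ij(3) by (intro disj_le) (auto simp: cluster_def)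
        then show ?thesis by simp
      qed
    qed (use i in auto)
    then have "4 * M * ?z \<le> 4 * M * ?J i" by simp
    moreover have "n \<le> 4 * M * ?z" using ij by (auto simp: Big_def min_def)
    ultimately show ?thesis by linarith
  qed
  have "card Big < K"
  proof (cases "card Big \<ge> 2")
    case True
    have "Big \<subseteq> {w \<in> {1..n}. n \<le> 4 * M * ?J w}"
    proof
      fix i assume i: "i \<in> Big"
      have "\<not> Big \<subseteq> {i}" using True card_mono[of "{i}" Big] by auto
      then obtain j where "j \<in> Big" "i \<noteq> j" by blast
      then show "i \<in> {w \<in> {1..n}. n \<le> 4 * M * ?J w}" using Big[OF i] i K by (auto simp: Big_def)
    qed
    then have "card Big \<le> card {w \<in> {1..n}. n \<le> 4 * M * ?J w}" by (intro card_mono) auto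
    then show ?thesis using fl by (simp add: few_central_def)
  qed (use K in auto)
  moreover have "Big \<subseteq> {1..M}" by (auto simp: Big_def)
  ultimately obtain W where W: "Big \<subseteq> W" "W \<subseteq> {1..M}" "card W = K"
    using exists_subset_between[of Big K "{1..M}"] K by auto
  have "{1..n} - cluster f M W n \<subseteq> (\<Union>i\<in>{1..M} - W. cluster f M {i} n)"
    using anc_range[OF f, of M] K by (auto simp: cluster_def)
  then have "card ({1..n} - cluster f M W n) \<le> card (\<Union>i\<in>{1..M} - W. cluster f M {i} n)" by (intro card_mono) auto
  also have "\<dots> \<le> (\<Sum>i\<in>{1..M} - W. card (cluster f M {i} n))" by (rule card_UN_le) auto
  finally have "4 * M * card ({1..n} - cluster f M W n) \<le> (\<Sum>i\<in>{1..M} - W. 4 * M * card (cluster f M {i} n))"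
    by (simp add: sum_distrib_left[symmetric])
  also have "\<dots> \<le> (\<Sum>i\<in>{1..M} - W. n)" using W(1) by (intro sum_mono) (auto simp: Big_def not_le intro: less_imp_le)
  also have "\<dots> \<le> M * n" using card_mono[of "{1..M}" "{1..M} - W"] by simp
  finally have "4 * card ({1..n} - cluster f M W n) \<le> n" using K by simp
  moreover have "card ({1..n} - cluster f M W n) = n - card (cluster f M W n)"
    using cluster_subset by (subst card_Diff_subset) auto
  moreover have "card (cluster f M W n) \<le> n" using card_mono[OF _ cluster_subset[of f M W n]] by simp
  ultimately show ?thesis using W by (intro exI[of _ W]) auto
qed

text \<open>
  The quotient of \<open>pochhammer (1 + K) K\<close> and \<open>fact K\<close> is the central binomial coefficient.
\<close>

lemma pochhammer_self_le: "pochhammer (real K) K \<le> 4 ^ K * fact K"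
proof -
  have "pochhammer (real K) K \<le> pochhammer (1 + real K) K"
  proof (induction K)
    case (Suc K)
    show ?case unfolding pochhammer_prod by (intro prod_mono) auto
  qed auto
  also have "\<dots> = fact (2 * K) / fact K"
    using pochhammer_product'[of "1::real" K K] pochhammer_fact[of K, where 'a=real] pochhammer_fact[of "2 * K", where 'a=real]
    by (simp add: mult_2 pochhammer_pos[THEN less_imp_neq, symmetric])
  also have "\<dots> = real (2 * K choose K) * fact K"
    using binomial_fact[of K "2 * K", where 'a=real] by (simp add: mult_2)
  also have "\<dots> \<le> 2 ^ (2 * K) * fact K"
    using of_nat_mono[OF binomial_le_pow2[of "2 * K" K], where 'a=real] by (intro mult_right_mono) simp_all
  finally show ?thesis by (simp add: power_mult)
qed

text \<open>
  A union bound over the sets \<open>W\<close> of \<open>K\<close> vertices whose clusters may hold three quarters of the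
  tree, with Markov's inequality for a rising factorial of order \<open>4 * K\<close>. The moment is of order
  \<open>(K / M) ^ (4 * K)\<close>; the number of sets takes back \<open>K\<close> of the factors \<open>K / M\<close>. The weight \<open>H\<close>
  allows for a prescribed parent.
\<close>

lemma few_central_ev:
  assumes K: "2 \<le> K" "K \<le> M" "M \<le> n" and H: "\<And>f. 0 \<le> H f" and h: "0 \<le> h"
   and W: "\<And>W. W \<subseteq> {1..M} \<Longrightarrow> card W = K \<Longrightarrow> ev n (\<lambda>f. H f * pochhammer (real (card (cluster f M W n))) (4 * K))
        \<le> h * (pochhammer (real n) (4 * K) / pochhammer (real M) (4 * K) * pochhammer (real K) (4 * K))"
  shows "ev n (\<lambda>f. H f * of_bool (few_central n M K f)) \<le> h * (12 * real K / real M) ^ (3 * K)"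
proof -
  let ?r = "4 * K"
  let ?P = "\<lambda>x. pochhammer (x :: real) ?r"
  let ?WW = "{W. W \<subseteq> {1..M} \<and> card W = K}"
  have fin: "finite ?WW" by (rule finite_subset[of _ "Pow {1..M}"]) auto
  have pos: "0 < ?P (3 / 4 * real n)" using K by (intro pochhammer_pos) auto
  have pM: "0 < ?P (real M)" and pn: "0 < ?P (real n)" using K by (auto intro!: pochhammer_pos)
  have "ev n (\<lambda>f. H f * of_bool (few_central n M K f)) \<le> ev n (\<lambda>f. \<Sum>W\<in>?WW. H f * ?P (real (card (cluster f M W n))) / ?P (3 / 4 * real n))"
  proof (rule ev_mono)
    fix f assume f: "valid n f"
    have nn: "0 \<le> H f * ?P (real (card (cluster f M W n))) / ?P (3 / 4 * real n)" for W
      using H pos by (intro divide_nonneg_nonneg mult_nonneg_nonneg pochhammer_nonneg') auto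
    show "H f * of_bool (few_central n M K f) \<le> (\<Sum>W\<in>?WW. H f * ?P (real (card (cluster f M W n))) / ?P (3 / 4 * real n))"
    proof (cases "few_central n M K f")
      case True
      then obtain W where W: "W \<subseteq> {1..M}" "card W = K" "3 * n \<le> 4 * card (cluster f M W n)" using few_central_imp[OF f K] by blast
      have "?P (3 / 4 * real n) \<le> ?P (real (card (cluster f M W n)))"
        unfolding pochhammer_prod by (intro prod_mono) (use W(3) in auto)
      then have "H f * 1 \<le> H f * (?P (real (card (cluster f M W n))) / ?P (3 / 4 * real n))"
        using H pos by (intro mult_left_mono) (auto simp: le_divide_eq)
      also have "\<dots> \<le> (\<Sum>W\<in>?WW. H f * ?P (real (card (cluster f M W n))) / ?P (3 / 4 * real n))"
        using member_le_sum[of W ?WW "\<lambda>W. H f * ?P (real (card (cluster f M W n))) / ?P (3 / 4 * real n)"] nn W fin by auto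
      finally show ?thesis using True by simp
    next
      case False
      then show ?thesis using nn by (auto intro!: sum_nonneg)
    qed
  qed
  also have "\<dots> \<le> (\<Sum>W\<in>?WW. h * (?P (real n) / ?P (real M) * ?P (real K)) / ?P (3 / 4 * real n))"
    unfolding ev_sum[OF fin] ev_divide using W pos by (intro sum_mono divide_right_mono) auto
  also have "\<dots> = real (M choose K) * (h * (?P (real n) / ?P (real M) * ?P (real K)) / ?P (3 / 4 * real n))"
    using n_subsets[of "{1..M}" K] by simp
  also have "\<dots> = h * ((?P (real n) / ?P (3 / 4 * real n)) * (real (M choose K) * (?P (real K) / ?P (real M))))"
    by (simp add: mult_ac)
  also have "\<dots> \<le> h * ((4 / 3) ^ ?r * (4 ^ K * (5 * real K / real M) ^ (3 * K)))"
  proof (rule mult_left_mono[OF _ h], rule mult_mono)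
    have "(3 / 4) ^ ?r * ?P (real n) \<le> ?P (3 / 4 * real n)" by (rule pochhammer_scale) auto
    then have "?P (real n) / ?P (3 / 4 * real n) \<le> 1 / (3 / 4) ^ ?r" using pos by (simp add: field_simps)
    then show "?P (real n) / ?P (3 / 4 * real n) \<le> (4 / 3) ^ ?r" by (simp add: power_one_over[symmetric] power_divide)
    (* The first K of the 4 K factors pay for the number of sets W; the other 3 K give the decay. *)
    have split: "?P x = pochhammer x K * pochhammer (x + real K) (3 * K)" for x
      using pochhammer_product'[of x K "3 * K"] by simp
    have "real (M choose K) * fact K \<le> real M ^ K"
    proof -
      have "real ((M choose K) * fact K) = real (fact K * (M choose K))" by (simp add: mult.commute)
      have "(M choose K) * fact K \<le> M ^ K"
        using binomial_fact_pow[of M K] .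
      then have "real ((M choose K) * fact K) \<le> real (M ^ K)" by (rule of_nat_mono)
      then show ?thesis by simp
    qed
    also have "\<dots> \<le> pochhammer (real M) K" by (rule pow_le_pochhammer) simp
    finally have c: "real (M choose K) * fact K \<le> pochhammer (real M) K" .
    have pMK: "0 < pochhammer (real M) K" "0 < pochhammer (real M + real K) (3 * K)" using K by (auto intro!: pochhammer_pos)
    have "real (M choose K) * (?P (real K) / ?P (real M)) =
       (real (M choose K) * pochhammer (real K) K / pochhammer (real M) K) * (pochhammer (real K + real K) (3 * K) / pochhammer (real M + real K) (3 * K))"
      unfolding split by simp
    also have "\<dots> \<le> 4 ^ K * (5 * real K / real M) ^ (3 * K)"
    proof (intro mult_mono)
      have "real (M choose K) * pochhammer (real K) K \<le> real (M choose K) * (4 ^ K * fact K)"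
        by (intro mult_left_mono pochhammer_self_le) auto
      also have "\<dots> \<le> 4 ^ K * pochhammer (real M) K" using mult_left_mono[OF c, of "4 ^ K"] by (simp add: mult_ac)
      finally show "real (M choose K) * pochhammer (real K) K / pochhammer (real M) K \<le> 4 ^ K"
        using pMK by (simp add: divide_le_eq)
      have "pochhammer (real K + real K) (3 * K) \<le> (5 * real K) ^ (3 * K)"
        using pochhammer_le_pow[of "real K + real K" "3 * K"] by simp
      moreover have "real M ^ (3 * K) \<le> pochhammer (real M + real K) (3 * K)"
        by (rule order_trans[OF power_mono pow_le_pochhammer]) auto
      ultimately show "pochhammer (real K + real K) (3 * K) / pochhammer (real M + real K) (3 * K) \<le> (5 * real K / real M) ^ (3 * K)"
        unfolding power_divide using K by (intro frac_le) (auto intro!: pochhammer_nonneg')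
    qed (use pMK in \<open>auto intro!: divide_nonneg_nonneg pochhammer_nonneg'\<close>)
    finally show "real (M choose K) * (?P (real K) / ?P (real M)) \<le> 4 ^ K * (5 * real K / real M) ^ (3 * K)" .
  qed (use pM in \<open>auto intro!: mult_nonneg_nonneg divide_nonneg_nonneg pochhammer_nonneg'\<close>)
  also have "\<dots> \<le> h * (12 * real K / real M) ^ (3 * K)"
  proof (intro mult_left_mono[OF _ h])
    define x where "x = real K / real M"
    have e: "(c * x) ^ (3 * K) = (c ^ 3) ^ K * x ^ (3 * K)" for c
      by (simp only: power_mult_distrib power_mult[of c])
    (* (4/3)^4 * 4 * 5^3 is about 1580, below 12^3 = 1728. *)
    have "(4 / 3) ^ ?r * (4 ^ K * (5 * x) ^ (3 * K)) = ((4 / 3) ^ 4 * 4 * 5 ^ 3) ^ K * x ^ (3 * K)"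
      unfolding e power_mult[of "4 / 3 :: real" 4 K] by (simp only: power_mult_distrib[symmetric] mult.assoc[symmetric])
    also have "\<dots> \<le> (12 ^ 3) ^ K * x ^ (3 * K)"
      by (intro mult_right_mono power_mono) (auto simp: power_divide x_def)
    also have "\<dots> = (12 * x) ^ (3 * K)"
      by (simp only: e)
    finally have "(4 / 3) ^ ?r * (4 ^ K * (5 * x) ^ (3 * K)) \<le> (12 * x) ^ (3 * K)" .
    then show "(4 / 3) ^ ?r * (4 ^ K * (5 * real K / real M) ^ (3 * K)) \<le> (12 * real K / real M) ^ (3 * K)"
      by (simp add: x_def)
  qed
  finally show ?thesis .
qed

lemma cluster_empty [simp]: "cluster f m {} n = {}"
  by (simp add: cluster_def)

lemma few_central_prob:
  assumes K: "2 \<le> K" "K \<le> M" "M \<le> n"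
  shows "pr n (few_central n M K) \<le> (12 * real K / real M) ^ (3 * K)"
proof -
  have "ev n (\<lambda>f. 1 * of_bool (few_central n M K f)) \<le> 1 * (12 * real K / real M) ^ (3 * K)"
  proof (rule few_central_ev[OF K])
    fix W assume W: "W \<subseteq> {1..M}" "card W = K"
    show "ev n (\<lambda>f. 1 * pochhammer (real (card (cluster f M W n))) (4 * K))
        \<le> 1 * (pochhammer (real n) (4 * K) / pochhammer (real M) (4 * K) * pochhammer (real K) (4 * K))"
      using urn_moments[of M n "\<lambda>_. 1" "\<lambda>_. W" "\<lambda>_. {}" "4 * K" 0] K W by (simp add: cluster_self Int_absorb2)
  qed auto
  then show ?thesis by simp
qed

lemma ev_parent:
  assumes "1 \<le> n" "1 \<le> p" "p \<le> n"
  shows "ev (Suc n) (\<lambda>f. of_bool (f (Suc n) = p) * g f) = ev n (\<lambda>f. g (f(Suc n := p))) / real n"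
proof -
  have "(\<Sum>u=1..n. of_bool ((f(Suc n := u)) (Suc n) = p) * g (f(Suc n := u))) = g (f(Suc n := p))" for f
  proof -
    have "(\<Sum>u=1..n. of_bool ((f(Suc n := u)) (Suc n) = p) * g (f(Suc n := u))) = (\<Sum>u=1..n. if u = p then g (f(Suc n := p)) else 0)"
      by (intro sum.cong) auto
    then show ?thesis using assms by simp
  qed
  then show ?thesis using assms by (simp add: ev_Suc ev_divide)
qed

lemma pr_parent: "2 \<le> v \<Longrightarrow> v \<le> n \<Longrightarrow> 1 \<le> p \<Longrightarrow> p < v \<Longrightarrow> pr n (\<lambda>f. f v = p) = 1 / (real v - 1)"
proof -
  assume v: "2 \<le> v" "v \<le> n" "1 \<le> p" "p < v"
  obtain m where m: "v = Suc m" "1 \<le> m" using v by (cases v) auto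
  have "pr n (\<lambda>f. f v = p) = pr v (\<lambda>f. f v = p)"
    using v by (intro ev_extend) (auto simp: local_at_def)
  also have "\<dots> = 1 / real m" using ev_parent[of m p "\<lambda>_. 1"] v m by simp
  finally show ?thesis using m by simp
qed

text \<open>
  Prescribing the parent of \<open>v\<close> adds at most one vertex to the clusters grown from \<open>W\<close>, which
  changes a rising factorial of order \<open>4 * K\<close> by the factor \<open>1 + 4 * K\<close> at most.
\<close>

lemma few_central_prob_parent:
  assumes K: "2 \<le> K" "K \<le> M" "M < v" "v \<le> n" and p: "1 \<le> p" "p < v"
  shows "pr n (\<lambda>f. f v = p \<and> few_central n M K f) \<le> (1 + 4 * real K) / (real v - 1) * (12 * real K / real M) ^ (3 * K)"
proof -
  let ?r = "4 * K"
  obtain m where m: "v = Suc m" "1 \<le> m" using K by (cases v) auto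
  have loc: "local_at v (\<lambda>f. of_bool (f v = p))" by (auto simp: local_at_def)
  have "ev n (\<lambda>f. of_bool (f v = p) * of_bool (few_central n M K f)) \<le> (1 + 4 * real K) / (real v - 1) * (12 * real K / real M) ^ (3 * K)"
  proof (rule few_central_ev)
    fix W assume W: "W \<subseteq> {1..M}" "card W = K"
    let ?Q = "\<lambda>x. pochhammer (real x) ?r"
    have "ev n (\<lambda>f. of_bool (f v = p) * ?Q (card (cluster f M W n))) = ev n (\<lambda>f. of_bool (f v = p) * (?Q (card (cluster f v (cluster f M W v) n)) * pochhammer (real (card (cluster f v {} n))) 0))"
      using K by (intro ev_cong) (simp add: cluster_cluster)
    also have "\<dots> = ?Q n / ?Q v * ev v (\<lambda>f. of_bool (f v = p) * ?Q (card (cluster f M W v)))"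
      using urn_moments[OF _ _ loc, of n "\<lambda>f. cluster f M W v" "\<lambda>_. {}" ?r 0] K local_at_cluster[of M "\<lambda>_. W" v]
        cluster_subset[of _ M W v] by (simp add: cluster_self Int_absorb2)
    also have "ev v (\<lambda>f. of_bool (f v = p) * ?Q (card (cluster f M W v))) = ev m (\<lambda>f. ?Q (card (cluster (f(v := p)) M W v))) / real m"
      unfolding m using m p by (intro ev_parent) auto
    also have "ev m (\<lambda>f. ?Q (card (cluster (f(v := p)) M W v))) \<le> ev m (\<lambda>f. (1 + 4 * real K) * ?Q (card (cluster f M W m)))"
    proof (rule ev_mono)
      fix f assume f: "valid m f"
      define k where "k = card (cluster f M W m)"
      have "W \<subseteq> cluster f M W m" using W K m by (auto simp: cluster_def)
      then have k: "K \<le> k" using card_mono[of "cluster f M W m" W] W by (simp add: k_def)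
      have "cluster (f(v := p)) M W v = (if p \<in> cluster f M W m then insert v (cluster f M W m) else cluster f M W m)"
        unfolding m using f K m p by (intro cluster_Suc_upd) auto
      then have "card (cluster (f(v := p)) M W v) \<le> Suc k" using card_insert_le_m1[of "Suc k" "cluster f M W m" v] by (auto simp: k_def)
      then have "?Q (card (cluster (f(v := p)) M W v)) \<le> ?Q (Suc k)"
        unfolding pochhammer_prod by (intro prod_mono) auto
      also have "real k * ?Q (Suc k) = (real k + real ?r) * ?Q k"
        using pochhammer_rec[of "real k" ?r] pochhammer_Suc[of "real k" ?r] by (simp add: mult.commute add.commute)
      then have "?Q (Suc k) = (1 + real ?r / real k) * ?Q k" using k K by (simp add: field_simps)
      also have "\<dots> \<le> (1 + 4 * real K) * ?Q k"
        using k K by (intro mult_right_mono pochhammer_nonneg') (auto simp: field_simps)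
      finally show "?Q (card (cluster (f(v := p)) M W v)) \<le> (1 + 4 * real K) * ?Q (card (cluster f M W m))" by (simp add: k_def)
    qed
    also have "\<dots> = (1 + 4 * real K) * (?Q m / ?Q M * ?Q K)"
      unfolding ev_cmult using urn_moments[of M m "\<lambda>_. 1" "\<lambda>_. W" "\<lambda>_. {}" ?r 0] K m W by (simp add: cluster_self Int_absorb2)
    also have "\<dots> \<le> (1 + 4 * real K) * (?Q v / ?Q M * ?Q K)"
    proof -
      have "?Q m \<le> ?Q v" unfolding pochhammer_prod m by (intro prod_mono) auto
      then show ?thesis using pochhammer_pos[of "real M" ?r] K
        by (intro mult_left_mono mult_right_mono divide_right_mono pochhammer_nonneg') auto
    qed
    finally have "ev n (\<lambda>f. of_bool (f v = p) * ?Q (card (cluster f M W n))) \<le> ?Q n / ?Q v * ((1 + 4 * real K) * (?Q v / ?Q M * ?Q K) / real m)"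
      by (simp add: divide_right_mono mult_left_mono pochhammer_nonneg')
    also have "\<dots> = (1 + 4 * real K) / (real v - 1) * (?Q n / ?Q M * ?Q K)"
    proof -
      have "a / b * (c * (b / d * e) / g) = c / g * (a / d * e)" if "b \<noteq> 0" for a b c d e g :: real
        using that by (simp add: mult_ac)
      from this[of "?Q v" "?Q n"] show ?thesis using pochhammer_pos[of "real v" ?r] m by simp
    qed
    finally show "ev n (\<lambda>f. of_bool (f v = p) * ?Q (card (cluster f M W n))) \<le> (1 + 4 * real K) / (real v - 1) * (?Q n / ?Q M * ?Q K)" .
  qed (use K in auto)
  then show ?thesis by (simp add: of_bool_conj)
qed

text \<open>
  The descendants of the parent are those of \<open>v\<close> and the cluster grown from the subtree that the
  parent had before \<open>v\<close> arrived: two colours of the urn started at time \<open>v\<close>.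
\<close>

lemma D_parent_split:
  assumes f: "valid n f" and v: "2 \<le> v" "v \<le> n"
  shows "D f n (f v) = D f n v + card (cluster f v (desc f (v - 1) (f v)) n)"
    and "v \<notin> desc f (v - 1) (f v)"
proof -
  let ?p = "f v"
  obtain m where m: "v = Suc m" "1 \<le> m" using v by (cases v) auto
  have p: "1 \<le> ?p" "?p < v" using validD[OF f v] by auto
  show nin: "v \<notin> desc f (v - 1) ?p" using cluster_subset[of f ?p "{?p}" "v - 1"] v by auto
  have "desc f v ?p = insert v (desc f m ?p)"
    using cluster_Suc[of m f ?p "{?p}"] valid_mono[OF f v(2)] p desc_self[of ?p m f] by (auto simp: m)
  then have "desc f n ?p = cluster f v ({v} \<union> desc f (v - 1) ?p) n"
    using cluster_cluster[OF f p(1), of v "{?p}"] p v m by auto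
  then show "D f n ?p = D f n v + card (cluster f v (desc f (v - 1) ?p) n)"
    unfolding cluster_Un using nin by (simp add: card_Un_disjoint cluster_disjoint)
qed

lemma local_parent: "local_at v (\<lambda>f. P (f v))"
  by (auto simp: local_at_def)

text \<open>
  If \<open>k * (k + l) \<ge> y\<^sup>2\<close> then \<open>k\<^sup>2\<close> or \<open>k * l\<close> is at least \<open>y\<^sup>2 / 2\<close>; Markov's inequality for the
  fourth powers of these needs the moments \<open>8\<close> and \<open>(4, 4)\<close> of the urn. The order is chosen such
  that the square root of the bound is still summable over \<open>p\<close>. The constant is
  \<open>16 * (fact 8 + (fact 4)\<^sup>2)\<close>.
\<close>

lemma DD_moment:
  assumes v: "2 \<le> v" "v \<le> n" and p: "1 \<le> p" "p < v" and y: "0 < y"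
  shows "pr n (\<lambda>f. f v = p \<and> y\<^sup>2 \<le> real (D f n v * D f n (f v)))
      \<le> 1 / (real v - 1) * (654336 * (real n ^ 2 / (real v * real p * y\<^sup>2)) ^ 4)"
proof -
  obtain m where m: "v = Suc m" "1 \<le> m" using v by (cases v) auto
  define H where "H = (\<lambda>f :: nat \<Rightarrow> nat. of_bool (f v = p) :: real)"
  define C' where "C' = (\<lambda>f. desc f (v - 1) p)"
  have loc: "local_at v H" "local_at v (\<lambda>_. {v})" "local_at v C'" and disj: "{v} \<inter> C' f = {}" for f
    using local_parent[of v "\<lambda>u. of_bool (u = p)"] local_at_mono[OF local_at_cluster[of p "\<lambda>_. {p}" m], of v] p m
      cluster_subset[of f p "{p}" m]
    by (auto simp: H_def C'_def)
  let ?k = "\<lambda>f. real (D f n v)" and ?l = "\<lambda>f. real (card (cluster f v (C' f) n))"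
  let ?P = "\<lambda>n r. pochhammer (real n) r"
  have sp: "?P n 8 / ?P v 8 \<le> (real n / real v) ^ 8" using v by (intro pochhammer_ratio_le) auto
  have "pr n (\<lambda>f. f v = p \<and> y\<^sup>2 \<le> real (D f n v * D f n (f v)))
      \<le> ev n (\<lambda>f. 16 / y ^ 8 * (H f * (pochhammer (?k f) 8 * pochhammer (?l f) 0) + H f * (pochhammer (?k f) 4 * pochhammer (?l f) 4)))"
  proof (rule ev_mono)
    fix f assume f: "valid n f"
    show "of_bool (f v = p \<and> y\<^sup>2 \<le> real (D f n v * D f n (f v)))
       \<le> 16 / y ^ 8 * (H f * (pochhammer (?k f) 8 * pochhammer (?l f) 0) + H f * (pochhammer (?k f) 4 * pochhammer (?l f) 4))"
    proof (cases "f v = p \<and> y\<^sup>2 \<le> real (D f n v * D f n (f v))")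
      case True
      define k l where "k = ?k f" and "l = ?l f"
      have kl0: "0 \<le> k" "0 \<le> l" by (auto simp: k_def l_def)
      have "real (D f n p) = k + l"
        using D_parent_split(1)[OF f v] True by (simp add: k_def l_def C'_def)
      then have kl: "y\<^sup>2 \<le> k * (k + l)" using True k_def by auto
      have "y ^ 8 \<le> 16 * (k ^ 8 + k ^ 4 * l ^ 4)"
      proof (cases "y\<^sup>2 \<le> 2 * k\<^sup>2")
        case True
        have "(y\<^sup>2) ^ 4 \<le> (2 * k\<^sup>2) ^ 4" using True by (intro power_mono) auto
        then have "y ^ 8 \<le> 16 * k ^ 8" by (simp add: power_mult_distrib flip: power_mult)
        also have "\<dots> \<le> 16 * (k ^ 8 + k ^ 4 * l ^ 4)" using kl0 by simp
        finally show ?thesis .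
      next
        case False
        then have "y\<^sup>2 \<le> 2 * (k * l)" using kl by (simp add: power2_eq_square algebra_simps)
        then have "(y\<^sup>2) ^ 4 \<le> (2 * (k * l)) ^ 4" by (intro power_mono) auto
        then have "y ^ 8 \<le> 16 * (k ^ 4 * l ^ 4)" by (simp add: power_mult_distrib flip: power_mult)
        also have "\<dots> \<le> 16 * (k ^ 8 + k ^ 4 * l ^ 4)" using kl0 by simp
        finally show ?thesis .
      qed
      also have "\<dots> \<le> 16 * (pochhammer k 8 + pochhammer k 4 * pochhammer l 4)"
        using kl0 by (intro mult_left_mono add_mono mult_mono pow_le_pochhammer pochhammer_nonneg') auto
      finally have "1 \<le> 16 / y ^ 8 * (pochhammer k 8 + pochhammer k 4 * pochhammer l 4)" using y by (simp add: field_simps)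
      then show ?thesis using True by (simp add: H_def k_def l_def)
    next
      case False
      moreover have "0 \<le> 16 / y ^ 8 * (H f * (pochhammer (?k f) 8 * pochhammer (?l f) 0) + H f * (pochhammer (?k f) 4 * pochhammer (?l f) 4))"
        using y by (intro mult_nonneg_nonneg add_nonneg_nonneg pochhammer_nonneg') (auto simp: H_def)
      moreover have "of_bool (f v = p \<and> y\<^sup>2 \<le> real (D f n v * D f n (f v))) = (0::real)" using False by (simp only: of_bool_eq)
      ultimately show ?thesis by (simp only:)
    qed
  qed
  also have "\<dots> = 16 / y ^ 8 * (?P n 8 / ?P v 8 * ev v (\<lambda>f. H f * 40320) + ?P n 8 / ?P v 8 * ev v (\<lambda>f. H f * (24 * ?P (D f m p) 4)))"
  proof -
    have s: "card (cluster f v {v} v) = 1" "cluster f v (C' f) v = C' f" for f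
      using v cluster_subset[of f p "{p}" m] m by (auto simp: cluster_self C'_def)
    have e: "pochhammer (1::real) 8 = 40320" "pochhammer (1::real) 4 = 24"
      by (simp_all add: pochhammer_fact[symmetric] fact_numeral)
    have "ev n (\<lambda>f. H f * (pochhammer (?k f) 8 * pochhammer (?l f) 0)) = ?P n 8 / ?P v 8 * ev v (\<lambda>f. H f * 40320)"
      using urn_moments[OF _ v(2) loc disj, of 8 0] v by (simp add: s e)
    moreover have "ev n (\<lambda>f. H f * (pochhammer (?k f) 4 * pochhammer (?l f) 4)) = ?P n 8 / ?P v 8 * ev v (\<lambda>f. H f * (24 * pochhammer (real (card (C' f))) 4))"
      using urn_moments[OF _ v(2) loc disj, of 4 4] v by (simp add: s e)
    moreover have "C' f = desc f m p" for f by (simp add: C'_def m)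
    ultimately show ?thesis by (simp only: ev_cmult ev_add)
  qed
  also have "\<dots> = 16 / y ^ 8 * (?P n 8 / ?P v 8) * (40320 + 24 * ev m (\<lambda>f. ?P (D f m p) 4)) / (real v - 1)"
  proof -
    have "ev v (\<lambda>f. H f * 40320) = 40320 / (real v - 1)" "ev v (\<lambda>f. H f * (24 * ?P (D f m p) 4)) = ev m (\<lambda>f. 24 * ?P (D f m p) 4) / (real v - 1)"
      unfolding H_def m using ev_parent[of m p "\<lambda>f. 40320"] ev_parent[of m p "\<lambda>f. 24 * ?P (D f m p) 4"] m p
      by (simp_all add: cluster_upd)
    moreover have "a * (b * (x / g) + b * (z / g)) = a * b * (x + z) / g" for a b x z g :: real
      by (simp add: algebra_simps add_divide_distrib)
    ultimately show ?thesis by (simp only: ev_cmult)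
  qed
  also have "\<dots> \<le> 16 / y ^ 8 * (real n / real v) ^ 8 * (40320 * (real v / real p) ^ 4 + 24 * (24 * (real v / real p) ^ 4)) / (real v - 1)"
  proof (intro divide_right_mono mult_mono sp add_mono mult_left_mono)
    have "(1::real) \<le> (real v / real p) ^ 4" using p by (intro one_le_power) auto
    then show "40320 \<le> 40320 * (real v / real p) ^ 4" by simp
    have "ev m (\<lambda>f. ?P (D f m p) 4) = ?P m 4 / ?P p 4 * 24"
      using urn_moments[of p m "\<lambda>_. 1" "\<lambda>_. {p}" "\<lambda>_. {}" 4 0] p m
      by (simp add: cluster_self pochhammer_fact[symmetric] fact_numeral)
    also have "\<dots> \<le> (real m / real p) ^ 4 * 24" using p m by (intro mult_right_mono pochhammer_ratio_le) auto
    also have "\<dots> \<le> (real v / real p) ^ 4 * 24" using m by (intro mult_right_mono power_mono divide_right_mono) auto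
    finally show "ev m (\<lambda>f. ?P (D f m p) 4) \<le> 24 * (real v / real p) ^ 4" by simp
    show "0 \<le> 40320 + 24 * ev m (\<lambda>f. ?P (D f m p) 4)" by (intro add_nonneg_nonneg mult_nonneg_nonneg ev_nonneg pochhammer_nonneg') auto
  qed (use v y in \<open>auto intro!: divide_nonneg_nonneg pochhammer_nonneg' ev_nonneg\<close>)
  also have "\<dots> = 1 / (real v - 1) * (654336 * (real n ^ 2 / (real v * real p * y\<^sup>2)) ^ 4)"
  proof -
    have E: "(real n / real v) ^ 8 * (real v / real p) ^ 4 / y ^ 8 = (real n ^ 2 / (real v * real p * y\<^sup>2)) ^ 4"
    proof -
      have "(real n / real v)\<^sup>2 * (real v / real p) / y\<^sup>2 = real n ^ 2 / (real v * real p * y\<^sup>2)"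
        using v by (simp add: power2_eq_square)
      moreover have "(real n / real v) ^ 8 * (real v / real p) ^ 4 / y ^ 8 = ((real n / real v)\<^sup>2 * (real v / real p) / y\<^sup>2) ^ 4"
        unfolding power_divide[of _ "y\<^sup>2"] power_mult_distrib power_mult[symmetric] by simp
      ultimately show ?thesis by (simp only:)
    qed
    have "16 / Y * N * (40320 * P + 24 * (24 * P)) / w = 1 / w * (654336 * (N * P / Y))" for Y N P w :: real
      by simp
    from this[of "y ^ 8" "(real n / real v) ^ 8" "(real v / real p) ^ 4" "real v - 1"]
    show ?thesis unfolding E .
  qed
  finally show ?thesis .
qed

section \<open>Binary shapes and abundance of central vertices\<close>

datatype bin_shape = Lf | Nd bin_shape bin_shape

primrec leaves :: "bin_shape \<Rightarrow> nat" where
  "leaves Lf = 1"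
| "leaves (Nd A B) = leaves A + leaves B"

text \<open>
  The encoding of a recursive tree by oldest child and remainder. The vertices sit at the leaves;
  an inner node separates the subtree of the oldest child of a vertex from the vertex itself with
  its other descendants. A new vertex splits the leaf of its parent in two, so the shape of this
  binary tree grows by splitting a uniform leaf.
\<close>

datatype ltree = LLeaf nat | LNode ltree ltree

primrec shape :: "ltree \<Rightarrow> bin_shape" where
  "shape (LLeaf a) = Lf"
| "shape (LNode A B) = Nd (shape A) (shape B)"

primrec labels :: "ltree \<Rightarrow> nat set" where
  "labels (LLeaf a) = {a}"
| "labels (LNode A B) = labels A \<union> labels B"

text \<open>
  The root of an encoded tree is its rightmost leaf.
\<close>

primrec root_label :: "ltree \<Rightarrow> nat" where
  "root_label (LLeaf a) = a"
| "root_label (LNode A B) = root_label B"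

primrec attach :: "nat \<Rightarrow> nat \<Rightarrow> ltree \<Rightarrow> ltree" where
  "attach u x (LLeaf a) = (if a = u then LNode (LLeaf x) (LLeaf a) else LLeaf a)"
| "attach u x (LNode A B) = LNode (attach u x A) (attach u x B)"

primrec encoding :: "(nat \<Rightarrow> nat) \<Rightarrow> nat \<Rightarrow> ltree" where
  "encoding f 0 = LLeaf 1"
| "encoding f (Suc n) = (if n = 0 then LLeaf 1 else attach (f (Suc n)) (Suc n) (encoding f n))"

text \<open>
  The invariant of the growth: a left part consists of all descendants of a child of the root of
  the right part.
\<close>

primrec encodes :: "(nat \<Rightarrow> nat) \<Rightarrow> nat \<Rightarrow> ltree \<Rightarrow> bool" where
  "encodes f n (LLeaf a) = True"
| "encodes f n (LNode A B) = (labels A = desc f n (root_label A) \<and> f (root_label A) = root_label B \<and> labels A \<inter> labels B = {} \<and> encodes f n A \<and> encodes f n B)"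

lemma finite_labels [simp]: "finite (labels t)" by (induction t) auto
lemma root_label_in_labels: "root_label t \<in> labels t" by (induction t) auto
lemma labels_attach: "labels (attach u x t) = (if u \<in> labels t then insert x (labels t) else labels t)" by (induction t) auto
lemma root_label_attach [simp]: "root_label (attach u x t) = root_label t" by (induction t) auto
lemma attach_id: "u \<notin> labels t \<Longrightarrow> attach u x t = t" by (induction t) auto

lemma leaves_shape: "encodes f n t \<Longrightarrow> leaves (shape t) = card (labels t)"
  by (induction t) (auto simp: card_Un_disjoint)

lemma encodes_attach:
  assumes f: "valid (Suc n) f" "1 \<le> n" and u: "u = f (Suc n)" and "encodes f n t" "labels t \<subseteq> {1..n}"
  shows "encodes f (Suc n) (attach u (Suc n) t)"
  using assms(4,5)
proof (induction t)
  case (LLeaf a)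
  have "desc f (Suc n) (Suc n) = {Suc n}"
    using desc_ge[OF f(1), of "Suc n"] desc_self[of "Suc n" "Suc n" f] by fastforce
  then show ?case using LLeaf u by auto
next
  case (LNode A B)
  have "root_label A \<in> {1..n}" using root_label_in_labels[of A] LNode.prems by auto
  then have "desc f (Suc n) (root_label A) = (if u \<in> labels A then insert (Suc n) (labels A) else labels A)"
    using cluster_Suc[OF f(1), of "root_label A" "{root_label A}"] LNode.prems u by auto
  moreover have "Suc n \<notin> labels A" "Suc n \<notin> labels B" using LNode.prems by auto
  ultimately show ?case using LNode by (auto simp: labels_attach)
qed

lemma encoding_props:
  assumes "valid n f" "1 \<le> n"
  shows "encodes f n (encoding f n) \<and> labels (encoding f n) = {1..n} \<and> root_label (encoding f n) = 1"
  using assms(2,1)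
proof (induction n rule: dec_induct)
  case (step n)
  have v: "valid n f" using step.prems by (rule valid_mono) simp
  have u: "f (Suc n) \<in> {1..n}" using validD[OF step.prems, of "Suc n"] step.hyps by auto
  have "encodes f (Suc n) (attach (f (Suc n)) (Suc n) (encoding f n))"
    using step v by (intro encodes_attach) auto
  moreover have "insert (Suc n) {1..n} = {1..Suc n}" by auto
  ultimately show ?case using step v u by (auto simp: labels_attach)
qed auto

lemma encoding_upd: "n < k \<Longrightarrow> encoding (f(k := u)) n = encoding f n"
  by (induction n) auto

text \<open>
  The sum of \<open>g\<close> over the shapes that arise by splitting one leaf.
\<close>

primrec growth_sum :: "bin_shape \<Rightarrow> (bin_shape \<Rightarrow> real) \<Rightarrow> real" where
  "growth_sum Lf g = g (Nd Lf Lf)"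
| "growth_sum (Nd A B) g = growth_sum A (\<lambda>A'. g (Nd A' B)) + growth_sum B (\<lambda>B'. g (Nd A B'))"

lemma sum_attach: "encodes f n t \<Longrightarrow> (\<Sum>u\<in>labels t. g (shape (attach u x t))) = growth_sum (shape t) g"
proof (induction t arbitrary: g)
  case (LNode A B)
  then have d: "labels A \<inter> labels B = {}" by auto
  have "(\<Sum>u\<in>labels (LNode A B). g (shape (attach u x (LNode A B)))) =
     (\<Sum>u\<in>labels A. g (Nd (shape (attach u x A)) (shape (attach u x B)))) + (\<Sum>u\<in>labels B. g (Nd (shape (attach u x A)) (shape (attach u x B))))"
    using d by (simp add: sum.union_disjoint)
  also have "(\<Sum>u\<in>labels A. g (Nd (shape (attach u x A)) (shape (attach u x B)))) = (\<Sum>u\<in>labels A. g (Nd (shape (attach u x A)) (shape B)))"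
    using d by (intro sum.cong) (auto simp: attach_id disjoint_iff)
  also have "(\<Sum>u\<in>labels B. g (Nd (shape (attach u x A)) (shape (attach u x B)))) = (\<Sum>u\<in>labels B. g (Nd (shape A) (shape (attach u x B))))"
  proof (rule sum.cong[OF refl])
    fix u assume "u \<in> labels B"
    then have "u \<notin> labels A" using d by blast
    then show "g (Nd (shape (attach u x A)) (shape (attach u x B))) = g (Nd (shape A) (shape (attach u x B)))" by (simp add: attach_id)
  qed
  also have "(\<Sum>u\<in>labels A. g (Nd (shape (attach u x A)) (shape B))) = growth_sum (shape A) (\<lambda>A'. g (Nd A' (shape B)))"
    using LNode.prems by (intro LNode.IH(1)) auto
  also have "(\<Sum>u\<in>labels B. g (Nd (shape A) (shape (attach u x B)))) = growth_sum (shape B) (\<lambda>B'. g (Nd (shape A) B'))"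
    using LNode.prems by (intro LNode.IH(2)) auto
  finally show ?case by simp
qed auto

text \<open>
  The expectation over the shape of a random recursive tree with \<open>n\<close> vertices.
\<close>

definition shape_ev :: "nat \<Rightarrow> (bin_shape \<Rightarrow> real) \<Rightarrow> real" where
  "shape_ev n g = ev n (\<lambda>f. g (shape (encoding f n)))"

lemma shape_ev_1: "shape_ev (Suc 0) g = g Lf"
  by (simp add: shape_ev_def)

lemma shape_ev_Suc: "1 \<le> n \<Longrightarrow> shape_ev (Suc n) g = shape_ev n (\<lambda>t. growth_sum t g) / real n"
proof -
  assume n: "1 \<le> n"
  have "(\<Sum>u=1..n. g (shape (encoding (f(Suc n := u)) (Suc n)))) = growth_sum (shape (encoding f n)) g" if "valid n f" for f
    using encoding_props[OF that n] sum_attach[of f n "encoding f n" g "Suc n"] n by (simp add: encoding_upd)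
  then have "ev n (\<lambda>f. (\<Sum>u=1..n. g (shape (encoding (f(Suc n := u)) (Suc n)))) / real n) = ev n (\<lambda>f. growth_sum (shape (encoding f n)) g / real n)"
    by (intro ev_cong) simp
  then show ?thesis unfolding shape_ev_def by (simp only: ev_Suc[OF n] ev_divide)
qed

lemma shape_ev_add: "shape_ev n (\<lambda>t. g t + h t) = shape_ev n g + shape_ev n h" by (simp add: shape_ev_def ev_add)
lemma shape_ev_cmult: "shape_ev n (\<lambda>t. c * g t) = c * shape_ev n g" by (simp add: shape_ev_def ev_cmult)
lemma shape_ev_multc: "shape_ev n (\<lambda>t. g t * c) = shape_ev n g * c" by (simp add: shape_ev_cmult mult.commute[of _ c])

lemma leaves_encoding: "valid n f \<Longrightarrow> 1 \<le> n \<Longrightarrow> leaves (shape (encoding f n)) = n"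
  using leaves_shape[of f n "encoding f n"] encoding_props[of n f] by simp

lemma shape_ev_cong: "1 \<le> n \<Longrightarrow> (\<And>t. leaves t = n \<Longrightarrow> g t = h t) \<Longrightarrow> shape_ev n g = shape_ev n h"
  unfolding shape_ev_def by (intro ev_cong) (simp add: leaves_encoding)

lemma shape_ev_const [simp]: "shape_ev n (\<lambda>_. c) = c" by (simp add: shape_ev_def)

lemma growth_sum_shape_ev: "growth_sum A (\<lambda>A'. shape_ev m (G A')) = shape_ev m (\<lambda>B. growth_sum A (\<lambda>A'. G A' B))"
  by (induction A arbitrary: G) (simp_all add: shape_ev_add)

text \<open>
  The two parts at the top of the shape have uniform sizes \<open>k\<close> and \<open>n - k\<close> and are, given the
  sizes, independent copies of the same random shape. Size \<open>k\<close> of the left part arises by a split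
  on the left from \<open>k - 1\<close>, or by a split on the right from \<open>k\<close>; the rates \<open>k - 1\<close> and \<open>n - k\<close> add
  up to \<open>n - 1\<close> for each \<open>k\<close>, so the law stays uniform.
\<close>

lemma shape_ev_split:
  assumes "2 \<le> n"
  shows "shape_ev n g = (\<Sum>k=1..n-1. shape_ev k (\<lambda>A. shape_ev (n - k) (\<lambda>B. g (Nd A B)))) / real (n - 1)"
  using assms
proof (induction n arbitrary: g rule: dec_induct)
  case base
  have "shape_ev 2 g = g (Nd Lf Lf)" using shape_ev_Suc[of 1 g] by (simp add: shape_ev_1 numeral_2_eq_2)
  then show ?case by (simp add: shape_ev_1)
next
  case (step n)
  define F where "F i j = shape_ev i (\<lambda>A. shape_ev j (\<lambda>B. g (Nd A B)))" for i j
  have 1: "shape_ev k (\<lambda>A. shape_ev (n - k) (\<lambda>B. growth_sum (Nd A B) g)) = real k * F (Suc k) (n - k) + real (n - k) * F k (Suc (n - k))"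
    if k: "k \<in> {1..n-1}" for k
  proof -
    have "shape_ev k (\<lambda>A. shape_ev (n - k) (\<lambda>B. growth_sum (Nd A B) g)) =
       shape_ev k (\<lambda>A. growth_sum A (\<lambda>A'. shape_ev (n - k) (\<lambda>B. g (Nd A' B)))) + shape_ev k (\<lambda>A. shape_ev (n - k) (\<lambda>B. growth_sum B (\<lambda>B'. g (Nd A B'))))"
      by (simp add: shape_ev_add growth_sum_shape_ev)
    also have "shape_ev k (\<lambda>A. growth_sum A (\<lambda>A'. shape_ev (n - k) (\<lambda>B. g (Nd A' B)))) = real k * F (Suc k) (n - k)"
      unfolding F_def using k shape_ev_Suc[of k "\<lambda>A'. shape_ev (n - k) (\<lambda>B. g (Nd A' B))"] by simp
    also have "shape_ev k (\<lambda>A. shape_ev (n - k) (\<lambda>B. growth_sum B (\<lambda>B'. g (Nd A B')))) = shape_ev k (\<lambda>A. real (n - k) * shape_ev (Suc (n - k)) (\<lambda>B. g (Nd A B)))"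
    proof -
      have "shape_ev (n - k) (\<lambda>B. growth_sum B G) = real (n - k) * shape_ev (Suc (n - k)) G" for G
      proof -
        have "1 \<le> n - k" using k by auto
        then show ?thesis using shape_ev_Suc[of "n - k" G] by (simp del: of_nat_diff)
      qed
      then show ?thesis by (simp only:)
    qed
    finally show ?thesis by (simp add: shape_ev_cmult F_def)
  qed
  have "shape_ev (Suc n) g = shape_ev n (\<lambda>t. growth_sum t g) / real n" using step by (intro shape_ev_Suc) simp
  also have "shape_ev n (\<lambda>t. growth_sum t g) = (\<Sum>k=1..n-1. real k * F (Suc k) (n - k) + real (n - k) * F k (Suc (n - k))) / real (n - 1)"
    unfolding step.IH by (intro arg_cong2[where f = "(/)"] sum.cong 1) auto
  also have "(\<Sum>k=1..n-1. real k * F (Suc k) (n - k) + real (n - k) * F k (Suc (n - k)))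
     = (\<Sum>k=1..n-1. real k * F (Suc k) (n - k)) + (\<Sum>k=1..n-1. real (n - k) * F k (Suc (n - k)))"
    by (rule sum.distrib)
  also have "(\<Sum>k=1..n-1. real k * F (Suc k) (n - k)) = (\<Sum>k=1..n. real (k - 1) * F k (Suc n - k))"
  proof -
    have "(\<Sum>k=1..n. real (k - 1) * F k (Suc n - k)) = (\<Sum>k=0..n-1. real k * F (Suc k) (n - k))"
      using step by (intro sum.reindex_bij_witness[of _ Suc "\<lambda>k. k - 1"]) auto
    also have "\<dots> = (\<Sum>k=1..n-1. real k * F (Suc k) (n - k))"
      by (intro sum.mono_neutral_right) auto
    finally show ?thesis by simp
  qed
  also have "(\<Sum>k=1..n-1. real (n - k) * F k (Suc (n - k))) = (\<Sum>k=1..n. real (n - k) * F k (Suc n - k))"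
    using step by (intro sum.mono_neutral_cong_left) (auto simp: Suc_diff_le)
  also have "(\<Sum>k=1..n. real (k - 1) * F k (Suc n - k)) + (\<Sum>k=1..n. real (n - k) * F k (Suc n - k)) = (\<Sum>k=1..n. real (n - 1) * F k (Suc n - k))"
    unfolding sum.distrib[symmetric] by (intro sum.cong) (auto simp: distrib_right[symmetric] of_nat_add[symmetric] simp del: of_nat_add)
  also have "\<dots> / real (n - 1) / real n = (\<Sum>k=1..n. F k (Suc n - k)) / real n"
    unfolding sum_distrib_left[symmetric] using step by simp
  finally show ?case by (simp add: F_def)
qed

text \<open>
  The product of \<open>h (D w) (D (f w))\<close> over all vertices \<open>w\<close> except the root. The number \<open>z\<close> stands
  for the number of descendants of the vertex at the rightmost leaf; it is passed on to the right
  part and is replaced by the actual size in the left part.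
\<close>

primrec weight :: "(nat \<Rightarrow> nat \<Rightarrow> real) \<Rightarrow> nat \<Rightarrow> bin_shape \<Rightarrow> real" where
  "weight h z Lf = 1"
| "weight h z (Nd A B) = h (leaves A) z * weight h (leaves A) A * weight h z B"

definition mean_weight :: "(nat \<Rightarrow> nat \<Rightarrow> real) \<Rightarrow> nat \<Rightarrow> nat \<Rightarrow> real" where
  "mean_weight h n z = shape_ev n (weight h z)"

lemma mean_weight_1: "mean_weight h (Suc 0) z = 1" by (simp add: mean_weight_def shape_ev_1)

lemma mean_weight_rec:
  assumes "2 \<le> n"
  shows "mean_weight h n z = (\<Sum>k=1..n-1. h k z * mean_weight h k k * mean_weight h (n - k) z) / real (n - 1)"
proof -
  have "shape_ev k (\<lambda>A. shape_ev (n - k) (\<lambda>B. weight h z (Nd A B))) = h k z * mean_weight h k k * mean_weight h (n - k) z" if "k \<in> {1..n-1}" for k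
  proof -
    have "shape_ev k (\<lambda>A. shape_ev (n - k) (\<lambda>B. weight h z (Nd A B))) = shape_ev k (\<lambda>A. h k z * (weight h k A * mean_weight h (n - k) z))"
      using that by (intro shape_ev_cong) (simp_all add: shape_ev_cmult mean_weight_def mult.assoc)
    then show ?thesis by (simp add: shape_ev_cmult shape_ev_multc mean_weight_def)
  qed
  then show ?thesis unfolding mean_weight_def[of h n] shape_ev_split[OF assms] by simp
qed

lemma mean_weight_nonneg:
  assumes "\<And>k d. 0 \<le> h k d"
  shows "0 \<le> mean_weight h n z"
proof -
  have "0 \<le> weight h z t" for t by (induction t arbitrary: z) (auto intro!: mult_nonneg_nonneg assms)
  then show ?thesis unfolding mean_weight_def shape_ev_def by (intro ev_nonneg) auto
qed

lemma weight_prod: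
  assumes f: "valid n f" and "encodes f n t" "labels t \<subseteq> {1..n}"
  shows "weight h z (shape t) = (\<Prod>w\<in>labels t - {root_label t}. h (D f n w) (if f w = root_label t then z else D f n (f w)))"
  using assms(2,3)
proof (induction t arbitrary: z)
  case (LNode A B)
  let ?g = "\<lambda>r z w. h (D f n w) (if f w = r then z else D f n (f w))"
  have A: "labels A = desc f n (root_label A)" "f (root_label A) = root_label B" "labels A \<inter> labels B = {}" "encodes f n A" "encodes f n B" using LNode.prems by auto
  have rA: "1 \<le> root_label A" using root_label_in_labels[of A] LNode.prems by auto
  have lvA: "leaves (shape A) = D f n (root_label A)" using leaves_shape[OF A(4)] A(1) by simp
  have rB: "root_label B \<in> labels B" by (rule root_label_in_labels)
  have "labels (LNode A B) - {root_label (LNode A B)} = insert (root_label A) ((labels A - {root_label A}) \<union> (labels B - {root_label B}))"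
    using root_label_in_labels[of A] rB A(3) by auto
  then have "(\<Prod>w\<in>labels (LNode A B) - {root_label (LNode A B)}. ?g (root_label B) z w)
     = ?g (root_label B) z (root_label A) * (\<Prod>w\<in>(labels A - {root_label A}) \<union> (labels B - {root_label B}). ?g (root_label B) z w)"
    using A(3) root_label_in_labels[of A] by (simp add: disjoint_iff)
  also have "(\<Prod>w\<in>(labels A - {root_label A}) \<union> (labels B - {root_label B}). ?g (root_label B) z w) =
      (\<Prod>w\<in>labels A - {root_label A}. ?g (root_label B) z w) * (\<Prod>w\<in>labels B - {root_label B}. ?g (root_label B) z w)"
    using A(3) by (intro prod.union_disjoint) auto
  also have "(\<Prod>w\<in>labels A - {root_label A}. ?g (root_label B) z w) = (\<Prod>w\<in>labels A - {root_label A}. ?g (root_label A) (leaves (shape A)) w)"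
  proof (rule prod.cong[OF refl])
    fix w assume w: "w \<in> labels A - {root_label A}"
    then have "w \<in> desc f n (root_label A)" "w \<noteq> root_label A" using A(1) by auto
    then have "w \<in> {2..n}" using desc_ge[OF f rA, of w] rA by auto
    then have "f w \<in> labels A" using w desc_parent[OF f rA, of w] A(1) by auto
    then have "f w \<noteq> root_label B" using A(3) rB by auto
    then show "?g (root_label B) z w = ?g (root_label A) (leaves (shape A)) w" by (auto simp: lvA)
  qed
  finally have fin: "(\<Prod>w\<in>labels (LNode A B) - {root_label (LNode A B)}. ?g (root_label B) z w) = h (D f n (root_label A)) z *
     ((\<Prod>w\<in>labels A - {root_label A}. ?g (root_label A) (leaves (shape A)) w) * (\<Prod>w\<in>labels B - {root_label B}. ?g (root_label B) z w))"
    by (simp only: A(2) refl if_True simp_thms)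
  have "weight h (leaves (shape A)) (shape A) = (\<Prod>w\<in>labels A - {root_label A}. ?g (root_label A) (leaves (shape A)) w)"
    using LNode.prems by (intro LNode.IH(1)) auto
  moreover have "weight h z (shape B) = (\<Prod>w\<in>labels B - {root_label B}. ?g (root_label B) z w)"
    using LNode.prems by (intro LNode.IH(2)) auto
  ultimately have "weight h z (shape (LNode A B)) = h (D f n (root_label A)) z *
     ((\<Prod>w\<in>labels A - {root_label A}. ?g (root_label A) (leaves (shape A)) w) * (\<Prod>w\<in>labels B - {root_label B}. ?g (root_label B) z w))"
    by (simp only: shape.simps weight.simps lvA[symmetric] mult.assoc)
  then show ?case unfolding fin[symmetric] by (simp only: root_label.simps)
qed auto

text \<open>
  A product over all vertices of a function of the sizes of the vertex and of its parent has a
  mean that satisfies the recursion \<open>mean_weight_rec\<close>.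
\<close>

lemma ev_prod:
  assumes "1 \<le> n"
  shows "ev n (\<lambda>f. \<Prod>w\<in>{2..n}. h (D f n w) (D f n (f w))) = mean_weight h n n"
  unfolding mean_weight_def shape_ev_def
proof (rule ev_cong)
  fix f assume f: "valid n f"
  have s: "{2..n} = {1..n} - {1}" by auto
  have t: "encodes f n (encoding f n)" "labels (encoding f n) = {1..n}" "root_label (encoding f n) = 1" using encoding_props[OF f assms] by auto
  have "weight h n (shape (encoding f n)) = (\<Prod>w\<in>{2..n}. h (D f n w) (if f w = 1 then n else D f n (f w)))"
    unfolding s using weight_prod[OF f t(1), of h n] t by simp
  also have "\<dots> = (\<Prod>w\<in>{2..n}. h (D f n w) (D f n (f w)))"
    using D_1[OF f] by (intro prod.cong) auto
  finally show "(\<Prod>w\<in>{2..n}. h (D f n w) (D f n (f w))) = weight h n (shape (encoding f n))" by simp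
qed

text \<open>
  The terms are dominated by differences of \<open>y / (1 + k / y)\<close>, which telescope.
\<close>

lemma sum_inverse_square_le:
  fixes y :: real assumes "0 < y"
  shows "(\<Sum>k=1..m. 1 / (1 + real k / y)\<^sup>2) \<le> y"
proof -
  have "1 / (1 + real (Suc k) / y)\<^sup>2 \<le> y * (1 / (1 + real k / y) - 1 / (1 + real (Suc k) / y))" for k
  proof -
    define a where "a = 1 + real k / y"
    have a: "1 \<le> a" "1 + real (Suc k) / y = a + 1 / y" using assms by (auto simp: a_def add_divide_distrib)
    have "y * (1 / a - 1 / (a + 1 / y)) = 1 / (a * (a + 1 / y))"
      using a assms by (simp add: divide_simps add_pos_pos)
    moreover have "a * (a + 1 / y) \<le> (a + 1 / y)\<^sup>2" unfolding power2_eq_square using a assms by (intro mult_right_mono) auto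
    moreover have "0 < a * (a + 1 / y)" using a assms by (intro mult_pos_pos add_pos_pos) auto
    ultimately show ?thesis unfolding a a_def[symmetric] by (simp add: frac_le)
  qed
  note step = this
  have "(\<Sum>k=1..m. 1 / (1 + real k / y)\<^sup>2) \<le> y * (1 - 1 / (1 + real m / y))"
  proof (induction m)
    case (Suc m)
    then show ?case using step[of m] by (simp add: algebra_simps del: of_nat_Suc)
  qed auto
  also have "\<dots> \<le> y" using assms by (simp add: mult_le_cancel_left1)
  finally show ?thesis .
qed

text \<open>
  A bonus \<open>3 / 2\<close> for each vertex with \<open>k * d \<ge> y\<^sup>2\<close>, the vertices to be counted, and a payment
  \<open>y\<^sup>2 / (2 * k\<^sup>2)\<close> for each vertex with at least \<open>y\<close> descendants. The payment cancels the mean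
  weight inside the subtree of that vertex, so that the weights do not multiply along a branch.
\<close>

definition pair_weight :: "real \<Rightarrow> nat \<Rightarrow> nat \<Rightarrow> real" where
  "pair_weight y k d = (if y\<^sup>2 \<le> real k * real d then 3 / 2 else 1) * (if y \<le> real k then y\<^sup>2 / (2 * (real k)\<^sup>2) else 1)"

text \<open>
  Compensates the payments in \<open>pair_weight\<close>: the product of a payment and the square of this
  weight is \<open>y\<^sup>2 / (2 * k\<^sup>2) * (2 * k / y)\<^sup>2 = 2\<close>.
\<close>

definition size_weight :: "real \<Rightarrow> nat \<Rightarrow> nat \<Rightarrow> real" where
  "size_weight y k d = (if y \<le> real k then 2 * real k / y else 1)"

text \<open>
  The function \<open>1 + n * z / y\<^sup>2\<close> is a supersolution of the recursion. The payment reduces the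
  factor of the left part to at most \<open>1\<close>. The bonus \<open>3 / 2\<close> is earned only if \<open>k * z / y\<^sup>2 \<ge> 1\<close>,
  and is then absorbed by half of \<open>n * z / y\<^sup>2\<close>; the average of \<open>n - k\<close> over \<open>k\<close> supplies the
  other half. When \<open>n * z < y\<^sup>2\<close> no bonus can be earned.
\<close>

lemma mean_weight_pair_weight:
  assumes y: "0 < y" and n: "1 \<le> n" "n \<le> z"
  shows "mean_weight (pair_weight y) n z \<le> 1 + real n * real z / y\<^sup>2 \<and> (real n * real z < y\<^sup>2 \<longrightarrow> mean_weight (pair_weight y) n z \<le> 1)"
  using n
proof (induction n arbitrary: z rule: less_induct)
  case (less n)
  show ?case
  proof (cases "n = 1")
    case True
    then show ?thesis by (simp add: mean_weight_1)
  next
    case False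
    then have n2: "2 \<le> n" using less by simp
    define c where "c = real z / y\<^sup>2"
    have c0: "0 \<le> c" by (simp add: c_def)
    have h0: "0 \<le> pair_weight y k d" for k d by (simp add: pair_weight_def)
    define d where "d k = (if y \<le> real k then y\<^sup>2 / (2 * (real k)\<^sup>2) else 1)" for k
    have small: "d k * mean_weight (pair_weight y) k k \<le> 1" if k: "k \<in> {1..n-1}" for k
    proof (cases "y \<le> real k")
      case True
      have "mean_weight (pair_weight y) k k \<le> 1 + real k * real k / y\<^sup>2" using less.IH[of k k] k by auto
      also have "\<dots> \<le> 2 * (real k)\<^sup>2 / y\<^sup>2" using True y mult_mono[of y "real k" y "real k"] by (simp add: field_simps power2_eq_square)
      finally show ?thesis using True y k by (simp add: d_def field_simps)
    next
      case False
      then have "real k * real k < y\<^sup>2" using mult_strict_mono[of "real k" y "real k" y] k by (simp add: power2_eq_square)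
      then show ?thesis using False less.IH[of k k] k by (auto simp: d_def)
    qed
    have trm: "pair_weight y k z * mean_weight (pair_weight y) k k * mean_weight (pair_weight y) (n - k) z \<le> (if y\<^sup>2 \<le> real k * real z then 3 / 2 else 1) * mean_weight (pair_weight y) (n - k) z"
      if k: "k \<in> {1..n-1}" for k
    proof -
      have "pair_weight y k z * mean_weight (pair_weight y) k k = (if y\<^sup>2 \<le> real k * real z then 3 / 2 else 1) * (d k * mean_weight (pair_weight y) k k)"
        by (simp add: pair_weight_def d_def)
      also have "\<dots> \<le> (if y\<^sup>2 \<le> real k * real z then 3 / 2 else 1) * 1"
        using small[OF k] by (intro mult_left_mono) auto
      finally show ?thesis using mean_weight_nonneg[OF h0] by (intro mult_right_mono) auto
    qed
    have cn: "real (n - 1) = real n - 1" using n2 by (simp add: of_nat_diff)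
    have s: "(\<Sum>k=1..n-1. real (n - k)) = real n * (real n - 1) / 2"
    proof -
      have "(\<Sum>k=1..n-1. real (n - k)) = (\<Sum>k=1..n-1. real k)"
        by (intro sum.reindex_bij_witness[of _ "\<lambda>k. n - k" "\<lambda>k. n - k"]) auto
      also have "\<dots> = real (\<Sum>k=1..n-1. k)" by simp
      also have "(\<Sum>k=1..n-1. k) = (n - 1) * n div 2" using gauss_sum_from_Suc_0[of "n - 1", where 'a=nat] n2 by simp
      also have "real ((n - 1) * n div 2) = real ((n - 1) * n) / 2" by (subst real_of_nat_div) auto
      finally show ?thesis using cn by simp
    qed
    have "mean_weight (pair_weight y) n z \<le> (\<Sum>k=1..n-1. 1 + (real (n - k) * c + real n * c / 2)) / real (n - 1)"
      unfolding mean_weight_rec[OF n2]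
    proof (intro divide_right_mono sum_mono)
      fix k assume k: "k \<in> {1..n-1}"
      have q: "mean_weight (pair_weight y) (n - k) z \<le> 1 + real (n - k) * c" using less.IH[of "n - k" z] k less.prems by (auto simp: c_def)
      have kc: "y\<^sup>2 \<le> real k * real z \<longleftrightarrow> 1 \<le> real k * c" using y by (simp add: c_def field_simps)
      have "(if y\<^sup>2 \<le> real k * real z then 3 / 2 else 1) * mean_weight (pair_weight y) (n - k) z \<le> 1 + (real (n - k) * c + real n * c / 2)"
      proof (cases "1 \<le> real k * c")
        case True
        have "k \<le> n" using k by auto
        then have "real n = real k + real (n - k)" by (simp add: of_nat_diff)
        then have "real n * c = real k * c + real (n - k) * c" by (simp only: distrib_right)
        moreover have "3 / 2 * q \<le> 1 + (b + N / 2)" if "N = a + b" "1 \<le> a" "q \<le> 1 + b" for a b N q :: real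
        proof -
          have "3 * q \<le> 3 * (1 + b)" using that(3) by simp
          then have "3 * q \<le> 2 + (2 * b + N)" using that(1,2) by argo
          then show ?thesis by argo
        qed
        moreover have "y\<^sup>2 \<le> real k * real z" using True kc by blast
        ultimately show ?thesis using True q by (simp only: if_True)
      next
        case False
        moreover have "0 \<le> real n * c" using c0 by simp
        moreover have "\<not> y\<^sup>2 \<le> real k * real z" using False kc by blast
        ultimately show ?thesis using q by (simp only: if_False)
      qed
      then show "pair_weight y k z * mean_weight (pair_weight y) k k * mean_weight (pair_weight y) (n - k) z \<le> 1 + (real (n - k) * c + real n * c / 2)"
        using trm[OF k] by linarith
    qed auto
    also have "(\<Sum>k=1..n-1. 1 + (real (n - k) * c + real n * c / 2)) = (real n - 1) * (1 + real n * c)"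
      unfolding sum.distrib sum_distrib_right[symmetric] s using cn by (simp add: algebra_simps)
    also have "\<dots> / real (n - 1) = 1 + real n * c" using cn n2 by simp
    finally have b1: "mean_weight (pair_weight y) n z \<le> 1 + real n * real z / y\<^sup>2" by (simp add: c_def)
    have b2: "mean_weight (pair_weight y) n z \<le> 1" if nz: "real n * real z < y\<^sup>2"
    proof -
      have "mean_weight (pair_weight y) n z \<le> (\<Sum>k=1..n-1. 1) / real (n - 1)"
        unfolding mean_weight_rec[OF n2]
      proof (intro divide_right_mono sum_mono)
        fix k assume k: "k \<in> {1..n-1}"
        have "real k * real z \<le> real n * real z" "real (n - k) * real z \<le> real n * real z" using k by (auto intro!: mult_right_mono)
        then have "real k * real z < y\<^sup>2" "real (n - k) * real z < y\<^sup>2" using nz by auto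
        then show "pair_weight y k z * mean_weight (pair_weight y) k k * mean_weight (pair_weight y) (n - k) z \<le> 1"
        proof -
          have nk: "n - k < n" "1 \<le> n - k" "n - k \<le> z" using k less.prems by auto
          show ?thesis using trm[OF k] less.IH[OF nk] \<open>real k * real z < y\<^sup>2\<close> \<open>real (n - k) * real z < y\<^sup>2\<close> by auto
        qed
      qed auto
      then show ?thesis using n2 by simp
    qed
    show ?thesis using b1 b2 by simp
  qed
qed

lemma mean_weight_size_weight_indep: "mean_weight (size_weight y) n z = mean_weight (size_weight y) n z'"
proof -
  have "weight (size_weight y) z t = weight (size_weight y) z' t" for t
    by (induction t) (auto simp: size_weight_def)
  then have "weight (size_weight y) z = weight (size_weight y) z'" by (rule ext)
  then show ?thesis by (simp add: mean_weight_def)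
qed

text \<open>
  The supersolution is \<open>exp (480 * n / y) / (24 * (1 + n / y)\<^sup>2)\<close>. The exponential is
  multiplicative and inverse squares are stable under convolution, with a factor that \<open>1 / 24\<close>
  compensates. The rate \<open>480\<close> makes the bound exceed \<open>1\<close> from \<open>n = y / 48\<close> on; for smaller \<open>n\<close> the
  bound \<open>1\<close> is kept, as the indicator, and its contribution to the convolution is small because
  only \<open>y / 48\<close> values of \<open>n\<close> are concerned.
\<close>

lemma mean_weight_size_weight:
  assumes y: "0 < y" and n: "1 \<le> n"
  shows "mean_weight (size_weight y) n z \<le> 1 / 24 * exp (480 * real n / y) / (1 + real n / y)\<^sup>2 + (if 48 * real n < y then 1 else 0)
     \<and> (real n < y \<longrightarrow> mean_weight (size_weight y) n z \<le> 1)"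
  using n
proof (induction n arbitrary: z rule: less_induct)
  case (less n)
  define q where "q k = mean_weight (size_weight y) k 0" for k
  define G where "G k = 1 / 24 * exp (480 * real k / y) / (1 + real k / y)\<^sup>2" for k
  define b where "b k = (if 48 * real k < y then 1 else 0 :: real)" for k
  have qQ: "mean_weight (size_weight y) k z = q k" for k z unfolding q_def by (rule mean_weight_size_weight_indep)
  have h0: "0 \<le> size_weight y k d" for k d using y by (simp add: size_weight_def)
  have q0: "0 \<le> q k" for k unfolding q_def by (rule mean_weight_nonneg[OF h0])
  have G0: "0 \<le> G k" for k by (simp add: G_def)
  have b0: "0 \<le> b k" for k by (simp add: b_def)
  have IH: "q k \<le> G k + b k" "real k < y \<Longrightarrow> q k \<le> 1" if "k \<in> {1..n-1}" for k
    using less.IH[of k 0] that by (auto simp: q_def G_def b_def)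
  have rec: "q n = (\<Sum>k=1..n-1. size_weight y k 0 * q k * q (n - k)) / real (n - 1)" if "2 \<le> n"
    unfolding q_def mean_weight_rec[OF that] using mean_weight_size_weight_indep[of y _ _ 0] by (intro arg_cong2[where f = "(/)"] sum.cong) auto
  have small: "q n \<le> 1" if ny: "real n < y"
  proof (cases "n = 1")
    case False
    then have n2: "2 \<le> n" using less by simp
    have "q n \<le> (\<Sum>k=1..n-1. 1) / real (n - 1)"
      unfolding rec[OF n2]
    proof (intro divide_right_mono sum_mono)
      fix k assume k: "k \<in> {1..n-1}"
      have "n - k \<in> {1..n-1}" "real (n - k) < y" "real k < y" using k ny by (auto simp: of_nat_diff)
      then have "q k * q (n - k) \<le> 1 * 1" using k IH(2)[of k] IH(2)[of "n - k"] q0 by (intro mult_mono) auto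
      then show "size_weight y k 0 * q k * q (n - k) \<le> 1" using \<open>real k < y\<close> by (simp add: size_weight_def)
    qed auto
    then show ?thesis using n2 by simp
  qed (simp add: q_def mean_weight_1)
  have "q n \<le> G n + b n"
  proof (cases "real n < y \<or> n = 1")
    case True
    have q1: "q n \<le> 1" using True small by (auto simp: q_def mean_weight_1)
    show ?thesis
    proof (cases "48 * real n < y")
      case False
      define x where "x = real n / y"
      have x: "1 / 48 \<le> x" using False y by (simp add: x_def field_simps)
      have "96 * (1 + x)\<^sup>2 / 4 \<le> exp (480 * x)"
      proof -
        have "(1 + x) \<le> exp x" using exp_ge_add_one_self[of x] by simp
        then have "(1 + x)\<^sup>2 \<le> (exp x)\<^sup>2" using x by (intro power_mono) auto
        moreover have "(2::real) ^ 9 \<le> exp 1 ^ 9" using exp_ge_add_one_self[of 1] by (intro power_mono) auto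
        then have "(512::real) \<le> exp 9" by (simp add: exp_of_nat_mult[symmetric])
        then have "512 \<le> exp (478 * x)" using x by (elim order_trans) simp
        ultimately have "512 * (1 + x)\<^sup>2 \<le> exp (478 * x) * (exp x)\<^sup>2" by (intro mult_mono) auto
        also have "\<dots> = exp (480 * x)" by (simp add: power2_eq_square exp_add[symmetric])
        finally show ?thesis using zero_le_power2[of "1 + x"] by linarith
      qed
      moreover have "0 < (1 + x)\<^sup>2" using x by simp
      ultimately have "1 \<le> 1 / 24 * exp (480 * x) / (1 + x)\<^sup>2" by (simp add: field_simps)
      then show ?thesis using q1 b0[of n] by (simp add: G_def x_def)
    qed (use q1 G0[of n] in \<open>simp add: b_def\<close>)
  next
    case False
    then have n2: "2 \<le> n" and ny: "y \<le> real n" using less by auto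
    define S where "S = (\<Sum>k=1..n-1. q k * q (n - k))"
    have rev: "(\<Sum>k=1..n-1. g k) = (\<Sum>k=1..n-1. g (n - k))" for g :: "nat \<Rightarrow> real"
      by (intro sum.reindex_bij_witness[of _ "\<lambda>k. n - k" "\<lambda>k. n - k"]) auto
    (* Symmetrizing in k and n - k bounds the weight by 3 n / (2 y) on average. *)
    have "2 * (\<Sum>k=1..n-1. size_weight y k 0 * q k * q (n - k)) = (\<Sum>k=1..n-1. size_weight y k 0 * q k * q (n - k)) + (\<Sum>k=1..n-1. size_weight y (n - k) 0 * q (n - k) * q (n - (n - k)))"
      using rev[of "\<lambda>k. size_weight y k 0 * q k * q (n - k)"] by simp
    also have "\<dots> = (\<Sum>k=1..n-1. (size_weight y k 0 + size_weight y (n - k) 0) * (q k * q (n - k)))"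
      unfolding sum.distrib[symmetric] by (intro sum.cong) (auto simp: algebra_simps)
    also have "\<dots> \<le> (\<Sum>k=1..n-1. (3 * real n / y) * (q k * q (n - k)))"
    proof (intro sum_mono mult_right_mono)
      fix k assume k: "k \<in> {1..n-1}"
      have "real k \<le> real n" "real (n - k) \<le> real n" "real k + real (n - k) = real n" using k by (auto simp: of_nat_diff)
      then have "(if y \<le> real k then 2 * real k else y) + (if y \<le> real (n - k) then 2 * real (n - k) else y) \<le> 3 * real n" using ny by auto
      moreover have "size_weight y k 0 + size_weight y (n - k) 0 = ((if y \<le> real k then 2 * real k else y) + (if y \<le> real (n - k) then 2 * real (n - k) else y)) / y"
        using y by (simp add: size_weight_def add_divide_distrib del: of_nat_diff)
      ultimately show "size_weight y k 0 + size_weight y (n - k) 0 \<le> 3 * real n / y" using y by (simp add: divide_right_mono)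
    qed (use q0 in auto)
    also have "\<dots> = 3 * real n / y * S" by (simp add: S_def sum_distrib_left)
    finally have "(\<Sum>k=1..n-1. size_weight y k 0 * q k * q (n - k)) \<le> 3 * real n / (2 * y) * S" using y by (simp add: field_simps)
    then have "q n \<le> 3 * real n / (2 * y) * S / real (n - 1)" unfolding rec[OF n2] by (intro divide_right_mono) auto
    also have "\<dots> = (real n / real (n - 1)) * (3 / (2 * y) * S)" by (simp add: mult_ac)
    also have "\<dots> \<le> 2 * (3 / (2 * y) * S)"
    proof (intro mult_right_mono)
      show "real n / real (n - 1) \<le> 2" using n2 by (simp add: field_simps of_nat_diff)
      show "0 \<le> 3 / (2 * y) * S" using y q0 by (auto simp: S_def intro!: divide_nonneg_nonneg mult_nonneg_nonneg sum_nonneg)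
    qed
    finally have qS: "q n \<le> 3 / y * S" by simp
    have "S \<le> (\<Sum>k=1..n-1. G k * G (n - k) + (b k * G (n - k) + b (n - k) * G k))"
      unfolding S_def
    proof (rule sum_mono)
      fix k assume k: "k \<in> {1..n-1}"
      then have k': "n - k \<in> {1..n-1}" by auto
      have "q k * q (n - k) \<le> (G k + b k) * (G (n - k) + b (n - k))"
        using IH(1)[OF k] IH(1)[OF k'] q0 G0 b0 by (intro mult_mono) (auto intro: add_nonneg_nonneg)
      moreover have "b k * b (n - k) = 0" using ny k by (auto simp: b_def of_nat_diff)
      ultimately show "q k * q (n - k) \<le> G k * G (n - k) + (b k * G (n - k) + b (n - k) * G k)"
        by (simp add: algebra_simps)
    qed
    also have "\<dots> = (\<Sum>k=1..n-1. G k * G (n - k)) + 2 * (\<Sum>k=1..n-1. b k * G (n - k))"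
    proof -
      have "(\<Sum>k=1..n-1. b k * G (n - k)) = (\<Sum>k=1..n-1. b (n - k) * G k)"
        unfolding rev[of "\<lambda>k. b k * G (n - k)"] by (intro sum.cong) auto
      then show ?thesis unfolding sum.distrib by simp
    qed
    finally have S: "S \<le> (\<Sum>k=1..n-1. G k * G (n - k)) + 2 * (\<Sum>k=1..n-1. b k * G (n - k))" .
    have GG: "(\<Sum>k=1..n-1. G k * G (n - k)) \<le> y * G n / 6"
    proof -
      let ?r = "\<lambda>k. 1 / (1 + real k / y)\<^sup>2"
      have "G k * G (n - k) \<le> G n / 12 * (?r k + ?r (n - k))" if k: "k \<in> {1..n-1}" for k
      proof -
        define a c where "a = 1 + real k / y" and "c = 1 + real (n - k) / y"
        have ac: "0 < a" "0 < c" using y by (auto simp: a_def c_def add_pos_nonneg)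
        have e: "exp (480 * real k / y) * exp (480 * real (n - k) / y) = exp (480 * real n / y)"
        proof -
          have "k \<le> n" using k by auto
          then have "480 * real k / y + 480 * real (n - k) / y = 480 * real n / y"
            by (simp add: of_nat_diff add_divide_distrib[symmetric])
          then show ?thesis unfolding exp_add[symmetric] by (simp only:)
        qed
        have "k \<le> n" using k by auto
        then have "1 + real n / y \<le> a + c" by (simp add: a_def c_def of_nat_diff diff_divide_distrib)
        then have "(1 + real n / y)\<^sup>2 \<le> (a + c)\<^sup>2" using y by (intro power_mono) auto
        also have "\<dots> \<le> 2 * (a\<^sup>2 + c\<^sup>2)" using zero_le_power2[of "a - c"] by (simp add: power2_eq_square algebra_simps)
        finally have *: "(1 + real n / y)\<^sup>2 \<le> 2 * (a\<^sup>2 + c\<^sup>2)" .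
        have n0: "0 < (1 + real n / y)\<^sup>2" using y by (intro zero_less_power add_pos_nonneg) auto
        have "1 / (a\<^sup>2 * c\<^sup>2) \<le> 2 * (1 / a\<^sup>2 + 1 / c\<^sup>2) / (1 + real n / y)\<^sup>2"
          using * ac n0 by (simp add: field_simps)
        then have "exp (480 * real n / y) / 576 * (1 / (a\<^sup>2 * c\<^sup>2)) \<le> exp (480 * real n / y) / 576 * (2 * (1 / a\<^sup>2 + 1 / c\<^sup>2) / (1 + real n / y)\<^sup>2)"
          by (intro mult_left_mono) auto
        moreover have "G k * G (n - k) = exp (480 * real n / y) / 576 * (1 / (a\<^sup>2 * c\<^sup>2))"
          unfolding G_def a_def[symmetric] c_def[symmetric] e[symmetric] by simp
        moreover have "exp (480 * real n / y) / 576 * (2 * (1 / a\<^sup>2 + 1 / c\<^sup>2) / (1 + real n / y)\<^sup>2) = G n / 12 * (1 / a\<^sup>2 + 1 / c\<^sup>2)"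
        proof -
          have "E / 576 * (2 * X / Y) = 1 / 24 * E / Y / 12 * X" for E X Y :: real by simp
          then show ?thesis unfolding G_def .
        qed
        ultimately show ?thesis by (simp only: a_def c_def)
      qed
      then have "(\<Sum>k=1..n-1. G k * G (n - k)) \<le> (\<Sum>k=1..n-1. G n / 12 * (?r k + ?r (n - k)))" by (rule sum_mono)
      also have "\<dots> = G n / 12 * (2 * (\<Sum>k=1..n-1. ?r k))"
        unfolding sum_distrib_left[symmetric] sum.distrib using rev[of ?r] by simp
      also have "\<dots> \<le> G n / 12 * (2 * y)"
        using sum_inverse_square_le[OF y] G0 by (intro mult_left_mono) auto
      finally show ?thesis by simp
    qed
    have bG: "(\<Sum>k=1..n-1. b k * G (n - k)) \<le> y * G n / 12"
    proof -
      have "b k * G (n - k) \<le> b k * (4 * G n)" if k: "k \<in> {1..n-1}" for k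
      proof (cases "48 * real k < y")
        case True
        have "real k / y \<le> 1 / 48" using True y by (simp add: field_simps)
        moreover have "k \<le> n" using k by auto
        then have "real (n - k) / y = real n / y - real k / y" by (simp add: of_nat_diff diff_divide_distrib)
        moreover have "1 \<le> real n / y" using y ny by simp
        moreover have "1 + u \<le> 2 * (1 + w)" if "c \<le> 1 / 48" "w = u - c" "1 \<le> u" for c u w :: real
          using that by argo
        ultimately have "1 + real n / y \<le> 2 * (1 + real (n - k) / y)" by blast
        then have "(1 + real n / y)\<^sup>2 \<le> (2 * (1 + real (n - k) / y))\<^sup>2" using y by (intro power_mono) auto
        then have *: "(1 + real n / y)\<^sup>2 \<le> 4 * (1 + real (n - k) / y)\<^sup>2" unfolding power_mult_distrib by simp
        have p: "0 < (1 + real n / y)\<^sup>2" "0 < (1 + real (n - k) / y)\<^sup>2" using y by (intro zero_less_power add_pos_nonneg; simp)+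
        have "exp (480 * real (n - k) / y) \<le> exp (480 * real n / y)" using y by (simp add: divide_right_mono)
        moreover have "1 / (1 + real (n - k) / y)\<^sup>2 \<le> 4 / (1 + real n / y)\<^sup>2" using * p by (simp add: field_simps)
        ultimately have "exp (480 * real (n - k) / y) * (1 / (1 + real (n - k) / y)\<^sup>2) \<le> exp (480 * real n / y) * (4 / (1 + real n / y)\<^sup>2)"
          by (intro mult_mono) auto
        then have "1 / 24 * (exp (480 * real (n - k) / y) * (1 / (1 + real (n - k) / y)\<^sup>2)) \<le> 1 / 24 * (exp (480 * real n / y) * (4 / (1 + real n / y)\<^sup>2))"
          by (rule mult_left_mono) simp
        moreover have "1 / 24 * (X * (1 / A)) = 1 / 24 * X / A" "1 / 24 * (X * (4 / A)) = 4 * (1 / 24 * X / A)" for X A :: real by simp_all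
        ultimately have "G (n - k) \<le> 4 * G n" unfolding G_def by (simp only:)
        then show ?thesis using b0 by (intro mult_left_mono) auto
      qed (simp add: b_def)
      then have "(\<Sum>k=1..n-1. b k * G (n - k)) \<le> (\<Sum>k=1..n-1. b k * (4 * G n))" by (rule sum_mono)
      also have "\<dots> = (\<Sum>k=1..n-1. b k) * (4 * G n)" by (simp add: sum_distrib_right)
      also have "(\<Sum>k=1..n-1. b k) \<le> y / 48"
      proof -
        have "(\<Sum>k=1..n-1. b k) = real (card {k \<in> {1..n-1}. 48 * real k < y})"
          unfolding b_def by (subst sum.inter_filter[symmetric]) auto
        also have "\<dots> \<le> real (card {1..nat \<lfloor>y / 48\<rfloor>})"
        proof (intro of_nat_mono card_mono subsetI)
          fix k assume "k \<in> {k \<in> {1..n-1}. 48 * real k < y}"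
          then have "1 \<le> k" "real k \<le> y / 48" by auto
          then show "k \<in> {1..nat \<lfloor>y / 48\<rfloor>}" by (simp add: le_nat_floor)
        qed simp
        also have "\<dots> \<le> y / 48" using y of_nat_floor[of "y / 48"] by simp
        finally show ?thesis .
      qed
      finally show ?thesis using G0[of n] by (simp add: mult_right_mono)
    qed
    have "3 / y * S \<le> 3 / y * (y * G n / 3)" using S GG bG y by (intro mult_left_mono) auto
    also have "\<dots> = G n" using y by simp
    finally show ?thesis using qS b0[of n] by linarith
  qed
  then show ?case using small qQ by (simp add: G_def b_def)
qed

text \<open>
  By \<open>jordan2_le_parent\<close>, all vertices but the root whose Jordan-2 centrality is at least \<open>y\<^sup>2\<close>
  are counted here.
\<close>

definition heavy_count :: "nat \<Rightarrow> real \<Rightarrow> (nat \<Rightarrow> nat) \<Rightarrow> nat" where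
  "heavy_count n y f = card {w \<in> {2..n}. y\<^sup>2 \<le> real (D f n w) * real (D f n (f w))}"

text \<open>
  If at least \<open>4 * s\<close> vertices are counted, the bonuses amount to \<open>(3 / 2) ^ (4 * s)\<close>. Let \<open>Z\<close> be
  the product of the payments. If \<open>Z\<close> is at least \<open>(2 / 3) ^ (2 * s)\<close>, the product of the pair
  weights is at least \<open>(3 / 2) ^ (2 * s)\<close>; otherwise the product of the size weights, whose square
  times \<open>Z\<close> is at least \<open>1\<close>, exceeds \<open>(3 / 2) ^ s\<close>. Markov's inequality applies to both products.
\<close>

lemma heavy_count_tail:
  assumes y: "0 < y" and n: "1 \<le> n"
  shows "pr n (\<lambda>f. 4 * s \<le> heavy_count n y f) \<le> (1 + (real n / y)\<^sup>2) * (2 / 3) ^ (2 * s) + exp (480 * real n / y) * (2 / 3) ^ s"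
proof -
  let ?P = "\<lambda>h f. \<Prod>w\<in>{2..n}. h (D f n w) (D f n (f w))"
  have "pr n (\<lambda>f. 4 * s \<le> heavy_count n y f) \<le> ev n (\<lambda>f. ?P (pair_weight y) f * (2 / 3) ^ (2 * s) + ?P (size_weight y) f * (2 / 3) ^ s)"
  proof (rule ev_mono)
    fix f
    let ?Z = "\<Prod>w\<in>{2..n}. (if y \<le> real (D f n w) then y\<^sup>2 / (2 * (real (D f n w))\<^sup>2) else 1)"
    have P1: "?P (pair_weight y) f = (3 / 2) ^ heavy_count n y f * ?Z"
    proof -
      have "(\<Prod>w\<in>{2..n}. if y\<^sup>2 \<le> real (D f n w) * real (D f n (f w)) then 3 / 2 else 1) = (3 / 2 :: real) ^ heavy_count n y f"
        unfolding heavy_count_def by (subst prod.inter_filter[symmetric]) auto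
      then show ?thesis unfolding pair_weight_def prod.distrib by simp
    qed
    have Z0: "0 < ?Z"
    proof (rule prod_pos)
      fix w show "0 < (if y \<le> real (D f n w) then y\<^sup>2 / (2 * (real (D f n w))\<^sup>2) else 1)"
        using y by (cases "D f n w = 0") auto
    qed
    have P2: "1 \<le> ?Z * (?P (size_weight y) f)\<^sup>2"
    proof -
      have "?Z * (?P (size_weight y) f)\<^sup>2 = (\<Prod>w\<in>{2..n}. (if y \<le> real (D f n w) then y\<^sup>2 / (2 * (real (D f n w))\<^sup>2) else 1) * (size_weight y (D f n w) (D f n (f w)))\<^sup>2)"
        by (simp add: prod.distrib prod_power_distrib)
      moreover have "\<dots> \<ge> (\<Prod>w\<in>{2..n}. 1)"
      proof (intro prod_mono conjI)
        fix w
        show "1 \<le> (if y \<le> real (D f n w) then y\<^sup>2 / (2 * (real (D f n w))\<^sup>2) else 1) * (size_weight y (D f n w) (D f n (f w)))\<^sup>2"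
          using y by (auto simp: size_weight_def power_divide power_mult_distrib)
      qed auto
      ultimately show ?thesis by simp
    qed
    have P20: "0 \<le> ?P (size_weight y) f" using y by (intro prod_nonneg) (auto simp: size_weight_def)
    show "of_bool (4 * s \<le> heavy_count n y f) \<le> ?P (pair_weight y) f * (2 / 3) ^ (2 * s) + ?P (size_weight y) f * (2 / 3) ^ s"
    proof (cases "4 * s \<le> heavy_count n y f")
      case True
      have "(3 / 2 :: real) ^ (4 * s) \<le> (3 / 2) ^ heavy_count n y f" using True by (intro power_increasing) auto
      then have 1: "(3 / 2) ^ (4 * s) * ?Z \<le> ?P (pair_weight y) f" unfolding P1 using Z0 by (intro mult_right_mono) auto
      have c: "(3 / 2 :: real) ^ k * (2 / 3) ^ k = 1" for k by (simp flip: power_mult_distrib)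
      show ?thesis
      proof (cases "1 \<le> (3 / 2) ^ (2 * s) * ?Z")
        case True
        have "1 \<le> (3 / 2) ^ (2 * s) * ?Z * ((3 / 2) ^ (2 * s) * (2 / 3) ^ (2 * s))" using True c by simp
        also have "\<dots> = (3 / 2) ^ (4 * s) * ?Z * (2 / 3) ^ (2 * s)"
        proof -
          have "(3 / 2 :: real) ^ (4 * s) = (3 / 2) ^ (2 * s) * (3 / 2) ^ (2 * s)" by (simp flip: power_add)
          then show ?thesis by (simp only: mult_ac)
        qed
        also have "\<dots> \<le> ?P (pair_weight y) f * (2 / 3) ^ (2 * s)" using 1 by (intro mult_right_mono) auto
        finally show ?thesis using P20 by (simp add: add_increasing2)
      next
        case False
        have "(1 :: real) \<le> ((2 / 3) ^ s * ?P (size_weight y) f)\<^sup>2"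
        proof -
          have "((3 / 2) ^ (2 * s)) * ?Z * (?P (size_weight y) f)\<^sup>2 \<le> 1 * (?P (size_weight y) f)\<^sup>2"
            using False by (intro mult_right_mono) auto
          moreover have "(3 / 2) ^ (2 * s) * 1 \<le> (3 / 2) ^ (2 * s) * (?Z * (?P (size_weight y) f)\<^sup>2)"
            by (rule mult_left_mono[OF P2]) simp
          ultimately have "(3 / 2) ^ (2 * s) \<le> (?P (size_weight y) f)\<^sup>2"
            by (simp only: mult.assoc mult_1_left mult_1_right)
          then have "(2 / 3) ^ (2 * s) * (3 / 2) ^ (2 * s) \<le> (2 / 3) ^ (2 * s) * (?P (size_weight y) f)\<^sup>2"
            by (intro mult_left_mono) auto
          moreover have "(2 / 3 :: real) ^ (2 * s) * (3 / 2) ^ (2 * s) = 1" using c[of "2 * s"] by (simp only: mult.commute)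
          ultimately have "1 \<le> (2 / 3) ^ (2 * s) * (?P (size_weight y) f)\<^sup>2" by (simp only:)
          then show ?thesis by (simp only: power_mult_distrib power_mult[symmetric] mult.commute[of s 2])
        qed
        then have "1 \<le> (2 / 3) ^ s * ?P (size_weight y) f" using P20 by (intro power2_le_imp_le[of 1]) auto
        moreover have "0 \<le> ?P (pair_weight y) f * (2 / 3) ^ (2 * s)" unfolding P1 using Z0 by simp
        ultimately show ?thesis by (simp add: mult.commute)
      qed
    next
      case False
      have "0 \<le> ?P (pair_weight y) f * (2 / 3) ^ (2 * s)" unfolding P1 using Z0 by simp
      then show ?thesis using False P20 by simp
    qed
  qed
  also have "\<dots> = mean_weight (pair_weight y) n n * (2 / 3) ^ (2 * s) + mean_weight (size_weight y) n n * (2 / 3) ^ s"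
    using ev_prod[OF n] ev_cmult[of n "(2 / 3) ^ (2 * s)" "?P (pair_weight y)"] ev_cmult[of n "(2 / 3) ^ s" "?P (size_weight y)"]
    by (simp add: ev_add mult.commute)
  also have "\<dots> \<le> (1 + (real n / y)\<^sup>2) * (2 / 3) ^ (2 * s) + exp (480 * real n / y) * (2 / 3) ^ s"
  proof (intro add_mono mult_right_mono)
    show "mean_weight (pair_weight y) n n \<le> 1 + (real n / y)\<^sup>2" using mean_weight_pair_weight[OF y n, of n] by (simp add: power2_eq_square)
    have "1 / 24 * exp (480 * real n / y) / (1 + real n / y)\<^sup>2 \<le> 1 / 24 * exp (480 * real n / y) / 1"
    proof (rule divide_left_mono)
      show "1 \<le> (1 + real n / y)\<^sup>2" using y by (intro one_le_power) simp
      then show "0 < (1 + real n / y)\<^sup>2 * 1" by linarith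
    qed auto
    then have E: "1 / 24 * exp (480 * real n / y) / (1 + real n / y)\<^sup>2 \<le> 1 / 24 * exp (480 * real n / y)" by simp
    have E1: "(1::real) \<le> exp (480 * real n / y)" using y by simp
    have B: "mean_weight (size_weight y) n n \<le> 1 / 24 * exp (480 * real n / y) / (1 + real n / y)\<^sup>2 + (if 48 * real n < y then 1 else 0)"
        "real n < y \<longrightarrow> mean_weight (size_weight y) n n \<le> 1"
      using mean_weight_size_weight[OF y n, of n] by blast+
    show "mean_weight (size_weight y) n n \<le> exp (480 * real n / y)"
    proof (cases "real n < y")
      case True
      then show ?thesis using B(2) E1 by linarith
    next
      case False
      then have "\<not> 48 * real n < y" by simp
      then show ?thesis using B(1) E E1 by (simp only: if_False)
    qed
  qed auto
  finally show ?thesis .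
qed

text \<open>
  This is \<open>24 * 480\<close>. For \<open>y = lam * n / K\<close> the growth \<open>exp (480 * n / y)\<close> becomes \<open>exp (K / 24)\<close>,
  and with \<open>s\<close> about \<open>K / 4\<close> the decay \<open>(2 / 3) ^ s\<close> is at least as fast as \<open>exp (- K / 12)\<close>.
\<close>

definition lam :: real where "lam = 11520"

text \<open>
  The tail is exponential in \<open>K\<close>; it is weakened to the inverse square in which the theorem is
  stated.
\<close>

lemma heavy_count_bound:
  assumes n: "1 \<le> n" and K: "0 < K"
  shows "pr n (\<lambda>f. K \<le> real (heavy_count n (lam * real n / K) f) + 1) \<le> 7376 / K\<^sup>2"
proof -
  define y where "y = lam * real n / K"
  have y: "0 < y" using n K by (simp add: y_def lam_def)
  define s where "s = nat \<lfloor>(K - 1) / 4\<rfloor>"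
  have s: "(K - 5) / 4 \<le> real s"
  proof -
    have "real_of_int \<lfloor>(K - 1) / 4\<rfloor> \<le> real s" unfolding s_def by (cases "0 \<le> \<lfloor>(K - 1) / 4\<rfloor>") auto
    then show ?thesis using real_of_int_floor_add_one_gt[of "(K - 1) / 4"] by (simp add: field_simps)
  qed
  have s': "4 * s \<le> N" if "K \<le> real N + 1" for N
  proof (cases "1 \<le> K")
    case True
    then have "real s \<le> (K - 1) / 4" unfolding s_def by (intro of_nat_floor) auto
    then have "real (4 * s) \<le> real N" using that by simp
    then show ?thesis by (simp only: of_nat_le_iff)
  next
    case False
    then have "s = 0" by (simp add: s_def)
    then show ?thesis by simp
  qed
  have ny: "real n / y = K / lam" using n K by (simp add: y_def lam_def)
  have "pr n (\<lambda>f. K \<le> real (heavy_count n y f) + 1) \<le> pr n (\<lambda>f. 4 * s \<le> heavy_count n y f)"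
    by (rule pr_mono) (rule s')
  also have "\<dots> \<le> (1 + (K / lam)\<^sup>2) * (2 / 3) ^ (2 * s) + exp (480 * (K / lam)) * (2 / 3) ^ s"
    using heavy_count_tail[OF y n, of s] ny by (simp only: times_divide_eq_right[symmetric])
  also have "\<dots> \<le> 3 * exp (480 * (K / lam)) * (2 / 3) ^ s + exp (480 * (K / lam)) * (2 / 3) ^ s"
  proof (intro add_right_mono mult_mono)
    define x where "x = K / lam"
    have x: "0 \<le> x" using K by (simp add: x_def lam_def)
    have "x\<^sup>2 \<le> 2 * exp x" using exp_lower_Taylor_quadratic[OF x] x by (simp add: field_simps)
    moreover have "exp x \<le> exp (480 * x)" "1 \<le> exp (480 * x)" using x by auto
    ultimately have "1 + x\<^sup>2 \<le> 3 * exp (480 * x)" by linarith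
    then show "1 + (K / lam)\<^sup>2 \<le> 3 * exp (480 * (K / lam))" by (simp add: x_def)
    show "(2 / 3 :: real) ^ (2 * s) \<le> (2 / 3) ^ s" by (intro power_decreasing) auto
  qed auto
  also have "\<dots> = 4 * (exp (480 * (K / lam)) * (2 / 3) ^ s)" by simp
  also have "(2 / 3 :: real) ^ s \<le> exp (- 1 / 3) ^ s"
    using exp_ge_add_one_self[of "- 1 / 3 :: real"] by (intro power_mono) auto
  also have "exp (- 1 / 3 :: real) ^ s = exp (- (real s / 3))" by (simp add: exp_of_nat_mult[symmetric])
  also have "exp (480 * (K / lam)) * exp (- (real s / 3)) \<le> exp (5 / 12 - K / 24)"
    unfolding exp_add[symmetric] using s by (simp add: lam_def)
  also have "exp (5 / 12 - K / 24) \<le> 1844 / K\<^sup>2"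
  proof -
    have "(K / 24)\<^sup>2 / 2 \<le> exp (K / 24)" using exp_lower_Taylor_quadratic[of "K / 24"] K by (simp add: field_simps)
    then have "K\<^sup>2 / 1152 \<le> exp (K / 24)" by (simp add: power_divide)
    then have "exp (- (K / 24)) \<le> 1152 / K\<^sup>2" using K by (simp add: exp_minus field_simps)
    moreover have "exp (5 / 12 :: real) \<le> 8 / 5"
    proof -
      have "1 - 5 / 36 \<le> exp (- 5 / 36 :: real)" using exp_ge_add_one_self[of "- 5 / 36 :: real"] by simp
      then have "(31 / 36) ^ 3 \<le> exp (- 5 / 36 :: real) ^ 3" by (intro power_mono) auto
      also have "exp (- 5 / 36 :: real) ^ 3 = exp (- 5 / 12)" by (simp add: exp_of_nat_mult[symmetric])
      finally show ?thesis by (simp add: exp_minus field_simps)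
    qed
    ultimately have "exp (5 / 12) * exp (- (K / 24)) \<le> 8 / 5 * (1152 / K\<^sup>2)" by (intro mult_mono) auto
    also have "8 / 5 * (1152 / K\<^sup>2) \<le> 1844 / K\<^sup>2" using K by (simp add: field_simps)
    finally show ?thesis by (simp add: exp_add[symmetric])
  qed
  finally show ?thesis by (simp add: y_def)
qed

section \<open>Upper tail: upper bound\<close>

lemma harmonic_le:
  assumes "1 \<le> m" "m \<le> N"
  shows "(\<Sum>k=m..N. 1 / real k) \<le> 1 + ln (real N / real m)"
  using assms(2)
proof (induction N rule: dec_induct)
  case base
  then show ?case using assms by (simp add: divide_le_eq)
next
  case (step N)
  have N: "1 \<le> N" using step assms by simp
  have "ln (real N / real (Suc N)) \<le> real N / real (Suc N) - 1" using N by (intro ln_le_minus_one) auto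
  also have "\<dots> = - (1 / real (Suc N))" by (simp add: field_simps)
  finally have "1 / real (Suc N) \<le> ln (real (Suc N)) - ln (real N)" using N by (simp add: ln_div)
  then show ?case using step assms by (simp add: ln_div)
qed

text \<open>
  Counts the pairs with \<open>k \<le> y\<close> and \<open>k * l \<le> y\<^sup>2\<close>, each of mass \<open>q2\<close>, where a column has mass at
  most \<open>q1\<close>. The cap \<open>q1\<close> is the better bound for \<open>k\<close> below \<open>\<theta> = q2 * y\<^sup>2 / q1\<close>; the harmonic sum
  from \<open>\<theta>\<close> to \<open>y\<close> gives the logarithm of \<open>y / \<theta>\<close>.
\<close>

lemma product_count_sum:
  fixes q1 q2 y :: real
  assumes "0 < y" "0 < q1" "0 < q2"
  shows "(\<Sum>k=1..nat \<lfloor>y\<rfloor>. min q1 (q2 * y\<^sup>2 / real k)) \<le> q2 * y\<^sup>2 * (2 + max 0 (ln (q1 / (q2 * y))))"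
proof -
  define N where "N = nat \<lfloor>y\<rfloor>"
  (* Below theta the cap q1 on a column is smaller than q2 * y^2 / k. *)
  define \<theta> where "\<theta> = q2 * y\<^sup>2 / q1"
  have \<theta>: "0 < \<theta>" "\<theta> * q1 = q2 * y\<^sup>2" using assms by (auto simp: \<theta>_def)
  have Ny: "real N \<le> y" using assms by (simp add: N_def of_nat_floor)
  have pos: "0 < q2 * y\<^sup>2" using assms by simp
  show ?thesis
  proof (cases "y \<le> \<theta>")
    case True
    have "(\<Sum>k=1..N. min q1 (q2 * y\<^sup>2 / real k)) \<le> (\<Sum>k=1..N. q1)" by (intro sum_mono) auto
    also have "\<dots> \<le> \<theta> * q1" using Ny True assms by (auto intro!: mult_right_mono)
    also have "\<dots> \<le> q2 * y\<^sup>2 * (2 + max 0 (ln (q1 / (q2 * y))))" unfolding \<theta>(2) using pos by (simp add: mult_le_cancel_left1)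
    finally show ?thesis by (simp add: N_def)
  next
    case False
    define m where "m = Suc (nat \<lfloor>\<theta>\<rfloor>)"
    have m: "\<theta> \<le> real m" "real (m - 1) \<le> \<theta>" "1 \<le> m" using \<theta> unfolding m_def by (simp_all add: of_nat_floor) linarith
    have "(\<Sum>k=1..N. min q1 (q2 * y\<^sup>2 / real k)) \<le> (\<Sum>k=1..N. (if k < m then q1 else 0) + (if m \<le> k then q2 * y\<^sup>2 / real k else 0))"
      by (intro sum_mono) auto
    also have "\<dots> = (\<Sum>k\<in>{k\<in>{1..N}. k < m}. q1) + (\<Sum>k\<in>{k\<in>{1..N}. m \<le> k}. q2 * y\<^sup>2 / real k)"
      unfolding sum.distrib by (simp only: sum.inter_filter finite_atLeastAtMost)
    also have "{k\<in>{1..N}. m \<le> k} = {m..N}" using m by auto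
    also have "(\<Sum>k\<in>{k\<in>{1..N}. k < m}. q1) \<le> real (m - 1) * q1"
    proof -
      have "card {k\<in>{1..N}. k < m} \<le> card {1..m-1}" by (intro card_mono) auto
      then have "card {k\<in>{1..N}. k < m} \<le> m - 1" by simp
      then have "real (card {k\<in>{1..N}. k < m}) \<le> real (m - 1)" by (rule of_nat_mono)
      then show ?thesis unfolding sum_constant using assms by (intro mult_right_mono) auto
    qed
    also have "real (m - 1) * q1 \<le> q2 * y\<^sup>2" unfolding \<theta>(2)[symmetric] using m assms by (intro mult_right_mono) auto
    also have "(\<Sum>k=m..N. q2 * y\<^sup>2 / real k) \<le> q2 * y\<^sup>2 * (1 + max 0 (ln (q1 / (q2 * y))))"
    proof (cases "m \<le> N")
      case True
      have "(\<Sum>k=m..N. 1 / real k) \<le> 1 + ln (real N / real m)" using m True by (intro harmonic_le) auto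
      also have "\<dots> \<le> 1 + ln (y / \<theta>)"
      proof -
        have "real N / real m \<le> y / \<theta>" using Ny m \<theta> assms by (intro frac_le) auto
        moreover have "0 < real N / real m" using True m by simp
        ultimately show ?thesis by (intro add_left_mono ln_mono)
      qed
      also have "y / \<theta> = q1 / (q2 * y)" using assms by (simp add: \<theta>_def power2_eq_square)
      finally have "(\<Sum>k=m..N. 1 / real k) \<le> 1 + max 0 (ln (q1 / (q2 * y)))" by simp
      then have "q2 * y\<^sup>2 * (\<Sum>k=m..N. 1 / real k) \<le> q2 * y\<^sup>2 * (1 + max 0 (ln (q1 / (q2 * y))))"
        using pos by (intro mult_left_mono) auto
      then show ?thesis by (simp add: sum_distrib_left)
    next
      case False
      then show ?thesis using pos by simp
    qed
    finally have "(\<Sum>k=1..N. min q1 (q2 * y\<^sup>2 / real k)) \<le> q2 * y\<^sup>2 + q2 * y\<^sup>2 * (1 + max 0 (ln (q1 / (q2 * y))))" by simp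
    also have "\<dots> = q2 * y\<^sup>2 * (2 + max 0 (ln (q1 / (q2 * y))))" by (simp add: algebra_simps)
    finally show ?thesis by (simp add: N_def)
  qed
qed

lemma sum_const_floor_le: "0 \<le> x \<Longrightarrow> 0 \<le> q \<Longrightarrow> (\<Sum>k\<in>{1..nat \<lfloor>x\<rfloor>}. q) \<le> x * (q :: real)"
  unfolding sum_constant by (intro mult_right_mono) (simp_all add: of_nat_floor del: of_nat_nat)

text \<open>
  The law of a product of two sizes near zero, from bounds on their joint density and on that of
  the first one. This is where the logarithm of the upper tail comes from.
\<close>

lemma pr_product_small:
  assumes y: "0 < y" "0 < q1" "0 < q2"
   and A: "\<And>f. valid n f \<Longrightarrow> A f \<Longrightarrow> 1 \<le> K f \<and> 1 \<le> L f \<and> real (K f) \<le> y \<and> real (K f) * real (L f) \<le> y\<^sup>2"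
   and q1: "\<And>k. 1 \<le> k \<Longrightarrow> pr n (\<lambda>f. A f \<and> K f = k) \<le> q1"
   and q2: "\<And>k l. 1 \<le> k \<Longrightarrow> 1 \<le> l \<Longrightarrow> pr n (\<lambda>f. A f \<and> K f = k \<and> L f = l) \<le> q2"
  shows "pr n A \<le> q2 * y\<^sup>2 * (2 + max 0 (ln (q1 / (q2 * y))))"
proof -
  have "pr n A \<le> (\<Sum>k=1..nat \<lfloor>y\<rfloor>. pr n (\<lambda>f. A f \<and> K f = k))"
    using A by (intro pr_UN) (auto simp: le_nat_floor)
  also have "\<dots> \<le> (\<Sum>k=1..nat \<lfloor>y\<rfloor>. min q1 (q2 * y\<^sup>2 / real k))"
  proof (rule sum_mono)
    fix k assume k: "k \<in> {1..nat \<lfloor>y\<rfloor>}"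
    have "pr n (\<lambda>f. A f \<and> K f = k) \<le> (\<Sum>l=1..nat \<lfloor>y\<^sup>2 / real k\<rfloor>. pr n (\<lambda>f. A f \<and> K f = k \<and> L f = l))"
    proof (rule pr_UN)
      fix f assume f: "valid n f" "A f \<and> K f = k"
      then have "1 \<le> L f" "real k * real (L f) \<le> y\<^sup>2" using A by auto
      then have "real (L f) \<le> y\<^sup>2 / real k" using k by (simp add: field_simps)
      then have "L f \<in> {1..nat \<lfloor>y\<^sup>2 / real k\<rfloor>}" using \<open>1 \<le> L f\<close> by (simp add: le_nat_floor)
      then show "\<exists>l\<in>{1..nat \<lfloor>y\<^sup>2 / real k\<rfloor>}. A f \<and> K f = k \<and> L f = l" using f by blast
    qed simp
    also have "\<dots> \<le> (\<Sum>l=1..nat \<lfloor>y\<^sup>2 / real k\<rfloor>. q2)" using k by (intro sum_mono q2) auto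
    also have "\<dots> \<le> (y\<^sup>2 / real k) * q2" using y by (intro sum_const_floor_le) auto
    finally show "pr n (\<lambda>f. A f \<and> K f = k) \<le> min q1 (q2 * y\<^sup>2 / real k)"
      using q1[of k] k by (simp add: mult.commute)
  qed
  also have "\<dots> \<le> q2 * y\<^sup>2 * (2 + max 0 (ln (q1 / (q2 * y))))" by (rule product_count_sum[OF y])
  finally show ?thesis .
qed

text \<open>
  Three sets of vertices older than \<open>v\<close>, whose clusters from time \<open>v\<close> on are colours of the urn:
  the descendants of \<open>2\<close>, all others, and the descendants of the parent of \<open>v\<close>.
\<close>

definition col2 :: "nat \<Rightarrow> (nat \<Rightarrow> nat) \<Rightarrow> nat set" where
  "col2 v f = desc f (v - 1) 2"

definition col3 :: "nat \<Rightarrow> (nat \<Rightarrow> nat) \<Rightarrow> nat set" where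
  "col3 v f = {1..v-1} - desc f (v - 1) 2"

definition colp :: "nat \<Rightarrow> (nat \<Rightarrow> nat) \<Rightarrow> nat set" where
  "colp v f = desc f (v - 1) (f v)"

lemma local_col:
  assumes "1 \<le> v"
  shows "local_at v (col2 v)" "local_at v (col3 v)" "local_at v (colp v)"
  using assms by (auto simp: local_at_def col2_def col3_def colp_def cluster_upd)

lemma col_notin: "1 \<le> v \<Longrightarrow> v \<notin> col2 v f" "1 \<le> v \<Longrightarrow> v \<notin> col3 v f" "1 \<le> v \<Longrightarrow> v \<notin> colp v f" "col2 v f \<inter> col3 v f = {}"
  using cluster_subset[of f 2 "{2}" "v - 1"] cluster_subset[of f "f v" "{f v}" "v - 1"]
  by (auto simp: col2_def col3_def colp_def)

lemma col_card:
  assumes f: "valid n f" and v: "3 \<le> v" "v \<le> n"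
  shows "D f n v + card (cluster f v (col2 v f) n) + card (cluster f v (col3 v f) n) = n"
    and "1 \<le> card (cluster f v (col2 v f) n)" "1 \<le> card (cluster f v (col3 v f) n)" "1 \<le> card (cluster f v (colp v f) n)"
proof -
  have c2: "col2 v f \<subseteq> {1..v-1}" using cluster_subset by (auto simp: col2_def)
  have u: "col2 v f \<union> col3 v f = {1..v-1}" using c2 unfolding col2_def col3_def by blast
  have "{v} \<union> {1..v-1} = {1..v}" using v by auto
  then have u: "{v} \<union> (col2 v f \<union> col3 v f) = {1..v}" unfolding u .
  have "cluster f v {1..v} n = {1..n}"
    using anc_range[OF f, of v] v by (auto simp: cluster_def)
  then have "cluster f v ({v} \<union> (col2 v f \<union> col3 v f)) n = {1..n}" unfolding u .
  then have "cluster f v {v} n \<union> (cluster f v (col2 v f) n \<union> cluster f v (col3 v f) n) = {1..n}" by (simp only: cluster_Un)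
  moreover have "card (cluster f v {v} n \<union> (cluster f v (col2 v f) n \<union> cluster f v (col3 v f) n)) = D f n v + (card (cluster f v (col2 v f) n) + card (cluster f v (col3 v f) n))"
  proof -
    have 1: "cluster f v (col2 v f) n \<inter> cluster f v (col3 v f) n = {}" by (rule cluster_disjoint[OF col_notin(4)])
    have "v \<notin> col2 v f \<union> col3 v f" using col_notin(1,2)[of v f] v by simp
    then have "cluster f v {v} n \<inter> cluster f v (col2 v f \<union> col3 v f) n = {}" by (intro cluster_disjoint) blast
    then have 2: "cluster f v {v} n \<inter> (cluster f v (col2 v f) n \<union> cluster f v (col3 v f) n) = {}" by (simp only: cluster_Un)
    show ?thesis using card_Un_disjoint[OF finite_cluster _ 2] card_Un_disjoint[OF finite_cluster finite_cluster 1] by simp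
  qed
  ultimately show "D f n v + card (cluster f v (col2 v f) n) + card (cluster f v (col3 v f) n) = n" by simp
  have 1: "1 \<le> card (cluster f v C n)" if "x \<in> C" "1 \<le> x" "x \<le> v" for x C
  proof -
    have "x \<in> cluster f v C n" using that v by (auto simp: cluster_def)
    then show ?thesis using card_gt_0_iff[of "cluster f v C n"] by auto
  qed
  have "2 \<in> col2 v f" using v by (auto simp: col2_def intro!: desc_self)
  then show "1 \<le> card (cluster f v (col2 v f) n)" using v by (intro 1[of 2]) auto
  have "1 \<in> col3 v f" using v by (auto simp: col3_def cluster_def)
  then show "1 \<le> card (cluster f v (col3 v f) n)" using v by (intro 1[of 1]) auto
  have "1 \<le> f v" "f v < v" using validD[OF f, of v] v by auto
  then show "1 \<le> card (cluster f v (colp v f) n)" by (intro 1[of "f v"]) (auto simp: colp_def intro!: desc_self)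
qed

text \<open>
  When at most half of the vertices descend from \<open>v\<close>, the Jordan centrality of \<open>v\<close> is \<open>D v\<close>. A
  branch at the parent of \<open>v\<close>, other than that of \<open>v\<close>, lies on one side of the edge between \<open>1\<close>
  and \<open>2\<close>, and so avoids the vertices of the other side that do not descend from \<open>v\<close>; this bounds
  the centrality of the parent by \<open>z\<close> from below.
\<close>

lemma jordan2_lower_small:
  assumes f: "valid n f" and v: "3 \<le> v" "v \<le> n" and k: "2 * D f n v \<le> n"
  defines "z \<equiv> min (min (D f n (f v)) (n - D f n v)) (min (card (cluster f v (col2 v f) n)) (card (cluster f v (col3 v f) n)))"
  shows "D f n v * D f n v \<le> jordan2 (tree_of f n) v" "D f n v * z \<le> jordan2 (tree_of f n) v"
proof -
  let ?J = "jordan (tree_of f n)"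
  have n2: "2 \<le> n" using v by simp
  have vn: "v \<in> {2..n}" using v by simp
  define p where "p = f v"
  have p: "1 \<le> p" "p < v" using validD[OF f, of v] v by (auto simp: p_def)
  define X where "X = cluster f v (col2 v f) n"
  have Jv: "D f n v \<le> ?J v"
  proof (rule jordan_ge[OF f n2])
    fix c assume c: "c \<in> {2..n}" "f c = v"
    then have "D f n c \<le> D f n v" using D_child[OF f, of c] by simp
    then show "D f n v \<le> n - D f n c" using k by simp
  qed (use v in auto)
  have d2: "desc f n 2 \<subseteq> X \<union> desc f n v" "X \<subseteq> desc f n 2"
  proof -
    obtain m where m: "v = Suc m" "2 \<le> m" using v by (cases v) auto
    have a: "desc f n 2 = cluster f v (desc f v 2) n" using cluster_cluster[OF f, of 2 v "{2}"] v by simp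
    have b: "desc f v 2 = (if f v \<in> col2 v f then insert v (col2 v f) else col2 v f)"
      using cluster_Suc[of m f 2 "{2}"] valid_mono[OF f, of v] v m by (auto simp: col2_def)
    show "desc f n 2 \<subseteq> X \<union> desc f n v" "X \<subseteq> desc f n 2" unfolding a b X_def by (auto simp: cluster_def)
  qed
  have sum: "D f n v + card X + card (cluster f v (col3 v f) n) = n" using col_card(1)[OF f v] by (simp add: X_def)
  have Jp: "z \<le> ?J p"
  proof (rule jordan_ge[OF f n2])
    show "p \<in> {1..n}" using p v by auto
    show "z \<le> D f n p" by (simp add: z_def p_def)
    fix c assume c: "c \<in> {2..n}" "f c = p"
    (* Either the branch of c is that of v, or it lies on one side of the edge {1, 2}, without
       the descendants of v. *)
    show "z \<le> n - D f n c"
    proof (cases "c = v")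
      case False
      have dis: "desc f n c \<inter> desc f n v = {}" using siblings_disjoint[OF f c(1) vn] c False by (simp add: p_def)
      show ?thesis
      proof (cases "c \<in> desc f n 2")
        case True
        then have "desc f n c \<subseteq> X" using desc_trans[OF f, of 2 c] d2 dis by auto
        then have "D f n c \<le> card X" by (intro card_mono) (auto simp: X_def)
        then show ?thesis using sum by (simp add: z_def X_def)
      next
        case c2: False
        then have "desc f n c \<inter> desc f n 2 = {}" using c by (intro desc_disjoint[OF f]) auto
        then have "desc f n c \<inter> X = {}" using d2 by auto
        then have "card (desc f n c \<union> X) = D f n c + card X" by (intro card_Un_disjoint) (auto simp: X_def)
        moreover have "card (desc f n c \<union> X) \<le> card {1..n}" using cluster_subset by (intro card_mono) (auto simp: X_def)
        ultimately show ?thesis by (simp add: z_def X_def)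
      qed
    qed (simp add: z_def)
  qed
  show "D f n v * D f n v \<le> jordan2 (tree_of f n) v"
    using jordan2_ge_square[OF f n2, of v] mult_mono[OF Jv Jv] v by simp
  show "D f n v * z \<le> jordan2 (tree_of f n) v"
    using jordan2_ge_parent[OF f n2 vn] mult_mono[OF Jv Jp] by (simp add: p_def)
qed

lemma jordan2_lower_large:
  assumes f: "valid n f" and v: "3 \<le> v" "v \<le> n" and k: "n < 2 * D f n v"
  shows "(n - D f n v) * (n - D f n v) \<le> jordan2 (tree_of f n) v"
proof -
  let ?J = "jordan (tree_of f n)"
  have n2: "2 \<le> n" using v by simp
  have vn: "v \<in> {2..n}" using v by simp
  have Jv: "n - D f n v \<le> ?J v"
  proof (rule jordan_ge[OF f n2])
    show "n - D f n v \<le> D f n v" using k by simp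
    fix c assume c: "c \<in> {2..n}" "f c = v"
    then show "n - D f n v \<le> n - D f n c" using D_child[OF f, of c] by simp
  qed (use v in auto)
  show ?thesis using jordan2_ge_square[OF f n2, of v] mult_mono[OF Jv Jv] v by simp
qed

lemma urn_density_ratio_le:
  assumes "3 \<le> v" "v \<le> (n::nat)"
  shows "(real v - 1) / (real n - 1) \<le> real v / real n" "(real v - 2) / (real n - 2) \<le> real v / real n"
  using assms by (auto simp: field_simps)

text \<open>
  If the Jordan-2 centrality of \<open>v\<close> is at most \<open>y\<^sup>2\<close>, then either the product of \<open>D v\<close> and one of
  three other colours is at most \<open>y\<^sup>2\<close>, or \<open>D v\<close> is of order \<open>y\<^sup>2 / n\<close>, or, if most vertices
  descend from \<open>v\<close>, the two sides of the edge between \<open>1\<close> and \<open>2\<close> are both at most \<open>y\<close>. All pairs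
  of colours have joint density of order \<open>(v / n)\<^sup>2\<close>, which turns into \<open>(v / n)\<^sup>2 * y\<^sup>2\<close> of order
  \<open>1 / S\<^sup>2\<close>.
\<close>

lemma jordan2_small_prob_ge3:
  assumes v: "3 \<le> v" "v \<le> n" and S: "1 \<le> S"
  shows "pr n (\<lambda>f. real (jordan2 (tree_of f n) v) \<le> (lam * real n / (S * real v))\<^sup>2) \<le> 9 * lam\<^sup>2 * ((1 + ln S) / S\<^sup>2)"
proof -
  define y where "y = lam * real n / (S * real v)"
  have y: "0 < y" using v S by (simp add: y_def lam_def)
  define q1 where "q1 = (real v - 1) / (real n - 1)"
  define q2 where "q2 = (real v - 1) * (real v - 2) / ((real n - 1) * (real n - 2))"
  have q: "0 < q1" "0 < q2" using v by (auto simp: q1_def q2_def)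
  let ?k = "\<lambda>f. D f n v" and ?c = "\<lambda>C f. card (cluster f v (C v f) n)"
  have dens1: "pr n (\<lambda>f. ?k f = k) \<le> q1" if "1 \<le> k" "k < n" for k
    using urn_density1[of v n "\<lambda>_. 1" "\<lambda>_. {v}" 1 k] v that pr_le_1[of v "\<lambda>f. card (cluster f v {v} v) = _"] by (simp add: q1_def)
  have dens2: "pr n (\<lambda>f. card (cluster f v (C f) n) = k \<and> card (cluster f v (C' f) n) = l) \<le> q2"
    if "1 \<le> k" "1 \<le> l" "k + l < n" "local_at v C" "local_at v C'" "\<And>f. C f \<inter> C' f = {}" for k l C C'
    using urn_density2[of v n "\<lambda>_. 1" C C' 1 k l] v that pr_le_1[of v] by (simp add: q2_def)
  have k1: "1 \<le> ?k f" if "valid n f" for f using D_pos[of v n f] v by simp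
  have pair: "pr n (\<lambda>f. real (?k f) \<le> y \<and> real (?k f) * real (?c C f) \<le> y\<^sup>2 \<and> ?k f + ?c C f < n)
      \<le> q2 * y\<^sup>2 * (2 + max 0 (ln (q1 / (q2 * y))))" if C: "C \<in> {col2, col3, colp}" for C
  proof (rule pr_product_small[where K = ?k and L = "?c C"])
    fix f assume "valid n f" "real (?k f) \<le> y \<and> real (?k f) * real (?c C f) \<le> y\<^sup>2 \<and> ?k f + ?c C f < n"
    then show "1 \<le> ?k f \<and> 1 \<le> ?c C f \<and> real (?k f) \<le> y \<and> real (?k f) * real (?c C f) \<le> y\<^sup>2"
      using C col_card(2-4)[of n f v] v k1[of f] by auto
  next
    fix k :: nat assume k: "1 \<le> k"
    show "pr n (\<lambda>f. (real (?k f) \<le> y \<and> real (?k f) * real (?c C f) \<le> y\<^sup>2 \<and> ?k f + ?c C f < n) \<and> ?k f = k) \<le> q1"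
    proof (cases "k < n")
      case True
      then show ?thesis by (intro order_trans[OF pr_mono dens1[OF k]]) auto
    next
      case False
      then have "pr n (\<lambda>f. (real (?k f) \<le> y \<and> real (?k f) * real (?c C f) \<le> y\<^sup>2 \<and> ?k f + ?c C f < n) \<and> ?k f = k) \<le> pr n (\<lambda>_. False)"
        by (intro pr_mono) auto
      then show ?thesis using q by simp
    qed
    fix l :: nat assume l: "1 \<le> l"
    show "pr n (\<lambda>f. (real (?k f) \<le> y \<and> real (?k f) * real (?c C f) \<le> y\<^sup>2 \<and> ?k f + ?c C f < n) \<and> ?k f = k \<and> ?c C f = l) \<le> q2"
    proof (cases "k + l < n")
      case True
      have "pr n (\<lambda>f. ?k f = k \<and> ?c C f = l) \<le> q2"
        using C v True k l local_col[of v] col_notin[of v] by (intro dens2) auto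
      then show ?thesis by (elim order_trans[OF pr_mono, rotated]) auto
    next
      case False
      then have "pr n (\<lambda>f. (real (?k f) \<le> y \<and> real (?k f) * real (?c C f) \<le> y\<^sup>2 \<and> ?k f + ?c C f < n) \<and> ?k f = k \<and> ?c C f = l) \<le> pr n (\<lambda>_. False)"
        by (intro pr_mono) auto
      then show ?thesis using q by simp
    qed
  qed (use y q in auto)
  have both: "pr n (\<lambda>f. real (?c col2 f) \<le> y \<and> real (?c col3 f) \<le> y) \<le> y\<^sup>2 * q2"
  proof -
    let ?N = "nat \<lfloor>y\<rfloor>"
    have "pr n (\<lambda>f. real (?c col2 f) \<le> y \<and> real (?c col3 f) \<le> y) \<le> (\<Sum>kl\<in>{1..?N} \<times> {1..?N}. pr n (\<lambda>f. ?c col2 f + ?c col3 f < n \<and> ?c col2 f = fst kl \<and> ?c col3 f = snd kl))"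
    proof (rule pr_UN)
      fix f assume f: "valid n f" "real (?c col2 f) \<le> y \<and> real (?c col3 f) \<le> y"
      have "?c col2 f + ?c col3 f < n" using col_card(1)[OF f(1) v] k1[OF f(1)] by linarith
      then show "\<exists>kl\<in>{1..?N} \<times> {1..?N}. ?c col2 f + ?c col3 f < n \<and> ?c col2 f = fst kl \<and> ?c col3 f = snd kl"
        using f col_card(2,3)[OF f(1) v] by (intro bexI[of _ "(?c col2 f, ?c col3 f)"]) (auto simp: le_nat_floor)
    qed auto
    also have "\<dots> \<le> (\<Sum>kl\<in>{1..?N} \<times> {1..?N}. q2)"
    proof (rule sum_mono)
      fix kl assume kl: "kl \<in> {1..?N} \<times> {1..?N}"
      show "pr n (\<lambda>f. ?c col2 f + ?c col3 f < n \<and> ?c col2 f = fst kl \<and> ?c col3 f = snd kl) \<le> q2"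
      proof (cases "fst kl + snd kl < n")
        case True
        have "pr n (\<lambda>f. ?c col2 f = fst kl \<and> ?c col3 f = snd kl) \<le> q2"
          using v True kl local_col[of v] col_notin[of v] by (intro dens2) auto
        then show ?thesis by (elim order_trans[OF pr_mono, rotated]) auto
      next
        case False
        then have "pr n (\<lambda>f. ?c col2 f + ?c col3 f < n \<and> ?c col2 f = fst kl \<and> ?c col3 f = snd kl) \<le> pr n (\<lambda>_. False)"
          by (intro pr_mono) auto
        then show ?thesis using q by simp
      qed
    qed
    also have "\<dots> = (real ?N)\<^sup>2 * q2" by (simp add: power2_eq_square)
    also have "\<dots> \<le> y\<^sup>2 * q2" using y q by (intro mult_right_mono power_mono) (auto simp: of_nat_floor)
    finally show ?thesis .
  qed
  have single: "pr n (\<lambda>f. real (?k f) * real n \<le> 2 * y\<^sup>2 \<and> ?k f < n) \<le> (2 * y\<^sup>2 / real n) * q1"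
  proof -
    let ?N = "nat \<lfloor>2 * y\<^sup>2 / real n\<rfloor>"
    have "pr n (\<lambda>f. real (?k f) * real n \<le> 2 * y\<^sup>2 \<and> ?k f < n) \<le> (\<Sum>k\<in>{1..?N}. pr n (\<lambda>f. ?k f < n \<and> ?k f = k))"
    proof (rule pr_UN)
      fix f assume f: "valid n f" "real (?k f) * real n \<le> 2 * y\<^sup>2 \<and> ?k f < n"
      then have "real (?k f) \<le> 2 * y\<^sup>2 / real n" using v by (simp add: field_simps)
      then show "\<exists>k\<in>{1..?N}. ?k f < n \<and> ?k f = k"
        using f k1[OF f(1)] by (intro bexI[of _ "?k f"]) (auto simp: le_nat_floor)
    qed auto
    also have "\<dots> \<le> (\<Sum>k\<in>{1..?N}. q1)"
    proof (rule sum_mono)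
      fix k assume k: "k \<in> {1..?N}"
      show "pr n (\<lambda>f. ?k f < n \<and> ?k f = k) \<le> q1"
      proof (cases "k < n")
        case True
        have "pr n (\<lambda>f. ?k f = k) \<le> q1" using True k by (intro dens1) auto
        then show ?thesis by (elim order_trans[OF pr_mono, rotated]) auto
      next
        case False
        then have "pr n (\<lambda>f. ?k f < n \<and> ?k f = k) \<le> pr n (\<lambda>_. False)" by (intro pr_mono) auto
        then show ?thesis using q by simp
      qed
    qed
    also have "\<dots> \<le> (2 * y\<^sup>2 / real n) * q1" using q by (intro sum_const_floor_le) auto
    finally show ?thesis .
  qed
  let ?P = "\<lambda>C f. real (?k f) \<le> y \<and> real (?k f) * real (?c C f) \<le> y\<^sup>2 \<and> ?k f + ?c C f < n"
  have "pr n (\<lambda>f. real (jordan2 (tree_of f n) v) \<le> y\<^sup>2)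
     \<le> pr n (\<lambda>f. ((?P col2 f \<or> ?P col3 f) \<or> ?P colp f) \<or> ((real (?c col2 f) \<le> y \<and> real (?c col3 f) \<le> y) \<or> (real (?k f) * real n \<le> 2 * y\<^sup>2 \<and> ?k f < n)))"
  proof (rule pr_mono)
    fix f assume f: "valid n f" and J: "real (jordan2 (tree_of f n) v) \<le> y\<^sup>2"
    have sum: "?k f + ?c col2 f + ?c col3 f = n" "1 \<le> ?c col2 f" "1 \<le> ?c col3 f" using col_card[OF f v] by auto
    have le: "real a * real b \<le> y\<^sup>2" if "a * b \<le> jordan2 (tree_of f n) v" for a b
    proof -
      have "real (a * b) \<le> real (jordan2 (tree_of f n) v)" using that by (rule of_nat_mono)
      then show ?thesis using J by simp
    qed
    have sq: "real a \<le> y" if "a * a \<le> jordan2 (tree_of f n) v" for a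
    proof (rule power2_le_imp_le[of _ y])
      show "(real a)\<^sup>2 \<le> y\<^sup>2" using le[OF that] by (simp only: power2_eq_square[of "real a"])
    qed (use y in simp)
    show "((?P col2 f \<or> ?P col3 f) \<or> ?P colp f) \<or> ((real (?c col2 f) \<le> y \<and> real (?c col3 f) \<le> y) \<or> (real (?k f) * real n \<le> 2 * y\<^sup>2 \<and> ?k f < n))"
    proof (cases "2 * ?k f \<le> n")
      case True
      define a b c d where "a = D f n (f v)" and "b = n - ?k f" and "c = ?c col2 f" and "d = ?c col3 f"
      define z where "z = min (min a b) (min c d)"
      have ky: "real (?k f) \<le> y" using jordan2_lower_small(1)[OF f v True] by (rule sq)
      have z: "real (?k f) * real z \<le> y\<^sup>2"
        using jordan2_lower_small(2)[OF f v True] unfolding z_def a_def b_def c_def d_def by (rule le)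
      have kn: "?k f < n" using sum by simp
      have ab: "a = ?k f + ?c colp f" using D_parent_split(1)[OF f, of v] v by (simp add: colp_def a_def)
      have "n \<le> 2 * b" using True by (simp add: b_def)
      moreover have "z = a \<or> z = b \<or> z = c \<or> z = d" by (auto simp: z_def min_def)
      ultimately have "(z = a \<and> a < n) \<or> n \<le> 2 * z \<or> z = c \<or> z = d" by linarith
      then consider "z = a" "a < n" | "n \<le> 2 * z" | "z = c" | "z = d" by blast
      then show ?thesis
      proof cases
        case 1
        have "real (?k f) * real (?c colp f) \<le> real (?k f) * real z" unfolding 1(1) ab by (intro mult_left_mono) auto
        then have "real (?k f) * real (?c colp f) \<le> y\<^sup>2" using z by linarith
        then show ?thesis using ky 1(2) unfolding ab by blast
      next
        case 2
        have "real n \<le> 2 * real z" using 2 by linarith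
        then have "real (?k f) * real n \<le> real (?k f) * (2 * real z)" by (rule mult_left_mono) simp
        then have "real (?k f) * real n \<le> 2 * y\<^sup>2" using z by (simp only: mult.left_commute[of _ 2])
        then show ?thesis using kn by blast
      next
        case 3
        then have "real (?k f) * real (?c col2 f) \<le> y\<^sup>2" using z by (simp only: c_def)
        moreover have "?k f + ?c col2 f < n" using sum by linarith
        ultimately show ?thesis using ky by blast
      next
        case 4
        then have "real (?k f) * real (?c col3 f) \<le> y\<^sup>2" using z by (simp only: d_def)
        moreover have "?k f + ?c col3 f < n" using sum by linarith
        ultimately show ?thesis using ky by blast
      qed
    next
      case False
      then have "real (n - ?k f) \<le> y" using jordan2_lower_large[OF f v] by (intro sq) auto
      moreover have "n - ?k f = ?c col2 f + ?c col3 f" using sum by simp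
      ultimately show ?thesis by auto
    qed
  qed
  also have "\<dots> \<le> ((pr n (?P col2) + pr n (?P col3)) + pr n (?P colp)) + (pr n (\<lambda>f. real (?c col2 f) \<le> y \<and> real (?c col3 f) \<le> y) + pr n (\<lambda>f. real (?k f) * real n \<le> 2 * y\<^sup>2 \<and> ?k f < n))"
    by (intro order_trans[OF pr_disj] add_mono order_refl)
  also have "\<dots> \<le> 3 * (q2 * y\<^sup>2 * (2 + max 0 (ln (q1 / (q2 * y))))) + (y\<^sup>2 * q2 + 2 * y\<^sup>2 / real n * q1)"
    using pair[of col2] pair[of col3] pair[of colp] both single by simp
  also have "\<dots> \<le> 3 * (lam\<^sup>2 / S\<^sup>2 * (2 + ln S)) + (lam\<^sup>2 / S\<^sup>2 + 2 * (lam\<^sup>2 / S\<^sup>2))"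
  proof -
    have b: "q1 \<le> real v / real n" using urn_density_ratio_le[OF v] by (simp only: q1_def)
    have "q2 = q1 * ((real v - 2) / (real n - 2))" by (simp add: q1_def q2_def)
    moreover have "q1 * ((real v - 2) / (real n - 2)) \<le> real v / real n * (real v / real n)"
      using v by (intro mult_mono b urn_density_ratio_le(2)[OF v]) auto
    ultimately have b2: "q2 \<le> real v / real n * (real v / real n)" by (simp only:)
    have yS: "y\<^sup>2 * (real v / real n * (real v / real n)) = lam\<^sup>2 / S\<^sup>2"
      using v S by (simp add: y_def power2_eq_square)
    have 1: "q2 * y\<^sup>2 \<le> lam\<^sup>2 / S\<^sup>2"
      using mult_left_mono[OF b2, of "y\<^sup>2"] yS by (simp add: mult.commute)
    have 2: "2 * y\<^sup>2 / real n * q1 \<le> 2 * (lam\<^sup>2 / S\<^sup>2)"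
    proof -
      have "2 * y\<^sup>2 / real n * q1 \<le> 2 * y\<^sup>2 / real n * (real v / real n)" using b by (intro mult_left_mono) auto
      also have "\<dots> = 2 * (y\<^sup>2 * (1 / real n * (real v / real n)))" by simp
      also have "\<dots> \<le> 2 * (y\<^sup>2 * (real v / real n * (real v / real n)))"
        using v by (intro mult_left_mono mult_right_mono divide_right_mono) auto
      finally show ?thesis unfolding yS .
    qed
    have 3: "max 0 (ln (q1 / (q2 * y))) \<le> ln S"
    proof -
      have "a / b / (a * c / (b * d) * y) = d / (c * y)" if "a \<noteq> 0" "b \<noteq> 0" for a b c d y :: real
        using that by simp
      from this[of "real v - 1" "real n - 1"] have "q1 / (q2 * y) = (real n - 2) / ((real v - 2) * y)"
        unfolding q1_def q2_def using v by simp
      also have "\<dots> = ((real n - 2) / real n) * (real v / (real v - 2)) * (S / lam)"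
        by (simp add: y_def mult_ac)
      also have "\<dots> \<le> 1 * 3 * (S / lam)" using v S by (intro mult_mono) (auto simp: lam_def divide_le_eq)
      also have "\<dots> \<le> S" using S by (simp add: lam_def)
      finally have "q1 / (q2 * y) \<le> S" .
      moreover have "0 < q1 / (q2 * y)" using q y by simp
      ultimately show ?thesis using S by auto
    qed
    have "q2 * y\<^sup>2 * (2 + max 0 (ln (q1 / (q2 * y)))) \<le> lam\<^sup>2 / S\<^sup>2 * (2 + ln S)"
      using 1 3 by (intro mult_mono) auto
    then show ?thesis using 1 2 by (simp add: mult.commute)
  qed
  also have "\<dots> = lam\<^sup>2 / S\<^sup>2 * (9 + 3 * ln S)" by (simp add: algebra_simps add_divide_distrib)
  also have "\<dots> \<le> lam\<^sup>2 / S\<^sup>2 * (9 * (1 + ln S))" using S by (intro mult_left_mono) auto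
  also have "\<dots> = 9 * lam\<^sup>2 * ((1 + ln S) / S\<^sup>2)" by simp
  finally show ?thesis by (simp add: y_def)
qed

primrec first_child :: "bin_shape \<Rightarrow> nat" where
  "first_child Lf = 0"
| "first_child (Nd A B) = leaves A"

primrec parts :: "bin_shape \<Rightarrow> nat \<times> bin_shape \<times> bin_shape" where
  "parts Lf = (0, Lf, Lf)"
| "parts (Nd A B) = (leaves A, A, B)"

lemma shape_ev_first_child:
  assumes m: "2 \<le> m"
  shows "shape_ev m (\<lambda>t. of_bool (first_child t = j)) \<le> 1 / (real m - 1)"
proof -
  have "shape_ev m (\<lambda>t. of_bool (first_child t = j)) = (\<Sum>k=1..m-1. of_bool (k = j)) / real (m - 1)"
    unfolding shape_ev_split[OF m]
  proof (intro arg_cong2[where f = "(/)"] sum.cong refl)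
    fix k assume "k \<in> {1..m-1}"
    then have "shape_ev k (\<lambda>A. shape_ev (m - k) (\<lambda>B. of_bool (first_child (Nd A B) = j))) = shape_ev k (\<lambda>A. of_bool (k = j))"
      by (intro shape_ev_cong) auto
    then show "shape_ev k (\<lambda>A. shape_ev (m - k) (\<lambda>B. of_bool (first_child (Nd A B) = j))) = of_bool (k = j)" by simp
  qed
  also have "(\<Sum>k=1..m-1. of_bool (k = j)) \<le> (1 :: real)"
    by (simp add: of_bool_def sum.delta)
  finally show ?thesis using m by (simp add: divide_right_mono of_nat_diff)
qed

text \<open>
  For \<open>v \<le> 2\<close> the urn starts too late to see both sides of \<open>v\<close>, and the top two splits of the
  shape are used instead. The edge between \<open>1\<close> and \<open>2\<close> splits the vertices into the left part, the
  descendants of \<open>2\<close>, and the right part. The flag tells whether the left part is taken as the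
  smaller one.
\<close>

definition small_side :: "bool \<Rightarrow> bin_shape \<Rightarrow> nat" where
  "small_side c t = (let (a, A, B) = parts t in if c then leaves A else leaves B)"

text \<open>
  The size of the next branch split off from the larger part, at whichever of \<open>1\<close> and \<open>2\<close> belongs
  to it.
\<close>

definition large_child :: "bool \<Rightarrow> bin_shape \<Rightarrow> nat" where
  "large_child c t = (let (a, A, B) = parts t in if c then first_child B else first_child A)"

text \<open>
  Two splits with uniform sizes give a flat joint law.
\<close>

lemma shape_ev_two_sides:
  assumes n: "2 \<le> n" and a: "1 \<le> a" "a + 2 \<le> n"
  shows "shape_ev n (\<lambda>t. of_bool (small_side c t = a \<and> large_child c t = j)) \<le> 1 / ((real n - 1) * (real (n - a) - 1))"
proof -
  let ?g = "\<lambda>t. of_bool (first_child t = j) :: real"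
  have e: "shape_ev k (\<lambda>A. shape_ev (n - k) (\<lambda>B. of_bool (small_side c (Nd A B) = a \<and> large_child c (Nd A B) = j)))
     = (if k = (if c then a else n - a) then shape_ev (n - a) ?g else 0)" if k: "k \<in> {1..n-1}" for k
  proof (cases c)
    case True
    have "shape_ev k (\<lambda>A. shape_ev (n - k) (\<lambda>B. of_bool (small_side c (Nd A B) = a \<and> large_child c (Nd A B) = j)))
      = shape_ev k (\<lambda>A. of_bool (k = a) * shape_ev (n - k) ?g)"
      using True k unfolding shape_ev_cmult[symmetric] by (intro shape_ev_cong) (auto simp: small_side_def large_child_def of_bool_conj)
    then show ?thesis using True by auto
  next
    case False
    have "shape_ev k (\<lambda>A. shape_ev (n - k) (\<lambda>B. of_bool (small_side c (Nd A B) = a \<and> large_child c (Nd A B) = j)))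
      = shape_ev k (\<lambda>A. shape_ev (n - k) (\<lambda>B. of_bool (n - k = a) * ?g A))"
      using False k by (intro shape_ev_cong) (auto simp: small_side_def large_child_def of_bool_conj)
    also have "\<dots> = of_bool (n - k = a) * shape_ev k ?g"
      by (simp add: shape_ev_cmult)
    also have "\<dots> = (if k = (if c then a else n - a) then shape_ev (n - a) ?g else 0)" using False k a by auto
    finally show ?thesis .
  qed
  have "shape_ev n (\<lambda>t. of_bool (small_side c t = a \<and> large_child c t = j)) = (\<Sum>k=1..n-1. if k = (if c then a else n - a) then shape_ev (n - a) ?g else 0) / real (n - 1)"
    unfolding shape_ev_split[OF n] by (rule arg_cong2[where f = "(/)", OF sum.cong[OF refl e] refl])
  also have "(\<Sum>k=1..n-1. if k = (if c then a else n - a) then shape_ev (n - a) ?g else 0) = shape_ev (n - a) ?g"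
    using a n by (subst sum.delta) auto
  also have "shape_ev (n - a) ?g / real (n - 1) \<le> (1 / (real (n - a) - 1)) / real (n - 1)"
    using a by (intro divide_right_mono shape_ev_first_child) auto
  also have "\<dots> = 1 / ((real n - 1) * (real (n - a) - 1))" using n by (simp add: of_nat_diff)
  finally show ?thesis .
qed

lemma encoding_top:
  assumes "valid n f" "2 \<le> n"
  shows "\<exists>A B. encoding f n = LNode A B \<and> root_label A = 2 \<and> root_label B = 1"
  using assms(2,1)
proof (induction n rule: dec_induct)
  case base
  have "f 2 = 1" using validD[OF base, of 2] by simp
  then show ?case by (simp add: numeral_2_eq_2)
next
  case (step n)
  then obtain A B where "encoding f n = LNode A B" "root_label A = 2" "root_label B = 1" using valid_mono[OF step.prems, of n] by auto
  then show ?case using step.hyps by auto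
qed

text \<open>
  Let the smaller of the two sides of the edge between \<open>1\<close> and \<open>2\<close> have \<open>a\<close> vertices, and let \<open>j\<close>
  be the size of the first branch at the endpoint on the larger side. The endpoint on the smaller
  side has centrality at least \<open>a\<close>. The other endpoint has centrality at least \<open>a\<close>, and also at
  least the minimum of \<open>j\<close> and the number of remaining vertices of its side, since each branch at
  it avoids one of the two.
\<close>

lemma jordan_pair_lower:
  assumes f: "valid n f" and n: "3 \<le> n"
  obtains c where "1 \<le> small_side c (shape (encoding f n))" "2 * small_side c (shape (encoding f n)) \<le> n"
     "large_child c (shape (encoding f n)) < n - small_side c (shape (encoding f n))" "1 \<le> large_child c (shape (encoding f n))"
     "\<And>x. x = small_side c (shape (encoding f n)) \<or> x = min (large_child c (shape (encoding f n))) (n - small_side c (shape (encoding f n)) - large_child c (shape (encoding f n)))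
       \<Longrightarrow> small_side c (shape (encoding f n)) * x \<le> jordan (tree_of f n) 1 * jordan (tree_of f n) 2"
proof -
  let ?J = "jordan (tree_of f n)"
  have n2: "2 \<le> n" using n by simp
  have f2: "f 2 = 1" using validD[OF f, of 2] n by simp
  obtain A B where t: "encoding f n = LNode A B" "root_label A = 2" "root_label B = 1" using encoding_top[OF f n2] by blast
  have encodes: "encodes f n A" "encodes f n B" and AB: "labels A = desc f n 2" "labels A \<inter> labels B = {}" "labels A \<union> labels B = {1..n}"
    using encoding_props[OF f] n t by auto
  define a b where "a = D f n 2" and "b = n - a"
  have ca: "leaves (shape A) = a" using leaves_shape[OF encodes(1)] AB by (simp add: a_def)
  have sumAB: "leaves (shape A) + leaves (shape B) = n" using leaves_encoding[OF f] t n by simp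
  have cb: "leaves (shape B) = b" "a + b = n" using sumAB ca by (auto simp: b_def)
  have a1: "1 \<le> a" using D_pos[of 2 n f] n by (simp add: a_def)
  have b1: "1 \<le> b" using cb leaves_shape[OF encodes(2)] root_label_in_labels[of B] card_gt_0_iff[of "labels B"] by auto
  have dis2: "D f n c + a \<le> n" if "c \<in> {2..n}" "f c = 1" "c \<noteq> 2" for c
  proof -
    have "desc f n c \<inter> desc f n 2 = {}" using siblings_disjoint[OF f that(1), of 2] that n f2 by auto
    then show ?thesis unfolding a_def by (rule D_add_le)
  qed
  show ?thesis
  proof (cases "a \<le> b")
    case True
    have "2 \<le> b" using True cb n by simp
    then obtain B1 B2 where B: "B = LNode B1 B2" using cb by (cases B) auto
    define s where "s = root_label B1"
    have okB: "labels B1 = desc f n s" "f s = 1" "labels B1 \<inter> labels B2 = {}" using encodes(2) t(3) by (auto simp: B s_def)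
    have sB: "s \<in> labels B" by (simp add: B s_def root_label_in_labels)
    have "1 \<in> labels B2" using root_label_in_labels[of B2] t(3) by (simp add: B)
    then have "s \<noteq> 1" using okB root_label_in_labels[of B1] by (auto simp: s_def)
    moreover have "s \<in> {1..n}" using sB AB(3) by blast
    ultimately have s1: "s \<in> {2..n}" by simp
    have "2 \<in> labels A" unfolding AB(1) using n by (intro desc_self) auto
    then have "s \<noteq> 2" using sB AB(2) by blast
    with s1 have s: "s \<in> {2..n}" "s \<noteq> 2" by blast+
    define j where "j = D f n s"
    have lj: "leaves (shape B1) = j" using encodes(2) leaves_shape[of f n B1] okB by (simp add: B j_def)
    have j1: "1 \<le> j" using D_pos[of s n f] s by (simp add: j_def)
    have "0 < leaves (shape B2)" using leaves_shape[of f n B2] encodes(2) root_label_in_labels[of B2] card_gt_0_iff[of "labels B2"] by (auto simp: B)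
    moreover have "b = j + leaves (shape B2)" using cb(1) lj by (simp add: B)
    ultimately have jb: "1 \<le> j" "j < b" using j1 by simp_all
    have sm: "small_side True (shape (encoding f n)) = a" "large_child True (shape (encoding f n)) = j"
      by (simp_all add: t small_side_def large_child_def ca B lj)
    have J2: "a \<le> ?J 2"
    proof (rule jordan_ge[OF f n2])
      show "a \<le> D f n 2" by (simp add: a_def)
      fix c assume c: "c \<in> {2..n}" "f c = 2"
      then show "a \<le> n - D f n c" using D_child[OF f c(1)] True cb by (simp add: a_def)
    qed (use n in auto)
    have J1: "x \<le> ?J 1" if x: "x \<le> a \<or> x \<le> min j (b - j)" for x
    proof (rule jordan_ge[OF f n2])
      fix c assume c: "c \<in> {2..n}" "f c = 1"
      show "x \<le> n - D f n c"
      proof (cases "c = 2")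
        case True
        then show ?thesis using x \<open>a \<le> b\<close> cb by (auto simp: a_def[symmetric])
      next
        case c2: False
        have 1: "a \<le> n - D f n c" using dis2[OF c c2] by simp
        have 2: "min j (b - j) \<le> n - D f n c"
        proof (cases "c = s")
          case True
          then show ?thesis using cb by (simp add: j_def)
        next
          case False
          have "desc f n c \<inter> desc f n s = {}" using siblings_disjoint[OF f c(1) s(1)] c okB False by auto
          then have "D f n c + j \<le> n" unfolding j_def by (rule D_add_le)
          then show ?thesis by simp
        qed
        show ?thesis using 1 2 x by linarith
      qed
    qed (use n in auto)
    show ?thesis
    proof (rule that[of True]; unfold sm)
      show "1 \<le> a" "2 * a \<le> n" "j < n - a" "1 \<le> j" using a1 True cb jb by auto
      show "a * x \<le> ?J 1 * ?J 2" if x: "x = a \<or> x = min j (n - a - j)" for x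
      proof -
        have "x * a \<le> ?J 1 * ?J 2" using x by (intro mult_mono J1 J2) (auto simp: b_def)
        then show ?thesis by (simp only: mult.commute)
      qed
    qed
  next
    case False
    have "2 \<le> a" using False b1 by simp
    then obtain A1 A2 where A: "A = LNode A1 A2" using ca by (cases A) auto
    define s where "s = root_label A1"
    have okA: "labels A1 = desc f n s" "f s = 2" "labels A1 \<inter> labels A2 = {}" using encodes(1) t(2) by (auto simp: A s_def)
    have "s \<in> labels A" by (simp add: A s_def root_label_in_labels)
    then have "s \<in> {1..n}" using AB by auto
    moreover have "s \<noteq> 1"
    proof
      assume "s = 1"
      then have "1 \<in> desc f n 2" using \<open>s \<in> labels A\<close> AB by simp
      then show False using desc_ge[OF f, of 2 1] by simp
    qed
    ultimately have s: "s \<in> {2..n}" by simp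
    define j where "j = D f n s"
    have lj: "leaves (shape A1) = j" using encodes(1) leaves_shape[of f n A1] okA by (simp add: A j_def)
    have j1: "1 \<le> j" using D_pos[of s n f] s by (simp add: j_def)
    have "0 < leaves (shape A2)" using leaves_shape[of f n A2] encodes(1) root_label_in_labels[of A2] card_gt_0_iff[of "labels A2"] by (auto simp: A)
    moreover have "a = j + leaves (shape A2)" using ca lj by (simp add: A)
    ultimately have ja: "1 \<le> j" "j < a" using j1 by simp_all
    have sm: "small_side False (shape (encoding f n)) = b" "large_child False (shape (encoding f n)) = j"
      by (simp_all add: t small_side_def large_child_def cb A lj)
    have J1: "b \<le> ?J 1"
    proof (rule jordan_ge[OF f n2])
      fix c assume c: "c \<in> {2..n}" "f c = 1"
      show "b \<le> n - D f n c"
      proof (cases "c = 2")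
        case True
        then show ?thesis by (simp add: b_def a_def)
      next
        case c2: False
        then show ?thesis using dis2[OF c c2] False by simp
      qed
    qed (use n in auto)
    have J2: "x \<le> ?J 2" if x: "x \<le> b \<or> x \<le> min j (a - j)" for x
    proof (rule jordan_ge[OF f n2])
      show "x \<le> D f n 2" using x False ja by (auto simp: a_def[symmetric])
      fix c assume c: "c \<in> {2..n}" "f c = 2"
      have 1: "b \<le> n - D f n c" using D_child[OF f c(1)] c by (simp add: b_def a_def)
      have 2: "min j (a - j) \<le> n - D f n c"
      proof (cases "c = s")
        case True
        then show ?thesis using cb by (simp add: j_def)
      next
        case False
        have "desc f n c \<inter> desc f n s = {}" using siblings_disjoint[OF f c(1) s] c okA False by auto
        then have "D f n c + j \<le> n" unfolding j_def by (rule D_add_le)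
        then show ?thesis by simp
      qed
      show "x \<le> n - D f n c" using 1 2 x by linarith
    qed (use n in auto)
    show ?thesis
    proof (rule that[of False]; unfold sm)
      show "1 \<le> b" "2 * b \<le> n" "j < n - b" "1 \<le> j" using b1 False cb ja by auto
      show "b * x \<le> ?J 1 * ?J 2" if x: "x = b \<or> x = min j (n - b - j)" for x
      proof -
        have "n - b = a" using cb by simp
        then show ?thesis using x by (intro mult_mono J1 J2) auto
      qed
    qed
  qed
qed

text \<open>
  The Jordan-2 centralities of \<open>1\<close> and \<open>2\<close> are at least the product of the Jordan centralities,
  since the two vertices are neighbors. The two splits at the top of the shape take the place of
  the colours of the urn.
\<close>

lemma jordan2_small_prob_le2:
  assumes v: "1 \<le> v" "v \<le> 2" and n: "3 \<le> n" and S: "1 \<le> S"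
  shows "pr n (\<lambda>f. real (jordan2 (tree_of f n) v) \<le> (lam * real n / (S * real v))\<^sup>2) \<le> 144 * lam\<^sup>2 * ((1 + ln S) / S\<^sup>2)"
proof -
  define y where "y = lam * real n / (S * real v)"
  have y: "0 < y" using v S n by (simp add: y_def lam_def)
  define q1 where "q1 = 1 / (real n - 1)"
  define q2 where "q2 = 4 / ((real n - 1) * (real n - 2))"
  have q: "0 < q1" "0 < q2" using n by (auto simp: q1_def q2_def)
  let ?K = "\<lambda>c f. small_side c (shape (encoding f n))" and ?j = "\<lambda>c f. large_child c (shape (encoding f n))"
  let ?L = "\<lambda>c f. min (?j c f) (n - ?K c f - ?j c f)"
  let ?A = "\<lambda>c f. 1 \<le> ?K c f \<and> 2 * ?K c f \<le> n \<and> ?j c f < n - ?K c f \<and> 1 \<le> ?j c f \<and> real (?K c f) \<le> y \<and> real (?K c f) * real (?L c f) \<le> y\<^sup>2"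
  have dens: "pr n (\<lambda>f. ?K c f = a \<and> ?j c f = j) \<le> 2 / ((real n - 1) * (real n - 2))" if a: "1 \<le> a" "2 * a \<le> n" for a j c
  proof (cases "a + 2 \<le> n")
    case True
    have "pr n (\<lambda>f. ?K c f = a \<and> ?j c f = j) = shape_ev n (\<lambda>t. of_bool (small_side c t = a \<and> large_child c t = j))" by (simp add: shape_ev_def)
    also have "\<dots> \<le> 1 / ((real n - 1) * (real (n - a) - 1))" using n a True by (intro shape_ev_two_sides) auto
    also have "\<dots> \<le> 1 / ((real n - 1) * ((real n - 2) / 2))"
    proof (intro divide_left_mono mult_left_mono mult_pos_pos)
      show "(real n - 2) / 2 \<le> real (n - a) - 1" using a n by (simp add: of_nat_diff field_simps)
      show "0 < real (n - a) - 1" using True by (simp add: of_nat_diff)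
    qed (use n in auto)
    also have "\<dots> = 2 / ((real n - 1) * (real n - 2))" by simp
    finally show ?thesis .
  next
    case False
    then show ?thesis using a n by simp
  qed
  have side: "pr n (?A c) \<le> q2 * y\<^sup>2 * (2 + max 0 (ln (q1 / (q2 * y))))" for c
  proof (rule pr_product_small[where K = "?K c" and L = "?L c"])
    fix k :: nat assume k: "1 \<le> k"
    show "pr n (\<lambda>f. ?A c f \<and> ?K c f = k) \<le> q1"
    proof (cases "2 * k \<le> n")
      case True
      have "pr n (\<lambda>f. ?K c f = k) \<le> q1"
      proof -
        have "pr n (\<lambda>f. ?K c f = k) = shape_ev n (\<lambda>t. of_bool (small_side c t = k))" by (simp add: shape_ev_def)
        also have "\<dots> = (\<Sum>i=1..n-1. shape_ev i (\<lambda>A. shape_ev (n - i) (\<lambda>B. of_bool (small_side c (Nd A B) = k)))) / real (n - 1)"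
          using n by (intro shape_ev_split) simp
        also have "(\<Sum>i=1..n-1. shape_ev i (\<lambda>A. shape_ev (n - i) (\<lambda>B. of_bool (small_side c (Nd A B) = k)))) = (\<Sum>i=1..n-1. of_bool (i = (if c then k else n - k)))"
        proof (rule sum.cong[OF refl])
          fix i assume i: "i \<in> {1..n-1}"
          have "shape_ev i (\<lambda>A. shape_ev (n - i) (\<lambda>B. of_bool (small_side c (Nd A B) = k))) = shape_ev i (\<lambda>A. shape_ev (n - i) (\<lambda>B. of_bool (i = (if c then k else n - k))))"
            using i True k by (intro shape_ev_cong) (auto simp: small_side_def)
          then show "shape_ev i (\<lambda>A. shape_ev (n - i) (\<lambda>B. of_bool (small_side c (Nd A B) = k))) = of_bool (i = (if c then k else n - k))" by simp
        qed
        also have "\<dots> \<le> 1" by (simp add: of_bool_def sum.delta)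
        finally show ?thesis using n by (simp add: q1_def of_nat_diff divide_right_mono)
      qed
      then show ?thesis by (elim order_trans[OF pr_mono, rotated]) auto
    next
      case False
      then have "pr n (\<lambda>f. ?A c f \<and> ?K c f = k) \<le> pr n (\<lambda>_. False)" by (intro pr_mono) auto
      then show ?thesis using q by simp
    qed
    fix l :: nat assume l: "1 \<le> l"
    show "pr n (\<lambda>f. ?A c f \<and> ?K c f = k \<and> ?L c f = l) \<le> q2"
    proof (cases "2 * k \<le> n")
      case True
      have "pr n (\<lambda>f. ?A c f \<and> ?K c f = k \<and> ?L c f = l) \<le> pr n (\<lambda>f. (?K c f = k \<and> ?j c f = l) \<or> (?K c f = k \<and> ?j c f = n - k - l))"
        by (intro pr_mono) (auto simp: min_def split: if_splits)
      also have "\<dots> \<le> pr n (\<lambda>f. ?K c f = k \<and> ?j c f = l) + pr n (\<lambda>f. ?K c f = k \<and> ?j c f = n - k - l)"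
        by (rule pr_disj)
      also have "\<dots> \<le> 2 / ((real n - 1) * (real n - 2)) + 2 / ((real n - 1) * (real n - 2))"
        by (intro add_mono dens k True)
      finally show ?thesis by (simp add: q2_def)
    next
      case False
      then have "pr n (\<lambda>f. ?A c f \<and> ?K c f = k \<and> ?L c f = l) \<le> pr n (\<lambda>_. False)" by (intro pr_mono) auto
      then show ?thesis using q by simp
    qed
  qed (use y q in auto)
  have n2: "2 \<le> n" using n by simp
  have "pr n (\<lambda>f. real (jordan2 (tree_of f n) v) \<le> y\<^sup>2) \<le> pr n (\<lambda>f. ?A True f \<or> ?A False f)"
  proof (rule pr_mono)
    fix f assume f: "valid n f" and J: "real (jordan2 (tree_of f n) v) \<le> y\<^sup>2"
    have f2: "f 2 = 1" using validD[OF f, of 2] n by simp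
    have JJ: "jordan (tree_of f n) 1 * jordan (tree_of f n) 2 \<le> jordan2 (tree_of f n) v"
    proof (cases "v = 1")
      case True
      then show ?thesis using jordan2_ge_neighbor[OF f n2, of 1 2] n f2 by (auto simp: neighbors_iff)
    next
      case False
      then have "v = 2" using v by simp
      then show ?thesis using jordan2_ge_parent[OF f n2, of 2] n f2 by (simp add: mult.commute)
    qed
    obtain c where c: "1 \<le> ?K c f" "2 * ?K c f \<le> n" "?j c f < n - ?K c f" "1 \<le> ?j c f"
       "\<And>x. x = ?K c f \<or> x = ?L c f \<Longrightarrow> ?K c f * x \<le> jordan (tree_of f n) 1 * jordan (tree_of f n) 2"
      using jordan_pair_lower[OF f n] by blast
    have le: "real (?K c f) * real x \<le> y\<^sup>2" if "x = ?K c f \<or> x = ?L c f" for x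
    proof -
      have "real (?K c f * x) \<le> real (jordan2 (tree_of f n) v)" using c(5)[OF that] JJ by (intro of_nat_mono) linarith
      then show ?thesis using J by simp
    qed
    have "real (?K c f) \<le> y"
    proof (rule power2_le_imp_le)
      show "(real (?K c f))\<^sup>2 \<le> y\<^sup>2" unfolding power2_eq_square[of "real (?K c f)"] by (rule le) simp
    qed (use y in simp)
    moreover have "real (?K c f) * real (?L c f) \<le> y\<^sup>2" by (rule le) simp
    ultimately have "?A c f" using c(1-4) by blast
    then show "?A True f \<or> ?A False f" by (cases c) auto
  qed
  also have "\<dots> \<le> pr n (?A True) + pr n (?A False)" by (rule pr_disj)
  also have "\<dots> \<le> 2 * (q2 * y\<^sup>2 * (2 + max 0 (ln (q1 / (q2 * y)))))" using side[of True] side[of False] by simp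
  also have "\<dots> \<le> 2 * (36 * (lam\<^sup>2 / S\<^sup>2) * (2 + ln S))"
  proof (rule mult_left_mono, rule mult_mono)
    have "(real n)\<^sup>2 \<le> 9 * ((real n - 1) * (real n - 2))"
    proof -
      have "real n * 1 \<le> real n * (8 * real n - 26)  + 18"
      proof (cases "n = 3")
        case False
        then have "4 \<le> real n" using n by simp
        then have "real n * 1 \<le> real n * (8 * real n - 26)" by (intro mult_left_mono) auto
        then show ?thesis by simp
      qed simp
      then show ?thesis by (simp add: power2_eq_square algebra_simps)
    qed
    then have X: "4 * (real n)\<^sup>2 / ((real n - 1) * (real n - 2)) \<le> 36" using n by (simp add: divide_le_eq)
    have e: "q2 * y\<^sup>2 = (4 * (real n)\<^sup>2 / ((real n - 1) * (real n - 2))) * (lam\<^sup>2 / S\<^sup>2) * (1 / (real v)\<^sup>2)"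
      by (simp add: q2_def y_def power_divide power_mult_distrib mult_ac)
    have Z: "1 / (real v)\<^sup>2 \<le> 1" using v by (simp add: divide_le_eq)
    have "X * Y * Z \<le> 36 * Y * 1" if "X \<le> 36" "Z \<le> 1" "0 \<le> Y" "0 \<le> Z" for X Y Z :: real
      using that by (intro mult_mono) auto
    from this[OF X Z, of "lam\<^sup>2 / S\<^sup>2"] have "q2 * y\<^sup>2 \<le> 36 * (lam\<^sup>2 / S\<^sup>2) * 1"
      unfolding e by simp
    then show "q2 * y\<^sup>2 \<le> 36 * (lam\<^sup>2 / S\<^sup>2)" by simp
    have "q1 / (q2 * y) = (real n - 2) * (S * real v) / (4 * (lam * real n))" using n v S
      by (simp add: q1_def q2_def y_def lam_def field_simps)
    also have "\<dots> \<le> S"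
    proof -
      have "(real n - 2) * (S * real v) \<le> real n * (S * 2)" using n v S by (intro mult_mono) auto
      also have "\<dots> \<le> S * (4 * (lam * real n))" using S by (simp add: lam_def)
      finally show ?thesis using n by (simp add: lam_def divide_le_eq)
    qed
    finally have "q1 / (q2 * y) \<le> S" .
    moreover have "0 < q1 / (q2 * y)" using q y by simp
    ultimately show "2 + max 0 (ln (q1 / (q2 * y))) \<le> 2 + ln S" using S by auto
  qed (use S q in auto)
  also have "\<dots> \<le> 2 * (36 * (lam\<^sup>2 / S\<^sup>2) * (2 * (1 + ln S)))" using S by (intro mult_left_mono) auto
  also have "\<dots> = 144 * lam\<^sup>2 * ((1 + ln S) / S\<^sup>2)" by simp
  finally show ?thesis by (simp add: y_def)
qed

text \<open>
  The additional vertex is the root, which has no parent.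
\<close>

lemma card_above_le_heavy_count:
  assumes f: "valid n f" and n: "2 \<le> n"
    and A: "\<And>w. w \<in> A \<Longrightarrow> w \<in> {1..n} \<and> y\<^sup>2 \<le> real (jordan2 (tree_of f n) w)"
  shows "card A \<le> heavy_count n y f + 1"
proof -
  let ?B = "{w \<in> {2..n}. y\<^sup>2 \<le> real (D f n w) * real (D f n (f w))}"
  have "A \<subseteq> insert 1 ?B"
  proof
    fix w assume w: "w \<in> A"
    show "w \<in> insert 1 ?B"
    proof (cases "w = 1")
      case False
      then have w2: "w \<in> {2..n}" using A[OF w] by auto
      have "real (jordan2 (tree_of f n) w) \<le> real (D f n w * D f n (f w))" by (intro of_nat_mono jordan2_le_parent[OF f n w2])
      then show ?thesis using A[OF w] w2 by auto
    qed simp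
  qed
  then have "card A \<le> card (insert 1 ?B)" by (intro card_mono) auto
  also have "\<dots> \<le> card ?B + 1" by (simp add: card_insert_if)
  finally show ?thesis by (simp add: heavy_count_def)
qed

lemma rank_le_n:
  assumes "\<sigma> \<in> jordan2_rankings n t" "v \<in> {1..n}"
  shows "1 \<le> \<sigma> v" "\<sigma> v \<le> n"
  using assms permutes_in_image[of \<sigma> "{1..n}" v] by (auto simp: jordan2_rankings_def)

text \<open>
  With \<open>y = lam * n / (S * v)\<close>, a rank of at least \<open>S * v\<close> requires that the Jordan-2 centrality
  of \<open>v\<close> is at most \<open>y\<^sup>2\<close> or that at least \<open>S * v\<close> vertices reach the level \<open>y\<^sup>2\<close>.
\<close>

lemma upper_tail_upper:
  assumes v: "v \<in> {1..n}" and S: "1 \<le> S"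
  shows "measure_pmf.prob (jordan2_ordering n) {\<sigma>. real (\<sigma> v) \<ge> S * real v} \<le> (144 * lam\<^sup>2 + 7376) * ((1 + ln S) / S\<^sup>2)"
proof (cases "3 \<le> n")
  case n: True
  define y where "y = lam * real n / (S * real v)"
  have "measure_pmf.prob (jordan2_ordering n) {\<sigma>. real (\<sigma> v) \<ge> S * real v}
     \<le> pr n (\<lambda>f. real (jordan2 (tree_of f n) v) \<le> y\<^sup>2 \<or> S * real v \<le> real (heavy_count n y f) + 1)"
  proof (rule ordering_prob_le)
    fix f \<sigma> assume f: "valid n f" and \<sigma>: "\<sigma> \<in> jordan2_rankings n (tree_of f n)" and r: "S * real v \<le> real (\<sigma> v)"
    show "real (jordan2 (tree_of f n) v) \<le> y\<^sup>2 \<or> S * real v \<le> real (heavy_count n y f) + 1"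
    proof (cases "real (jordan2 (tree_of f n) v) \<le> y\<^sup>2")
      case False
      have "\<sigma> v \<le> card {w \<in> {1..n}. jordan2 (tree_of f n) v \<le> jordan2 (tree_of f n) w}" by (rule rank_le[OF \<sigma> v])
      also have "\<dots> \<le> heavy_count n y f + 1"
      proof (rule card_above_le_heavy_count[OF f])
        fix w assume w: "w \<in> {w \<in> {1..n}. jordan2 (tree_of f n) v \<le> jordan2 (tree_of f n) w}"
        then have "real (jordan2 (tree_of f n) v) \<le> real (jordan2 (tree_of f n) w)" by simp
        then show "w \<in> {1..n} \<and> y\<^sup>2 \<le> real (jordan2 (tree_of f n) w)" using w False by auto
      qed (use n in auto)
      finally show ?thesis using r by linarith
    qed simp
  qed
  also have "\<dots> \<le> pr n (\<lambda>f. real (jordan2 (tree_of f n) v) \<le> y\<^sup>2) + pr n (\<lambda>f. S * real v \<le> real (heavy_count n y f) + 1)"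
    by (rule pr_disj)
  also have "\<dots> \<le> 144 * lam\<^sup>2 * ((1 + ln S) / S\<^sup>2) + 7376 * ((1 + ln S) / S\<^sup>2)"
  proof (rule add_mono)
    have nn: "0 \<le> (1 + ln S) / S\<^sup>2" using S by simp
    show "pr n (\<lambda>f. real (jordan2 (tree_of f n) v) \<le> y\<^sup>2) \<le> 144 * lam\<^sup>2 * ((1 + ln S) / S\<^sup>2)"
    proof (cases "3 \<le> v")
      case True
      have "9 * lam\<^sup>2 * ((1 + ln S) / S\<^sup>2) \<le> 144 * lam\<^sup>2 * ((1 + ln S) / S\<^sup>2)" using nn by (intro mult_right_mono) auto
      then show ?thesis using jordan2_small_prob_ge3[OF True _ S, of n] v by (simp add: y_def)
    next
      case False
      then show ?thesis using jordan2_small_prob_le2[of v n S] v S n by (simp add: y_def)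
    qed
    have "pr n (\<lambda>f. S * real v \<le> real (heavy_count n y f) + 1) \<le> 7376 / (S * real v)\<^sup>2"
      unfolding y_def using v S n by (intro heavy_count_bound) auto
    also have "\<dots> \<le> 7376 / S\<^sup>2" using v S by (intro divide_left_mono power_mono) auto
    also have "\<dots> \<le> 7376 * ((1 + ln S) / S\<^sup>2)" using S by (simp add: divide_right_mono)
    finally show "pr n (\<lambda>f. S * real v \<le> real (heavy_count n y f) + 1) \<le> 7376 * ((1 + ln S) / S\<^sup>2)" .
  qed
  finally show ?thesis by (simp only: distrib_right)
next
  case False
  show ?thesis
  (* For n \<le> 2 no rank exceeds 2, so only bounded S matter. *)
  proof (cases "S \<le> 2")
    case True
    have "S\<^sup>2 \<le> 2\<^sup>2" using True S by (intro power_mono) auto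
    then have "S\<^sup>2 \<le> 4 * (1 + ln S)" using S by (simp add: distrib_left) (use ln_ge_zero[OF S] in linarith)
    then have "1 \<le> 4 * ((1 + ln S) / S\<^sup>2)" using S by (simp add: field_simps)
    also have "\<dots> \<le> (144 * lam\<^sup>2 + 7376) * ((1 + ln S) / S\<^sup>2)"
      using S by (intro mult_right_mono) (auto simp: lam_def)
    finally show ?thesis using measure_pmf.prob_le_1 order_trans by blast
  next
    case S2: False
    have "measure_pmf.prob (jordan2_ordering n) {\<sigma>. real (\<sigma> v) \<ge> S * real v} \<le> pr n (\<lambda>_. False)"
    proof (rule ordering_prob_le)
      fix f \<sigma> assume \<sigma>: "\<sigma> \<in> jordan2_rankings n (tree_of f n)" and r: "S * real v \<le> real (\<sigma> v)"
      have "real (\<sigma> v) \<le> 2" using rank_le_n(2)[OF \<sigma> v] False by simp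
      moreover have "S * 1 \<le> S * real v" using v S by (intro mult_left_mono) auto
      ultimately show False using r S2 by simp
    qed
    also have "\<dots> \<le> (144 * lam\<^sup>2 + 7376) * ((1 + ln S) / S\<^sup>2)" using S by simp
    finally show ?thesis .
  qed
qed

section \<open>Lower tail: upper bound\<close>

text \<open>
  Among \<open>K\<close> vertices of Jordan centrality at least \<open>n / (4 * M)\<close> one is not strictly above \<open>v\<close>, if
  \<open>v\<close> is among the first \<open>K\<close>; the Jordan-2 centrality of that vertex is at least the square.
\<close>

lemma not_few_central_imp_jordan2:
  assumes f: "valid n f" and n: "2 \<le> n" and \<sigma>: "\<sigma> \<in> jordan2_rankings n (tree_of f n)" "\<sigma> v \<le> K" and v: "v \<in> {1..n}"
    and nf: "\<not> few_central n M K f"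
  shows "(real n)\<^sup>2 \<le> (4 * real M)\<^sup>2 * real (jordan2 (tree_of f n) v)"
proof -
  let ?G = "{w \<in> {1..n}. n \<le> 4 * M * jordan (tree_of f n) w}"
  let ?H = "{w \<in> {1..n}. jordan2 (tree_of f n) v < jordan2 (tree_of f n) w}"
  have "card ?H < K" using rank_ge[OF \<sigma>(1) v] \<sigma>(2) by simp
  also have "K \<le> card ?G" using nf by (simp add: few_central_def)
  finally have "\<not> ?G \<subseteq> ?H" using card_mono[of ?H ?G] by auto
  then obtain w where w': "w \<in> ?G" "w \<notin> ?H" by blast
  then have w: "w \<in> {1..n}" "n \<le> 4 * M * jordan (tree_of f n) w" "jordan2 (tree_of f n) w \<le> jordan2 (tree_of f n) v"
    by simp_all
  have "n * n \<le> (4 * M * jordan (tree_of f n) w) * (4 * M * jordan (tree_of f n) w)" using w(2) by (intro mult_mono) auto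
  also have "\<dots> = (4 * M) * (4 * M) * (jordan (tree_of f n) w * jordan (tree_of f n) w)" by (simp only: mult_ac)
  also have "\<dots> \<le> (4 * M) * (4 * M) * jordan2 (tree_of f n) v"
    using jordan2_ge_square[OF f n w(1)] w(3) by (intro mult_left_mono) auto
  finally have "real (n * n) \<le> real ((4 * M) * (4 * M) * jordan2 (tree_of f n) v)" by (rule of_nat_mono)
  then show ?thesis by (simp add: power2_eq_square)
qed

text \<open>
  The bound of \<open>few_central_prob_parent\<close> at \<open>M = 12 * 2 ^ i * K\<close>; the exponential decay in \<open>K\<close>
  takes care of the factor \<open>1 + 4 * K\<close>.
\<close>

lemma few_central_factor: "2 \<le> K \<Longrightarrow> 1 \<le> i \<Longrightarrow> (1 + 4 * real K) * (1 / 2 ^ i) ^ (3 * K) \<le> 9 * (1 / 8 ^ i)\<^sup>2"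
proof (induction K rule: dec_induct)
  case base
  have "((1 :: real) / 2 ^ i) ^ (3 * 2) = (1 / 8 ^ i)\<^sup>2"
  proof -
    have "(2 ^ i :: real) ^ 3 = (2 ^ 3) ^ i" by (simp only: power_mult[symmetric] mult.commute)
    then have "(1 / 2 ^ i :: real) ^ 3 = 1 / 8 ^ i" by (simp add: power_divide)
    then show ?thesis by (simp only: power_mult)
  qed
  then show ?case by simp
next
  case (step K)
  have "(1 / 2 ^ i :: real) \<le> 1 / 2" using step.prems power_increasing[of 1 i "2::real"] by (simp add: field_simps)
  then have a: "(1 / 2 ^ i :: real) ^ 3 \<le> (1 / 2) ^ 3" by (intro power_mono) auto
  have "(1 + 4 * real (Suc K)) * (1 / 2 ^ i) ^ (3 * Suc K) = ((1 + 4 * real (Suc K)) * (1 / 2 ^ i) ^ 3) * (1 / 2 ^ i) ^ (3 * K)"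
    by (simp add: power_add[symmetric] flip: power_mult)
  also have "\<dots> \<le> (1 + 4 * real K) * (1 / 2 ^ i) ^ (3 * K)"
  proof (intro mult_right_mono)
    have "(1 + 4 * real (Suc K)) * (1 / 2 ^ i) ^ 3 \<le> (1 + 4 * real (Suc K)) * (1 / 2) ^ 3"
      using a by (intro mult_left_mono) auto
    also have "\<dots> \<le> 1 + 4 * real K" using step by (simp add: power_divide)
    finally show "(1 + 4 * real (Suc K)) * (1 / 2 ^ i) ^ 3 \<le> 1 + 4 * real K" .
  qed auto
  finally show ?case using step by simp
qed

text \<open>
  On the dyadic scale \<open>M = 24 * 2 ^ i * K\<close>: level \<open>i - 1\<close> still has too few central vertices,
  while the Jordan-2 centrality of \<open>v\<close> may reach \<open>(n / (4 * M))\<^sup>2\<close>. For a given parent \<open>p\<close> the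
  first event has probability of order \<open>64 ^ (- i) / v\<close> by \<open>few_central_prob_parent\<close>, the second
  one of order \<open>(P / p) ^ 4 / v\<close> with \<open>P = 16 * M\<^sup>2 / v\<close> by \<open>DD_moment\<close>. The probability of both
  is at most the geometric mean \<open>8 ^ (- i) * (P / p)\<^sup>2 / v\<close>; its sum over \<open>p\<close> is of order
  \<open>8 ^ (- i) * P / v\<close>, and \<open>P\<close> grows only like \<open>4 ^ i\<close>, so that the levels are summable.
\<close>

lemma level_bound:
  assumes K: "2 \<le> K" "24 * 2 ^ i * K < v" and v: "v \<le> n"
  shows "pr n (\<lambda>f. (i = 0 \<or> few_central n (24 * 2 ^ (i - 1) * K) K f) \<and> (real n / (4 * real (24 * 2 ^ i * K)))\<^sup>2 \<le> real (D f n v * D f n (f v)))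
      \<le> 178937856 * (real K / real v)\<^sup>2 * (1 / 2) ^ i"
proof -
  define B where "B f \<longleftrightarrow> (i = 0 \<or> few_central n (24 * 2 ^ (i - 1) * K) K f)" for f
  define M where "M = 24 * 2 ^ i * K"
  define y where "y = real n / (4 * real M)"
  define A where "A f \<longleftrightarrow> y\<^sup>2 \<le> real (D f n v * D f n (f v))" for f
  (* The square of e is the decay of the first event, and e itself that of the geometric mean. *)
  define e where "e = (1 / 8 ^ i :: real)"
  define P where "P = 16 * (real M)\<^sup>2 / real v"
  define u where "u = 1 / (real v - 1)"
  have M0: "0 < M" using K by (simp add: M_def)
  have v2: "48 \<le> v"
  proof -
    have "24 * 1 * 2 \<le> 24 * 2 ^ i * K" using K by (intro mult_mono) auto
    then show ?thesis using K(2) by linarith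
  qed
  have y: "0 < y" using v v2 M0 by (simp add: y_def)
  have e: "0 < e" "e \<le> 1" by (auto simp: e_def)
  have P: "0 < P" using M0 v2 by (simp add: P_def)
  have u: "0 < u" using v2 by (simp add: u_def)
  have t: "pr n (\<lambda>f. f v = p \<and> B f \<and> A f) \<le> u * (9708 * e * (1 / (1 + real p / P)\<^sup>2))" if p: "p \<in> {1..v-1}" for p
  proof -
    define T where "T = pr n (\<lambda>f. f v = p \<and> B f \<and> A f)"
    have T0: "0 \<le> T" unfolding T_def by (rule pr_nonneg)
    have T1: "T \<le> u * (9 * e\<^sup>2)"
    proof (cases "i = 0")
      case True
      have "T \<le> pr n (\<lambda>f. f v = p)" unfolding T_def by (rule pr_mono) auto
      also have "\<dots> = u" unfolding u_def using p v v2 by (intro pr_parent) auto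
      finally show ?thesis using True u by (simp add: e_def)
    next
      case False
      have Mi: "24 * 2 ^ (i - 1) * K < v"
      proof -
        have "(2::nat) ^ (i - 1) \<le> 2 ^ i" by (intro power_increasing) auto
        then show ?thesis using K(2) mult_right_mono[of "24 * 2 ^ (i - 1)" "24 * 2 ^ i" K] by linarith
      qed
      have KM: "K \<le> 24 * 2 ^ (i - 1) * K" by simp
      have "T \<le> pr n (\<lambda>f. f v = p \<and> few_central n (24 * 2 ^ (i - 1) * K) K f)" unfolding T_def B_def using False by (intro pr_mono) auto
      also have "\<dots> \<le> (1 + 4 * real K) / (real v - 1) * (12 * real K / real (24 * 2 ^ (i - 1) * K)) ^ (3 * K)"
        using K KM Mi v p by (intro few_central_prob_parent) auto
      also have "12 * real K / real (24 * 2 ^ (i - 1) * K) = 1 / 2 ^ i"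
        using K False by (cases i) simp_all
      also have "(1 + 4 * real K) / (real v - 1) * (1 / 2 ^ i) ^ (3 * K) = u * ((1 + 4 * real K) * (1 / 2 ^ i) ^ (3 * K))"
        by (simp add: u_def)
      also have "\<dots> \<le> u * (9 * e\<^sup>2)" using few_central_factor[OF K(1), of i] False u by (intro mult_left_mono) (auto simp: e_def)
      finally show ?thesis .
    qed
    have T2: "T \<le> u * (654336 * (P / real p) ^ 4)"
    proof -
      have "T \<le> pr n (\<lambda>f. f v = p \<and> A f)" unfolding T_def by (rule pr_mono) auto
      also have "\<dots> \<le> 1 / (real v - 1) * (654336 * (real n ^ 2 / (real v * real p * y\<^sup>2)) ^ 4)"
        unfolding A_def using p v v2 y by (intro DD_moment) auto
      also have "real n ^ 2 / (real v * real p * y\<^sup>2) = P / real p"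
        using v v2 M0 by (simp add: y_def P_def power_divide power_mult_distrib)
      finally show ?thesis by (simp add: u_def)
    qed
    define r where "r = real p / P"
    have r: "0 < r" using p P by (simp add: r_def)
    have Pr: "P / real p = 1 / r" using P by (simp add: r_def)
    have "T \<le> u * (9708 * e * (1 / (1 + r)\<^sup>2))"
    proof (cases "r \<le> 1")
      case True
      have "(1 + r)\<^sup>2 \<le> 2\<^sup>2" using True r by (intro power_mono) auto
      then have "1 / 4 \<le> 1 / (1 + r)\<^sup>2" using r by (intro divide_left_mono) auto
      then have "9708 * e * (1 / 4) \<le> 9708 * e * (1 / (1 + r)\<^sup>2)" using e by (intro mult_left_mono) auto
      moreover have "9 * e\<^sup>2 \<le> 9708 * e * (1 / 4)" using e mult_left_mono[of e 1 e] by (simp add: power2_eq_square)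
      ultimately have "9 * e\<^sup>2 \<le> 9708 * e * (1 / (1 + r)\<^sup>2)" by linarith
      then have "u * (9 * e\<^sup>2) \<le> u * (9708 * e * (1 / (1 + r)\<^sup>2))" using u by (intro mult_left_mono) auto
      then show ?thesis using T1 by linarith
    next
      case False
      have "T\<^sup>2 \<le> (u * (2427 * e * (1 / r\<^sup>2)))\<^sup>2"
      proof -
        (* T is bounded by the geometric mean of the two bounds; 9 * 654336 \<le> 2427^2. *)
        have "T * T \<le> (u * (9 * e\<^sup>2)) * (u * (654336 * (P / real p) ^ 4))" using T0 T1 T2 u by (intro mult_mono) auto
        also have "\<dots> \<le> u * u * (e * e) * (2427 * 2427) * (1 / r) ^ 4" unfolding Pr using u e r by (simp add: power2_eq_square)
        also have "\<dots> = (u * (2427 * e * (1 / r\<^sup>2))) * (u * (2427 * e * (1 / r\<^sup>2)))" by (simp add: power4_eq_xxxx power2_eq_square mult_ac)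
        finally show ?thesis by (simp only: power2_eq_square)
      qed
      moreover have "0 \<le> u * (2427 * e * (1 / r\<^sup>2))" using u e by (intro mult_nonneg_nonneg) auto
      ultimately have "T \<le> u * (2427 * e * (1 / r\<^sup>2))" by (rule power2_le_imp_le)
      also have "\<dots> \<le> u * (2427 * e * (4 * (1 / (1 + r)\<^sup>2)))"
      proof (intro mult_left_mono)
        have "(1 + r)\<^sup>2 \<le> (2 * r)\<^sup>2" using False by (intro power_mono) auto
        then have 1: "(1 + r)\<^sup>2 \<le> 4 * r\<^sup>2" unfolding power_mult_distrib by simp
        have 2: "0 < (1 + r)\<^sup>2" "0 < r\<^sup>2" using r by (intro zero_less_power; simp)+
        have "1 / a \<le> 4 * (1 / b)" if "b \<le> 4 * a" "0 < b" "0 < a" for a b :: real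
          using that by (simp add: field_simps)
        from this[OF 1 2] show "1 / r\<^sup>2 \<le> 4 * (1 / (1 + r)\<^sup>2)" .
      qed (use u e in auto)
      finally show ?thesis by simp
    qed
    then show ?thesis by (simp add: T_def r_def)
  qed
  have "pr n (\<lambda>f. B f \<and> A f) \<le> (\<Sum>p\<in>{1..v-1}. pr n (\<lambda>f. f v = p \<and> B f \<and> A f))"
  proof (rule pr_UN)
    fix f assume "valid n f" "B f \<and> A f"
    then show "\<exists>p\<in>{1..v-1}. f v = p \<and> B f \<and> A f" using validD[of n f v] v v2 by (intro bexI[of _ "f v"]) auto
  qed simp
  also have "\<dots> \<le> (\<Sum>p\<in>{1..v-1}. u * (9708 * e * (1 / (1 + real p / P)\<^sup>2)))" by (rule sum_mono[OF t])
  also have "\<dots> = u * (9708 * e) * (\<Sum>p=1..v-1. 1 / (1 + real p / P)\<^sup>2)" by (simp add: sum_distrib_left mult.assoc)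
  also have "\<dots> \<le> u * (9708 * e) * P" using u e by (intro mult_left_mono sum_inverse_square_le[OF P]) auto
  also have "\<dots> = 89468928 * (e * (2 ^ i)\<^sup>2) * ((real K)\<^sup>2 * (u / real v))"
    by (simp add: P_def M_def power_mult_distrib)
  also have "e * (2 ^ i)\<^sup>2 = (1 / 2) ^ i"
    by (simp add: e_def power2_eq_square power_mult_distrib[symmetric] power_divide[symmetric] flip: power_one_over)
  also have "89468928 * (1 / 2) ^ i * ((real K)\<^sup>2 * (u / real v)) \<le> 89468928 * (1 / 2) ^ i * ((real K)\<^sup>2 * (2 / (real v)\<^sup>2))"
  proof (intro mult_left_mono)
    have "u \<le> 2 / real v" using v2 by (simp add: u_def field_simps)
    then have "u / real v \<le> 2 / real v / real v" by (rule divide_right_mono) simp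
    then show "u / real v \<le> 2 / (real v)\<^sup>2" by (simp add: power2_eq_square)
  qed auto
  also have "\<dots> = 178937856 * (real K / real v)\<^sup>2 * (1 / 2) ^ i" by (simp add: power_divide)
  finally show ?thesis by (simp add: A_def B_def y_def M_def)
qed

text \<open>
  Consider the first level of the dyadic scale with enough central vertices. The levels end at \<open>M\<close>
  of order \<open>v\<close>, where \<open>few_central_prob\<close> gives at most order \<open>(K / v)\<^sup>2\<close>; at an earlier level
  \<open>not_few_central_imp_jordan2\<close> forces a large value of \<open>D v * D (f v)\<close>.
\<close>

lemma rank_small:
  assumes K: "2 \<le> K" "24 * K < v" and v: "v \<le> n"
  shows "measure_pmf.prob (jordan2_ordering n) {\<sigma>. \<sigma> v \<le> K} \<le> 400000000 * (real K / real v)\<^sup>2"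
proof -
  define M where "M i = 24 * 2 ^ i * K" for i
  have "v \<le> M v"
  proof -
    have "v * 1 \<le> 2 ^ v * (24 * K)" using K by (intro mult_mono) (auto intro: less_imp_le)
    then show ?thesis by (simp add: M_def mult_ac)
  qed
  (* The levels 0..I are those with M below v, so that the parent of v is drawn after time M. *)
  define j where "j = (LEAST j. v \<le> M j)"
  have j: "v \<le> M j" unfolding j_def by (rule LeastI[of _ v]) fact
  have j0: "j \<noteq> 0" using j K by (auto simp: M_def intro: gr0I)
  define I where "I = j - 1"
  have I: "M I < v" "v \<le> 2 * M I"
  proof -
    have "I < j" using j0 by (simp add: I_def)
    then show "M I < v" using not_less_Least[of I "\<lambda>j. v \<le> M j"] by (simp add: j_def not_le)
    show "v \<le> 2 * M I" using j j0 by (cases j) (simp_all add: M_def I_def)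
  qed
  have Mmono: "M i \<le> M I" if "i \<le> I" for i
    using that by (auto simp: M_def intro!: mult_right_mono power_increasing)
  have n: "2 \<le> n" and vn: "v \<in> {2..n}" using K v by auto
  let ?E = "\<lambda>i f. (i = 0 \<or> few_central n (24 * 2 ^ (i - 1) * K) K f) \<and> (real n / (4 * real (24 * 2 ^ i * K)))\<^sup>2 \<le> real (D f n v * D f n (f v))"
  have "measure_pmf.prob (jordan2_ordering n) {\<sigma>. \<sigma> v \<le> K} \<le> pr n (\<lambda>f. few_central n (M I) K f \<or> (\<exists>i\<in>{..I}. ?E i f))"
  proof (rule ordering_prob_le)
    fix f \<sigma> assume f: "valid n f" and \<sigma>: "\<sigma> \<in> jordan2_rankings n (tree_of f n)" "\<sigma> v \<le> K"
    show "few_central n (M I) K f \<or> (\<exists>i\<in>{..I}. ?E i f)"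
    proof (cases "few_central n (M I) K f")
      case False
      define i where "i = (LEAST i. \<not> few_central n (M i) K f)"
      have i: "\<not> few_central n (M i) K f" "i \<le> I" unfolding i_def
        using LeastI[of "\<lambda>i. \<not> few_central n (M i) K f", OF False] Least_le[of "\<lambda>i. \<not> few_central n (M i) K f", OF False] by blast+
      have "i = 0 \<or> few_central n (M (i - 1)) K f"
        using not_less_Least[of "i - 1" "\<lambda>i. \<not> few_central n (M i) K f"] by (cases "i = 0") (auto simp: i_def)
      moreover have "(real n / (4 * real (M i)))\<^sup>2 \<le> real (D f n v * D f n (f v))"
      proof -
        have "(real n)\<^sup>2 \<le> (4 * real (M i))\<^sup>2 * real (jordan2 (tree_of f n) v)"
          using vn by (intro not_few_central_imp_jordan2[OF f n \<sigma> _ i(1)]) auto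
        moreover have "0 < (4 * real (M i))\<^sup>2" using K by (simp add: M_def)
        ultimately have "(real n / (4 * real (M i)))\<^sup>2 \<le> real (jordan2 (tree_of f n) v)"
          by (simp add: power_divide divide_le_eq mult.commute)
        also have "\<dots> \<le> real (D f n v * D f n (f v))" by (intro of_nat_mono jordan2_le_parent[OF f n vn])
        finally show ?thesis .
      qed
      ultimately show ?thesis using i(2) unfolding M_def by blast
    qed simp
  qed
  also have "\<dots> \<le> pr n (few_central n (M I) K) + pr n (\<lambda>f. \<exists>i\<in>{..I}. ?E i f)" by (rule pr_disj)
  also have "\<dots> \<le> 576 * (real K / real v)\<^sup>2 + 357875712 * (real K / real v)\<^sup>2"
  proof (rule add_mono)
    have MI: "K \<le> M I" "24 * K \<le> M I" by (simp_all add: M_def)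
    have "pr n (few_central n (M I) K) \<le> (12 * real K / real (M I)) ^ (3 * K)" using K MI I v by (intro few_central_prob) auto
    also have "\<dots> \<le> (12 * real K / real (M I)) ^ 2"
    proof (intro power_decreasing)
      have "12 * real K \<le> real (M I)" using MI(2) by linarith
      then show "12 * real K / real (M I) \<le> 1" by (simp add: divide_le_eq)
    qed (use K in auto)
    also have "\<dots> \<le> (24 * (real K / real v)) ^ 2"
    proof (intro power_mono)
      have "real v \<le> 2 * real (M I)" using I(2) by linarith
      then have "1 / real (M I) \<le> 2 / real v" using K MI I by (simp add: field_simps)
      then have "12 * real K * (1 / real (M I)) \<le> 12 * real K * (2 / real v)" by (rule mult_left_mono) simp
      then show "12 * real K / real (M I) \<le> 24 * (real K / real v)" by simp
    qed auto
    also have "\<dots> = 576 * (real K / real v)\<^sup>2" unfolding power_mult_distrib by simp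
    finally show "pr n (few_central n (M I) K) \<le> 576 * (real K / real v)\<^sup>2" .
    have "pr n (\<lambda>f. \<exists>i\<in>{..I}. ?E i f) \<le> (\<Sum>i\<in>{..I}. pr n (?E i))" by (rule pr_UN) auto
    also have "\<dots> \<le> (\<Sum>i\<in>{..I}. 178937856 * (real K / real v)\<^sup>2 * (1 / 2) ^ i)"
    proof (intro sum_mono level_bound K v)
      fix i assume "i \<in> {..I}"
      then have "M i < v" using Mmono[of i] I(1) by simp
      then show "24 * 2 ^ i * K < v" by (simp only: M_def)
    qed
    also have "\<dots> = 178937856 * (real K / real v)\<^sup>2 * (\<Sum>i\<in>{..I}. (1 / 2) ^ i)" by (simp add: sum_distrib_left)
    also have "\<dots> \<le> 178937856 * (real K / real v)\<^sup>2 * 2"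
    proof (rule mult_left_mono)
      show "(\<Sum>i\<in>{..I}. (1 / 2 :: real) ^ i) \<le> 2"
        by (subst sum_gp0) (simp add: power_one_over field_simps)
    qed simp
    finally show "pr n (\<lambda>f. \<exists>i\<in>{..I}. ?E i f) \<le> 357875712 * (real K / real v)\<^sup>2" by simp
  qed
  also have "\<dots> \<le> 400000000 * (real K / real v)\<^sup>2" by simp
  finally show ?thesis .
qed

lemma lower_tail_upper:
  assumes v: "v \<in> {1..n}" and S: "1 \<le> S"
  shows "measure_pmf.prob (jordan2_ordering n) {\<sigma>. real (\<sigma> v) \<le> 1 / S * real v} \<le> 1600000000 / S\<^sup>2"
proof -
  define K where "K = nat \<lfloor>real v / S\<rfloor>"
  have Kle: "real K \<le> real v / S" using S by (simp add: K_def of_nat_floor)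
  have imp: "\<sigma> v \<le> K" if "real (\<sigma> v) \<le> 1 / S * real v" for \<sigma> :: "nat \<Rightarrow> nat"
    using that by (simp add: K_def le_nat_floor)
  show ?thesis
  proof (cases "K = 0")
    case True
    have "measure_pmf.prob (jordan2_ordering n) {\<sigma>. real (\<sigma> v) \<le> 1 / S * real v} \<le> pr n (\<lambda>_. False)"
    proof (rule ordering_prob_le)
      fix f \<sigma> assume "\<sigma> \<in> jordan2_rankings n (tree_of f n)" "real (\<sigma> v) \<le> 1 / S * real v"
      then show False using rank_le_n(1)[OF _ v] imp[of \<sigma>] True by fastforce
    qed
    then show ?thesis using S by (simp add: order_trans)
  next
    case False
    (* The bound on few_central starts at two vertices; doubling K costs a factor four. *)
    define K2 where "K2 = max 2 K"
    have "1 \<le> real v / S" using False Kle by linarith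
    then have K2: "real K2 \<le> 2 * (real v / S)" using Kle by (simp add: K2_def)
    show ?thesis
    proof (cases "24 * K2 < v")
      case True
      have "measure_pmf.prob (jordan2_ordering n) {\<sigma>. real (\<sigma> v) \<le> 1 / S * real v} \<le> measure_pmf.prob (jordan2_ordering n) {\<sigma>. \<sigma> v \<le> K2}"
        using imp by (intro measure_pmf.finite_measure_mono) (auto simp: K2_def le_max_iff_disj)
      also have "\<dots> \<le> 400000000 * (real K2 / real v)\<^sup>2" using True v by (intro rank_small) (auto simp: K2_def)
      also have "\<dots> \<le> 400000000 * (2 / S)\<^sup>2"
      proof (intro mult_left_mono power_mono)
        show "real K2 / real v \<le> 2 / S" using K2 v S by (simp add: field_simps)
      qed auto
      also have "\<dots> = 1600000000 / S\<^sup>2" by (simp add: power_divide)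
      finally show ?thesis .
    next
      case F: False
      then have "real v \<le> 24 * real K2" by linarith
      also have "\<dots> \<le> 48 * (real v / S)" using K2 by simp
      finally have "S \<le> 48" using v S by (simp add: field_simps)
      then have "S\<^sup>2 \<le> 48\<^sup>2" using S by (intro power_mono) auto
      then have "1 \<le> 1600000000 / S\<^sup>2" using S by (simp add: field_simps)
      then show ?thesis using measure_pmf.prob_le_1 order_trans by blast
    qed
  qed
qed

section \<open>Lower tail: lower bound\<close>

lemma D_less:
  assumes f: "valid n f" and w: "2 \<le> w" "w \<le> n"
  shows "D f n w < n"
proof -
  have "desc f n w \<subseteq> {2..n}"
  proof
    fix x assume "x \<in> desc f n w"
    then show "x \<in> {2..n}" using desc_ge[OF f, of w x] w by simp
  qed
  then have "D f n w \<le> card {2..n}" by (intro card_mono) auto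
  then show ?thesis using w by simp
qed

lemma D_density:
  assumes w: "2 \<le> w" "w \<le> n"
  shows "pr n (\<lambda>f. D f n w = k) \<le> (real w - 1) / (real n - 1)"
proof (cases "1 \<le> k \<and> k < n")
  case True
  then show ?thesis
    using urn_density1[of w n "\<lambda>_. 1" "\<lambda>_. {w}" 1 k] w pr_le_1[of w "\<lambda>f. card (cluster f w {w} w) = _"] by simp
next
  case False
  have "pr n (\<lambda>f. D f n w = k) \<le> pr n (\<lambda>_. False)"
  proof (rule pr_mono)
    fix f assume f: "valid n f" and "D f n w = k"
    then show False using D_pos[of w n f] D_less[OF f w] w False by simp
  qed
  also have "\<dots> \<le> (real w - 1) / (real n - 1)" using w by simp
  finally show ?thesis .
qed

text \<open>
  Prescribing the parent of \<open>v\<close> increases \<open>D w\<close> by at most one, which at most doubles the bound on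
  the density.
\<close>

lemma parent_density:
  assumes v: "3 \<le> v" "v \<le> n" and w: "2 \<le> w" "w < v" and p: "1 \<le> p" "p < v" and k: "1 \<le> k" "k < n"
  shows "pr n (\<lambda>f. f v = p \<and> D f n w = k) \<le> 2 * (real w - 1) / ((real v - 1) * (real v - 2)) * (real v - 1) / (real n - 1)"
proof -
  obtain m where m: "v = Suc m" "2 \<le> m" using v by (cases v) auto
  define q where "q = 2 * (real w - 1) / ((real v - 1) * (real v - 2))"
  have "pr n (\<lambda>f. f v = p \<and> D f n w = k) = ev n (\<lambda>f. of_bool (f v = p) * of_bool (card (cluster f v (desc f v w) n) = k))"
    using v w by (intro ev_cong) (simp add: cluster_cluster of_bool_conj)
  also have "\<dots> \<le> q * (real v - 1) / (real n - 1)"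
  proof (rule urn_density1)
    show "local_at v (\<lambda>f. of_bool (f v = p) :: real)" by (auto simp: local_at_def)
    show "local_at v (\<lambda>f. desc f v w)" by (auto simp: local_at_def cluster_upd)
    fix k
    have "ev v (\<lambda>f. of_bool (f v = p) * of_bool (card (cluster f v (desc f v w) v) = k)) = ev v (\<lambda>f. of_bool (f v = p) * of_bool (D f v w = k))"
      using cluster_subset[of _ w "{w}" v] by (simp add: cluster_self Int_absorb2)
    also have "\<dots> = ev m (\<lambda>f. of_bool (D (f(v := p)) v w = k)) / real m"
      unfolding m using m p by (intro ev_parent) auto
    also have "\<dots> \<le> ev m (\<lambda>f. of_bool (D f m w = k) + of_bool (D f m w = k - 1)) / real m"
    proof (intro divide_right_mono ev_mono)
      fix f assume f: "valid m f"
      have "desc (f(v := p)) v w = (if p \<in> desc f m w then insert v (desc f m w) else desc f m w)"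
        unfolding m using f w m p by (intro cluster_Suc_upd) auto
      moreover have "v \<notin> desc f m w" using cluster_subset[of f w "{w}" m] m by auto
      ultimately have "D (f(v := p)) v w = D f m w \<or> D (f(v := p)) v w = Suc (D f m w)" by auto
      then show "of_bool (D (f(v := p)) v w = k) \<le> (of_bool (D f m w = k) + of_bool (D f m w = k - 1) :: real)" by auto
    qed auto
    also have "\<dots> \<le> ((real w - 1) / (real m - 1) + (real w - 1) / (real m - 1)) / real m"
      unfolding ev_add using w m by (intro divide_right_mono add_mono D_density) auto
    also have "\<dots> = q" by (simp add: q_def m mult.commute)
    finally show "ev v (\<lambda>f. of_bool (f v = p) * of_bool (card (cluster f v (desc f v w) v) = k)) \<le> q" .
  qed (use v k in auto)
  finally show ?thesis by (simp add: q_def)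
qed

lemma pr_small_value:
  assumes q: "0 \<le> q" and x: "0 \<le> x"
   and dens: "\<And>k. 1 \<le> k \<Longrightarrow> k < n \<Longrightarrow> pr n (\<lambda>f. A f \<and> X f = k) \<le> q"
   and X: "\<And>f. valid n f \<Longrightarrow> 1 \<le> X f \<and> X f < n"
  shows "pr n (\<lambda>f. A f \<and> real (X f) \<le> x) \<le> x * q"
proof -
  have "pr n (\<lambda>f. A f \<and> real (X f) \<le> x) \<le> (\<Sum>k\<in>{1..nat \<lfloor>x\<rfloor>}. pr n (\<lambda>f. A f \<and> X f = k))"
    using X by (intro pr_UN) (auto simp: le_nat_floor)
  also have "\<dots> \<le> (\<Sum>k\<in>{1..nat \<lfloor>x\<rfloor>}. q)"
  proof (rule sum_mono)
    fix k assume k: "k \<in> {1..nat \<lfloor>x\<rfloor>}"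
    show "pr n (\<lambda>f. A f \<and> X f = k) \<le> q"
    proof (cases "k < n")
      case False
      have "pr n (\<lambda>f. A f \<and> X f = k) \<le> pr n (\<lambda>_. False)"
      proof (rule pr_mono)
        fix f assume "valid n f" "A f \<and> X f = k"
        then show False using X[of f] False by simp
      qed
      then show ?thesis using q by simp
    qed (use dens k in auto)
  qed
  also have "\<dots> \<le> x * q" by (rule sum_const_floor_le[OF x q])
  finally show ?thesis .
qed

text \<open>
  Given the parent of \<open>v\<close>, each of \<open>D v\<close>, \<open>D p\<close> and the two sides of the edge between \<open>1\<close> and \<open>2\<close>
  is rarely below \<open>1 / 40\<close> of its typical size, and \<open>jordan_ge_min\<close> turns lower bounds on these
  numbers into centralities. The four exceptional events have conditional probability at most
  \<open>(1 + 6 + 6 + 6) / 40 \<le> 1 / 2\<close>.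
\<close>

lemma good_parent:
  assumes v: "3 \<le> v" "v \<le> n" and p: "1 \<le> p" "p < v"
  shows "1 / (2 * (real v - 1)) \<le> pr n (\<lambda>f. f v = p \<and> real n / (40 * real v) \<le> real (jordan (tree_of f n) v) \<and> real n / (40 * real p) \<le> real (jordan (tree_of f n) p))"
    (is "_ \<le> pr n ?G")
proof -
  (* Any value with 19 * b \<le> 1 / 2 will do. *)
  define b where "b = (1 / 40 :: real)"
  define u where "u = 1 / (real v - 1)"
  have u: "0 < u" using v by (simp add: u_def)
  have n3: "3 \<le> n" using v by simp
  let ?B1 = "\<lambda>f. f v = p \<and> real (D f n v) \<le> b * real n / real v"
  let ?B2 = "\<lambda>f. f v = p \<and> 2 \<le> p \<and> real (D f n p) \<le> b * real n / real p"
  let ?B3 = "\<lambda>f. f v = p \<and> real (D f n 2) \<le> b * real n"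
  let ?B4 = "\<lambda>f. f v = p \<and> real (n - D f n 2) \<le> b * real n"
  have nn: "real n / (real n - 1) \<le> 3 / 2" "(real v - 1) / (real v - 2) \<le> 2" using n3 v by (auto simp: field_simps)
  have B1: "pr n ?B1 \<le> b * u"
  proof -
    have "pr n ?B1 \<le> (b * real n / real v) * (u * (real v - 1) / (real n - 1))"
    proof (rule pr_small_value)
      fix k assume k: "1 \<le> k" "k < n"
      have "ev n (\<lambda>f. of_bool (f v = p) * of_bool (card (cluster f v {v} n) = k)) \<le> u * (real v - 1) / (real n - 1)"
      proof (rule urn_density1)
        show "local_at v (\<lambda>f. of_bool (f v = p) :: real)" by (auto simp: local_at_def)
        fix k
        have "ev v (\<lambda>f. of_bool (f v = p) * of_bool (card (cluster f v {v} v) = k)) \<le> pr v (\<lambda>f. f v = p)" by (rule ev_mono) auto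
        also have "\<dots> = u" unfolding u_def using v p by (intro pr_parent) auto
        finally show "ev v (\<lambda>f. of_bool (f v = p) * of_bool (card (cluster f v {v} v) = k)) \<le> u" .
      qed (use v k in auto)
      then show "pr n (\<lambda>f. f v = p \<and> D f n v = k) \<le> u * (real v - 1) / (real n - 1)" by (simp add: of_bool_conj)
    qed (use v u D_pos[of v n] D_less[of n _ v] in \<open>auto simp: b_def\<close>)
    also have "\<dots> = b * u * (((real v - 1) / (real n - 1)) * (real n / real v))" by (simp add: mult_ac)
    also have "\<dots> \<le> b * u * ((real v / real n) * (real n / real v))"
      using urn_density_ratio_le(1)[OF v] u v by (intro mult_left_mono mult_right_mono) (auto simp: b_def)
    also have "\<dots> = b * u" using v by simp
    finally show ?thesis .
  qed
  have Bw: "pr n (\<lambda>f. f v = p \<and> real (X f) \<le> x) \<le> 6 * (b * u)"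
    if w: "2 \<le> w" "w < v" and x: "0 \<le> x" "x * (real w - 1) \<le> b * real n" and X: "X = (\<lambda>f. D f n w) \<or> X = (\<lambda>f. n - D f n w)" for w x X
  proof -
    let ?q = "2 * (real w - 1) / ((real v - 1) * (real v - 2)) * (real v - 1) / (real n - 1)"
    have "pr n (\<lambda>f. f v = p \<and> real (X f) \<le> x) \<le> x * ?q"
    proof (rule pr_small_value)
      fix f assume f: "valid n f"
      show "1 \<le> X f \<and> X f < n" using X D_pos[of w n f] D_less[OF f, of w] w v by auto
    next
      fix k assume k: "1 \<le> k" "k < n"
      show "pr n (\<lambda>f. f v = p \<and> X f = k) \<le> ?q"
      proof (cases "X = (\<lambda>f. D f n w)")
        case True
        then show ?thesis using parent_density[OF v w p k] by simp
      next
        case False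
        then have XX: "X = (\<lambda>f. n - D f n w)" using X by blast
        have "pr n (\<lambda>f. f v = p \<and> X f = k) \<le> pr n (\<lambda>f. f v = p \<and> D f n w = n - k)"
          using k by (intro pr_mono) (auto simp: XX)
        also have "\<dots> \<le> ?q" using k by (intro parent_density[OF v w p]) auto
        finally show ?thesis .
      qed
    qed (use v w x in auto)
    also have "\<dots> = (x * (real w - 1)) * (2 * u * ((real v - 1) / (real v - 2)) * (1 / (real n - 1)))"
    proof -
      have "x * (2 * a / (c * d) * c / e) = (x * a) * (2 * (1 / c) * (c / d) * (1 / e))" if "c \<noteq> 0" for a c d e :: real
        using that by simp
      from this[of "real v - 1"] show ?thesis using v by (simp only: u_def)
    qed
    also have "\<dots> \<le> (b * real n) * (2 * u * 2 * (1 / (real n - 1)))"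
    proof (rule mult_mono)
      show "2 * u * ((real v - 1) / (real v - 2)) * (1 / (real n - 1)) \<le> 2 * u * 2 * (1 / (real n - 1))"
        using nn u n3 by (intro mult_right_mono mult_left_mono) auto
    qed (use x u v n3 in \<open>auto simp: b_def\<close>)
    also have "\<dots> = 4 * (b * u) * (real n / (real n - 1))" by simp
    also have "\<dots> \<le> 4 * (b * u) * (3 / 2)" using nn u by (intro mult_left_mono) (auto simp: b_def)
    finally show ?thesis by simp
  qed
  have B2: "pr n ?B2 \<le> 6 * (b * u)"
  proof (cases "2 \<le> p")
    case True
    have "pr n (\<lambda>f. f v = p \<and> real (D f n p) \<le> b * real n / real p) \<le> 6 * (b * u)"
    proof (rule Bw[where w = p])
      have "b * real n / real p * (real p - 1) \<le> b * real n / real p * real p" by (intro mult_left_mono) (auto simp: b_def)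
      then show "b * real n / real p * (real p - 1) \<le> b * real n" using p by simp
    qed (use True p in \<open>auto simp: b_def\<close>)
    then show ?thesis using True by simp
  qed (use u in \<open>simp add: b_def\<close>)
  have B3: "pr n ?B3 \<le> 6 * (b * u)" using v by (intro Bw[where w = 2]) (auto simp: b_def)
  have B4: "pr n ?B4 \<le> 6 * (b * u)" using v by (intro Bw[where w = 2]) (auto simp: b_def)
  have "u = pr n (\<lambda>f. f v = p)" unfolding u_def using v p by (intro pr_parent[symmetric]) auto
  also have "\<dots> \<le> pr n (\<lambda>f. ?G f \<or> ((?B1 f \<or> ?B2 f) \<or> (?B3 f \<or> ?B4 f)))"
  proof (rule pr_mono)
    fix f assume f: "valid n f" and fp: "f v = p"
    show "?G f \<or> ((?B1 f \<or> ?B2 f) \<or> (?B3 f \<or> ?B4 f))"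
    proof (cases "(?B1 f \<or> ?B2 f) \<or> (?B3 f \<or> ?B4 f)")
      case False
      have n2: "2 \<le> n" using n3 by simp
      have bn: "b * real n / real i \<le> b * real n" if "1 \<le> i" for i
        using that divide_left_mono[of 1 "real i" "b * real n"] by (simp add: b_def)
      have d: "b * real n < real (D f n 2)" "b * real n < real (n - D f n 2)" using False fp by auto
      have "b * real n / real v \<le> real (D f n v)" using False fp by auto
      then have "b * real n / real v \<le> real (min (D f n v) (min (D f n 2) (n - D f n 2)))"
        using d bn[of v] v by (simp add: min_def)
      also have "\<dots> \<le> real (jordan (tree_of f n) v)" using v by (intro of_nat_mono jordan_ge_min[OF f n2]) auto
      finally have 1: "b * real n / real v \<le> real (jordan (tree_of f n) v)" .
      have "b * real n / real p \<le> real (D f n p)"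
      proof (cases "2 \<le> p")
        case True
        then show ?thesis using False fp by auto
      next
        case False
        then have "p = 1" using p by simp
        then show ?thesis using D_1[OF f] bn[of 1] by (simp add: b_def)
      qed
      then have "b * real n / real p \<le> real (min (D f n p) (min (D f n 2) (n - D f n 2)))"
        using d bn[of p] p by (simp add: min_def)
      also have "\<dots> \<le> real (jordan (tree_of f n) p)" using v p by (intro of_nat_mono jordan_ge_min[OF f n2]) auto
      finally show ?thesis using 1 fp by (simp add: b_def)
    qed blast
  qed
  also have "\<dots> \<le> pr n ?G + ((pr n ?B1 + pr n ?B2) + (pr n ?B3 + pr n ?B4))"
    by (intro order_trans[OF pr_disj] add_mono order_refl)
  also have "\<dots> \<le> pr n ?G + 19 * (b * u)" using B1 B2 B3 B4 by simp
  finally have "u * (1 / 2) \<le> pr n ?G" using u by (simp add: b_def)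
  moreover have "1 / (2 * (real v - 1)) = u * (1 / 2)" by (simp add: u_def)
  ultimately show ?thesis by (simp only:)
qed

text \<open>
  A parent \<open>p \<le> a * v / S\<^sup>2\<close> has probability of order \<open>1 / S\<^sup>2\<close>, and \<open>good_parent\<close> then gives a
  Jordan-2 centrality of at least \<open>n\<^sup>2 / (1600 * v * p)\<close>, which is at least \<open>(lam * n * S / v)\<^sup>2\<close>
  by the choice of \<open>a\<close>. By \<open>heavy_count_bound\<close> fewer than \<open>v / S\<close> vertices reach this level,
  except with probability of order \<open>(S / v)\<^sup>2\<close>. The condition \<open>S \<le> \<delta> * sqrt v\<close> makes such parents
  exist and makes the exceptional probability small compared with \<open>1 / S\<^sup>2\<close>.
\<close>

lemma lower_tail_lower:
  "\<exists>c \<delta> :: real. 0 < c \<and> 0 < \<delta> \<and> (\<forall>n v S. 1 \<le> v \<longrightarrow> v \<le> n \<longrightarrow> 1 \<le> S \<longrightarrow> S \<le> \<delta> * sqrt (real v) \<longrightarrow>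
     c / S\<^sup>2 \<le> measure_pmf.prob (jordan2_ordering n) {\<sigma>. real (\<sigma> v) \<le> 1 / S * real v})"
proof -
  define a where "a = 1 / (1600 * lam\<^sup>2)"
  define \<delta> where "\<delta> = a / 100000"
  have a: "0 < a" "a \<le> 1 / 1600" by (auto simp: a_def lam_def)
  have d0: "0 < \<delta>" using a by (simp add: \<delta>_def)
  show ?thesis
  proof (rule exI[of _ "a / 8"], rule exI[of _ \<delta>], intro conjI allI impI)
    fix n v :: nat and S :: real
    assume v: "1 \<le> v" "v \<le> n" and S: "1 \<le> S" "S \<le> \<delta> * sqrt (real v)"
    have "S\<^sup>2 \<le> (\<delta> * sqrt (real v))\<^sup>2" using S by (intro power_mono) auto
    then have Sv: "S\<^sup>2 \<le> \<delta>\<^sup>2 * real v" by (simp add: power_mult_distrib)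
    have S2: "1 \<le> S\<^sup>2" using S by simp
    have dd: "\<delta>\<^sup>2 \<le> a / 2" "7376 * (\<delta>\<^sup>2 * \<delta>\<^sup>2) \<le> a / 8" "\<delta>\<^sup>2 \<le> 1 / 3"
    proof -
      have 0: "\<delta> \<le> 1" using a by (simp add: \<delta>_def)
      have "\<delta>\<^sup>2 \<le> \<delta>" using 0 d0 mult_left_mono[of \<delta> 1 \<delta>] by (simp add: power2_eq_square)
      then show "\<delta>\<^sup>2 \<le> a / 2" "\<delta>\<^sup>2 \<le> 1 / 3" using a by (auto simp: \<delta>_def)
      have "\<delta>\<^sup>2 * \<delta>\<^sup>2 \<le> \<delta> * 1" using \<open>\<delta>\<^sup>2 \<le> \<delta>\<close> 0 d0 by (intro mult_mono) auto
      then show "7376 * (\<delta>\<^sup>2 * \<delta>\<^sup>2) \<le> a / 8" using a by (simp add: \<delta>_def)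
    qed
    have v3: "3 \<le> v"
    proof -
      have "1 \<le> 1 / 3 * real v" using Sv S2 mult_right_mono[OF dd(3), of "real v"] by linarith
      then show ?thesis by linarith
    qed
    define K where "K = real v / S"
    define y where "y = lam * real n / K"
    (* The parents 1..P are old enough to lift v to the required level. *)
    define P where "P = nat \<lfloor>a * real v / S\<^sup>2\<rfloor>"
    have K: "0 < K" using v3 S by (simp add: K_def)
    have n: "3 \<le> n" using v3 v by simp
    have av: "2 \<le> a * real v / S\<^sup>2"
    proof -
      have "2 * S\<^sup>2 \<le> 2 * (\<delta>\<^sup>2 * real v)" using Sv by simp
      also have "\<dots> \<le> a * real v" using mult_right_mono[OF dd(1), of "real v"] by simp
      finally show ?thesis using S by (simp add: le_divide_eq)
    qed
    have P1: "a * real v / S\<^sup>2 / 2 \<le> real P" "real P \<le> a * real v / S\<^sup>2"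
    proof -
      have "a * real v / S\<^sup>2 < real_of_int \<lfloor>a * real v / S\<^sup>2\<rfloor> + 1" by linarith
      moreover have "real_of_int \<lfloor>a * real v / S\<^sup>2\<rfloor> \<le> real P" unfolding P_def by (cases "0 \<le> \<lfloor>a * real v / S\<^sup>2\<rfloor>") auto
      moreover have "x / 2 \<le> P'" if "x < i + 1" "i \<le> P'" "2 \<le> x" for x i P' :: real
        using that by linarith
      ultimately show "a * real v / S\<^sup>2 / 2 \<le> real P" using av by blast
      show "real P \<le> a * real v / S\<^sup>2" unfolding P_def using av by (intro of_nat_floor) simp
    qed
    have Pv: "P < v"
    proof -
      have "a * real v / S\<^sup>2 \<le> a * real v / 1" using S2 a by (intro divide_left_mono) auto
      also have "\<dots> < real v" using a v3 by simp
      finally show ?thesis using P1(2) by linarith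
    qed
    let ?G = "\<lambda>p f. f v = p \<and> real n / (40 * real v) \<le> real (jordan (tree_of f n) v) \<and> real n / (40 * real p) \<le> real (jordan (tree_of f n) p)"
    let ?J = "\<lambda>f. y\<^sup>2 \<le> real (jordan2 (tree_of f n) v)"
    have n2: "2 \<le> n" and vn: "v \<in> {2..n}" using n v3 v by auto
    have GJ: "?J f" if f: "valid n f" and p: "p \<in> {1..P}" and G: "?G p f" for f p
    proof -
      have "real p * (real v * (1600 * (lam\<^sup>2 * S\<^sup>2))) \<le> (a * real v / S\<^sup>2) * (real v * (1600 * (lam\<^sup>2 * S\<^sup>2)))"
        using p P1(2) by (intro mult_right_mono) auto
      also have "\<dots> = (real v)\<^sup>2" using S by (simp add: a_def lam_def power2_eq_square)
      finally have *: "real p * (real v * (1600 * (lam\<^sup>2 * S\<^sup>2))) \<le> (real v)\<^sup>2" .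
      have "y\<^sup>2 = lam\<^sup>2 * S\<^sup>2 * (real n)\<^sup>2 / (real v)\<^sup>2" by (simp add: y_def K_def power_mult_distrib power_divide)
      also have "\<dots> \<le> (real n)\<^sup>2 / (real p * (real v * 1600))"
        using * p v3 mult_left_mono[OF *, of "(real n)\<^sup>2"] by (simp add: field_simps)
      also have "\<dots> = real n / (40 * real v) * (real n / (40 * real p))" by (simp add: power2_eq_square)
      also have "\<dots> \<le> real (jordan (tree_of f n) v) * real (jordan (tree_of f n) p)"
        using G by (intro mult_mono) auto
      also have "\<dots> = real (jordan (tree_of f n) v * jordan (tree_of f n) (f v))" using G by simp
      also have "\<dots> \<le> real (jordan2 (tree_of f n) v)" by (intro of_nat_mono jordan2_ge_parent[OF f n2 vn])
      finally show ?thesis .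
    qed
    have "a / 4 / S\<^sup>2 \<le> real P * (1 / (2 * (real v - 1)))"
    proof -
      have "a / 4 / S\<^sup>2 = (a * real v / S\<^sup>2 / 2) * (1 / (2 * real v))" using v3 by simp
      also have "\<dots> \<le> real P * (1 / (2 * (real v - 1)))"
        using P1(1) v3 by (intro mult_mono divide_left_mono) auto
      finally show ?thesis .
    qed
    also have "\<dots> = (\<Sum>p\<in>{1..P}. 1 / (2 * (real v - 1)))" by simp
    also have "\<dots> \<le> (\<Sum>p\<in>{1..P}. pr n (?G p))" using Pv v v3 by (intro sum_mono good_parent) auto
    also have "\<dots> = ev n (\<lambda>f. \<Sum>p\<in>{1..P}. of_bool (?G p f))" by (subst ev_sum) auto
    also have "\<dots> \<le> pr n ?J"
    proof (rule ev_mono)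
      fix f assume f: "valid n f"
      have "(\<Sum>p\<in>{1..P}. of_bool (?G p f) :: real) \<le> (\<Sum>p\<in>{1..P}. if p = f v then of_bool (?J f) else 0)"
        using GJ[OF f] by (intro sum_mono) auto
      also have "\<dots> \<le> of_bool (?J f)" by (subst sum.delta) auto
      finally show "(\<Sum>p\<in>{1..P}. of_bool (?G p f) :: real) \<le> of_bool (?J f)" .
    qed
    also have "\<dots> \<le> pr n (\<lambda>f. (?J f \<and> real (heavy_count n y f) + 1 < K) \<or> K \<le> real (heavy_count n y f) + 1)"
      by (rule pr_mono) auto
    also have "\<dots> \<le> pr n (\<lambda>f. ?J f \<and> real (heavy_count n y f) + 1 < K) + pr n (\<lambda>f. K \<le> real (heavy_count n y f) + 1)" by (rule pr_disj)
    also have "pr n (\<lambda>f. K \<le> real (heavy_count n y f) + 1) \<le> 7376 / K\<^sup>2"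
      unfolding y_def using n K by (intro heavy_count_bound) auto
    also have "7376 / K\<^sup>2 \<le> a / 8 / S\<^sup>2"
    proof -
      have "S\<^sup>2 * S\<^sup>2 \<le> (\<delta>\<^sup>2 * real v) * (\<delta>\<^sup>2 * real v)" using Sv by (intro mult_mono) auto
      then have "7376 * (S\<^sup>2 * S\<^sup>2) \<le> 7376 * (\<delta>\<^sup>2 * \<delta>\<^sup>2) * (real v)\<^sup>2" by (simp add: power2_eq_square mult_ac)
      also have "\<dots> \<le> a / 8 * (real v)\<^sup>2" using dd(2) by (intro mult_right_mono) auto
      finally have "7376 * (S\<^sup>2 * S\<^sup>2) \<le> a / 8 * (real v)\<^sup>2" .
      moreover have "7376 / K\<^sup>2 = 7376 * (S\<^sup>2 * S\<^sup>2) / ((real v)\<^sup>2 * S\<^sup>2)"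
      proof -
        have "7376 / (V / s) = 7376 * (s * s) / (V * s)" if "s \<noteq> 0" for V s :: real using that by simp
        moreover have "S\<^sup>2 \<noteq> 0" using S by simp
        ultimately show ?thesis unfolding K_def power_divide by blast
      qed
      moreover have "a / 8 / S\<^sup>2 = a / 8 * (real v)\<^sup>2 / ((real v)\<^sup>2 * S\<^sup>2)" using v3 by simp
      ultimately show ?thesis by (simp only: divide_right_mono zero_le_mult_iff zero_le_power2 simp_thms)
    qed
    also have "pr n (\<lambda>f. ?J f \<and> real (heavy_count n y f) + 1 < K) \<le> measure_pmf.prob (jordan2_ordering n) {\<sigma>. real (\<sigma> v) \<le> 1 / S * real v}"
    proof (rule ordering_prob_ge)
      fix f \<sigma> assume f: "valid n f" and \<sigma>: "\<sigma> \<in> jordan2_rankings n (tree_of f n)" and J: "?J f \<and> real (heavy_count n y f) + 1 < K"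
      have "\<sigma> v \<le> card {w \<in> {1..n}. jordan2 (tree_of f n) v \<le> jordan2 (tree_of f n) w}" using vn by (intro rank_le[OF \<sigma>]) auto
      also have "\<dots> \<le> heavy_count n y f + 1"
      proof (rule card_above_le_heavy_count[OF f n2])
        fix w assume w: "w \<in> {w \<in> {1..n}. jordan2 (tree_of f n) v \<le> jordan2 (tree_of f n) w}"
        then have "real (jordan2 (tree_of f n) v) \<le> real (jordan2 (tree_of f n) w)" by simp
        then show "w \<in> {1..n} \<and> y\<^sup>2 \<le> real (jordan2 (tree_of f n) w)" using w J by auto
      qed
      finally have "real (\<sigma> v) \<le> real (heavy_count n y f + 1)" by (rule of_nat_mono)
      then show "real (\<sigma> v) \<le> 1 / S * real v" using J by (simp add: K_def)
    qed
    finally show "a / 8 / S\<^sup>2 \<le> measure_pmf.prob (jordan2_ordering n) {\<sigma>. real (\<sigma> v) \<le> 1 / S * real v}" by simp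
  qed (use a d0 in auto)
qed

section \<open>Upper tail: lower bound\<close>

text \<open>
  The size \<open>1\<close> of a colour is preserved by a draw at time \<open>n\<close> with probability \<open>(n - 1) / n\<close>.
\<close>

lemma leaf_prob:
  assumes p: "2 \<le> p" "p \<le> n"
  shows "pr n (\<lambda>f. D f n p = 1) = (real p - 1) / (real n - 1)"
  using p(2)
proof (induction n rule: dec_induct)
  case base
  have "desc f p p = {p}" for f using p by (simp add: cluster_self)
  then show ?case using p by simp
next
  case (step n)
  have "pr (Suc n) (\<lambda>f. D f (Suc n) p = 1) = real (n - 1) * pr n (\<lambda>f. D f n p = 1) / real n"
    using urn_pmf_step[of p n "\<lambda>_. 1" "\<lambda>_. {p}" "\<lambda>_. {}" 1 0] step p by simp
  also have "\<dots> = (real p - 1) / (real (Suc n) - 1)" using step p by (simp add: of_nat_diff)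
  finally show ?case .
qed

lemma parent_leaf_prob:
  assumes v: "3 \<le> v"
  shows "pr v (\<lambda>f. 2 \<le> f v \<and> desc f (v - 1) (f v) = {f v}) = 1 / 2"
proof -
  obtain m where m: "v = Suc m" "2 \<le> m" using v by (cases v) auto
  have *: "desc f m p = {p} \<longleftrightarrow> D f m p = 1" if "p \<in> {1..m}" for f p
  proof
    assume "D f m p = 1"
    then obtain x where "desc f m p = {x}" by (auto simp: card_1_singleton_iff)
    then show "desc f m p = {p}" using desc_self[of p m f] that by auto
  qed simp
  have "pr v (\<lambda>f. 2 \<le> f v \<and> desc f (v - 1) (f v) = {f v}) = ev m (\<lambda>f. (\<Sum>u=1..m. of_bool (2 \<le> u \<and> D f m u = 1)) / real m)"
    unfolding m using m by (subst ev_Suc) (auto intro!: ev_cong arg_cong2[where f = "(/)"] sum.cong simp: cluster_upd *)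
  also have "\<dots> = (\<Sum>u=1..m. pr m (\<lambda>f. 2 \<le> u \<and> D f m u = 1)) / real m"
    by (simp only: ev_divide ev_sum finite_atLeastAtMost)
  also have "(\<Sum>u=1..m. pr m (\<lambda>f. 2 \<le> u \<and> D f m u = 1)) = (\<Sum>u=1..m. (real u - 1) / (real m - 1))"
  proof (rule sum.cong[OF refl])
    fix u assume u: "u \<in> {1..m}"
    show "pr m (\<lambda>f. 2 \<le> u \<and> D f m u = 1) = (real u - 1) / (real m - 1)"
    proof (cases "2 \<le> u")
      case True
      then show ?thesis using leaf_prob[of u m] u by simp
    next
      case False
      then have "u = 1" using u by simp
      then show ?thesis by simp
    qed
  qed
  also have "\<dots> = (\<Sum>u=1..m. real u - 1) / (real m - 1)" by (simp add: sum_divide_distrib)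
  also have "(\<Sum>u=1..m. real u - 1) = real m * (real m - 1) / 2" by (induction m) (auto simp: field_simps)
  finally show ?thesis using m by simp
qed

text \<open>
  A history for which the urn at time \<open>max v 3\<close> has two colours with one vertex each, \<open>v\<close> itself
  and \<open>near_colour\<close>, that determine the Jordan-2 centrality of \<open>v\<close> from above. For \<open>v \<ge> 3\<close> the
  parent of \<open>v\<close> is a leaf when \<open>v\<close> arrives, and is the second colour. For \<open>v \<le> 2\<close> the vertex \<open>3\<close>
  is attached to the other one of \<open>1\<close> and \<open>2\<close>, which is the second colour.
\<close>

definition colour_event :: "nat \<Rightarrow> (nat \<Rightarrow> nat) \<Rightarrow> bool" where
  "colour_event v f = (if 3 \<le> v then 2 \<le> f v \<and> desc f (v - 1) (f v) = {f v} else f 3 = 3 - v)"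

definition near_colour :: "nat \<Rightarrow> (nat \<Rightarrow> nat) \<Rightarrow> nat set" where
  "near_colour v f = (if 3 \<le> v then desc f (v - 1) (f v) else {3 - v})"

lemma colour_event_prob: "1 \<le> v \<Longrightarrow> pr (max v 3) (colour_event v) = 1 / 2"
proof (cases "3 \<le> v")
  case True
  then show ?thesis using parent_leaf_prob[OF True] by (simp add: colour_event_def max_def)
next
  case False
  assume v: "1 \<le> v"
  have "pr (Suc 2) (\<lambda>f. f (Suc 2) = 3 - v) = 1 / 2" using ev_parent[of 2 "3 - v" "\<lambda>_. 1"] v False by simp
  then show ?thesis using False by (simp add: colour_event_def max_def numeral_3_eq_3 numeral_2_eq_2)
qed

text \<open>
  The vertex \<open>v\<close> has a branch whose complement is its own colour, and each neighbor has a branch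
  whose complement is contained in the union of both colours.
\<close>

lemma jordan2_upper_colours:
  assumes f: "valid n f" and n: "3 \<le> n" and v: "1 \<le> v" "v \<le> n" and ev: "colour_event v f"
  defines "k \<equiv> card (cluster f (max v 3) {v} n)" and "l \<equiv> card (cluster f (max v 3) (near_colour v f) n)"
  shows "jordan2 (tree_of f n) v \<le> k * (k + l)"
proof (cases "3 \<le> v")
  case True
  then have m: "max v 3 = v" by simp
  have "jordan2 (tree_of f n) v \<le> D f n v * D f n (f v)" using True v n by (intro jordan2_le_parent[OF f]) auto
  also have "D f n (f v) = D f n v + card (cluster f v (desc f (v - 1) (f v)) n)" using True v by (intro D_parent_split(1)[OF f]) auto
  finally show ?thesis using True by (simp add: k_def l_def m near_colour_def)
next
  case False
  then have m: "max v 3 = 3" and v12: "v = 1 \<or> v = 2" using v by auto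
  have n2: "2 \<le> n" using n by simp
  have f2: "f 2 = 1" using validD[OF f, of 2] n by simp
  have f3: "f 3 = 3 - v" using ev False by (simp add: colour_event_def)
  let ?J = "jordan (tree_of f n)"
  have tot: "D f n 3 + (k + l) = n"
  proof -
    have "{3} \<union> ({v} \<union> {3 - v}) = {1..3}" using v12 by auto
    moreover have "cluster f 3 {1..3} n = {1..n}" using anc_range[OF f, of 3] n by (auto simp: cluster_def)
    ultimately have "cluster f 3 {3} n \<union> (cluster f 3 {v} n \<union> cluster f 3 {3 - v} n) = {1..n}" by (simp only: cluster_Un[symmetric])
    moreover have "cluster f 3 {v} n \<inter> cluster f 3 {3 - v} n = {}" "cluster f 3 {3} n \<inter> (cluster f 3 {v} n \<union> cluster f 3 {3 - v} n) = {}"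
      using v12 unfolding cluster_Un[symmetric] by (intro cluster_disjoint; auto)+
    ultimately show ?thesis using False
      by (simp add: k_def l_def m near_colour_def card_Un_disjoint[symmetric])
  qed
  have J3: "?J (3 - v) \<le> k + l"
    using jordan_le_child[OF f n2, of 3] n f3 tot by simp
  have c12: "cluster f 2 C 3 = (if f 3 \<in> C \<inter> {1..2} then insert 3 (C \<inter> {1..2}) else C \<inter> {1..2})" for C
    using cluster_Suc[of 2 f 2 C] valid_mono[OF f, of 3] n by (simp add: cluster_self)
  show ?thesis
  proof (cases "v = 2")
    case True
    have "desc f 3 2 = {2}" using c12[of "{2}"] f3 True by simp
    then have k: "D f n 2 = k" using cluster_cluster[OF f, of 2 3 "{2}"] n True by (simp add: k_def m)
    have Jv: "?J v \<le> k" using jordan_le_desc[OF f n2, of 2] n k True by simp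
    have "jordan2 (tree_of f n) v \<le> ?J v * (k + l)"
    proof (rule jordan2_le[OF f n2])
      fix u assume "u \<in> neighbors (tree_of f n) v"
      then consider "u = 1" | "u \<in> {2..n}" "f u = 2" using True f2 by (auto simp: neighbors_iff)
      then show "?J u \<le> k + l"
      proof cases
        case 1
        then show ?thesis using J3 True by simp
      next
        case 2
        then show ?thesis using jordan_le_desc[OF f n2, of u] D_child[OF f, of u] k by simp
      qed
    qed (use v Jv in auto)
    also have "\<dots> \<le> k * (k + l)" using Jv by simp
    finally show ?thesis .
  next
    case F: False
    then have v1: "v = 1" using v12 by simp
    have "desc f 3 2 = {2, 3}" using c12[of "{2}"] f3 v1 by auto
    then have "desc f n 2 = cluster f 3 {2} n \<union> cluster f 3 {3} n" using cluster_cluster[OF f, of 2 3 "{2}"] n by (simp add: cluster_Un[symmetric] insert_commute)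
    moreover have "cluster f 3 {2} n \<inter> cluster f 3 {3} n = {}" by (intro cluster_disjoint) auto
    ultimately have D2: "D f n 2 + k = n" using tot v1 by (simp add: card_Un_disjoint l_def k_def m near_colour_def)
    have Jv: "?J v \<le> k" using jordan_le_child[OF f n2, of 2] n f2 D2 v1 by simp
    have "jordan2 (tree_of f n) v \<le> ?J v * (k + l)"
    proof (rule jordan2_le[OF f n2])
      fix u assume "u \<in> neighbors (tree_of f n) v"
      then have u: "u \<in> {2..n}" "f u = 1" using v1 by (auto simp: neighbors_iff)
      show "?J u \<le> k + l"
      proof (cases "u = 2")
        case True
        then show ?thesis using J3 v1 by simp
      next
        case False
        have "desc f n u \<inter> desc f n 2 = {}" using siblings_disjoint[OF f u(1), of 2] u f2 n False by auto
        then have "D f n u + D f n 2 \<le> n" by (rule D_add_le)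
        then show ?thesis using jordan_le_desc[OF f n2 u(1)] D2 by simp
      qed
    qed (use v Jv in auto)
    also have "\<dots> \<le> k * (k + l)" using Jv by simp
    finally show ?thesis .
  qed
qed

text \<open>
  A consequence of \<open>urn_density_lower\<close>: for \<open>k + l\<close> up to \<open>n / (9 * v)\<close> the correction is at most
  one half, and \<open>1 / 2 * (2 / 9) * (1 / 2) \<ge> 1 / 20\<close>.
\<close>

lemma colour_density:
  assumes v: "1 \<le> v" "v \<le> n" and n: "6 \<le> n" and kl: "1 \<le> k" "1 \<le> l" "9 * real v * (real k + real l) \<le> real n"
  shows "(real v / real n)\<^sup>2 / 20 \<le> pr n (\<lambda>f. colour_event v f \<and> card (cluster f (max v 3) {v} n) = k \<and> card (cluster f (max v 3) (near_colour v f) n) = l)"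
proof -
  define m where "m = max v 3"
  have m: "3 \<le> m" "m \<le> n" "real m \<le> 3 * real v" "real v \<le> real m" using v n by (auto simp: m_def)
  have loc: "local_at m (\<lambda>f. of_bool (colour_event v f) :: real)" "local_at m (near_colour v)"
  proof -
    have "colour_event v (f(k := u)) = colour_event v f \<and> near_colour v (f(k := u)) = near_colour v f" if "m < k" for f k u
    proof -
      have "v < k" "3 < k" using that by (simp_all add: m_def)
      then have "k \<noteq> v" "k \<noteq> 3" "v - 1 < k" by simp_all
      then show ?thesis by (simp add: colour_event_def near_colour_def cluster_upd)
    qed
    then show "local_at m (\<lambda>f. of_bool (colour_event v f) :: real)" "local_at m (near_colour v)"
      unfolding local_at_def by simp_all
  qed
  have disj: "{v} \<inter> near_colour v f = {}" for f
    using cluster_subset[of f "f v" "{f v}" "v - 1"] v by (auto simp: near_colour_def) arith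
  have one: "card (cluster f m {v} m) = 1 \<and> card (cluster f m (near_colour v f) m) = 1"
    if "valid m f" "of_bool (colour_event v f) \<noteq> (0 :: real)" for f
  proof -
    have "near_colour v f = {x} \<and> 1 \<le> x \<and> x \<le> m" if "x = (if 3 \<le> v then f v else 3 - v)" for x
      using that \<open>of_bool (colour_event v f) \<noteq> (0 :: real)\<close> v validD[OF \<open>valid m f\<close>, of v] m
      by (auto simp: near_colour_def colour_event_def m_def)
    then have "card (near_colour v f \<inter> {1..m}) = 1" by (auto simp: Int_insert_left)
    moreover have "{v} \<inter> {1..m} = {v}" using v m by auto
    ultimately show ?thesis by (simp add: cluster_self)
  qed
  have "ev m (\<lambda>f. of_bool (colour_event v f)) * ((real m - 1) * (real m - 2) / ((real n - 1) * (real n - 2))) * (1 - (real m - 2) * (real k + real l - 2) / (real n - 2))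
    \<le> ev n (\<lambda>f. of_bool (colour_event v f) * of_bool (card (cluster f m {v} n) = k \<and> card (cluster f m (near_colour v f) n) = l))"
    using m kl by (intro urn_density_lower loc disj one) auto
  also have "\<dots> = pr n (\<lambda>f. colour_event v f \<and> card (cluster f m {v} n) = k \<and> card (cluster f m (near_colour v f) n) = l)"
    by (simp add: of_bool_conj)
  also have "ev m (\<lambda>f. of_bool (colour_event v f)) = 1 / 2" unfolding m_def by (rule colour_event_prob[OF v(1)])
  finally have a: "1 / 2 * ((real m - 1) * (real m - 2) / ((real n - 1) * (real n - 2))) * (1 - (real m - 2) * (real k + real l - 2) / (real n - 2))
    \<le> pr n (\<lambda>f. colour_event v f \<and> card (cluster f m {v} n) = k \<and> card (cluster f m (near_colour v f) n) = l)" .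
  have b: "(real m - 1) * (real m - 2) / ((real n - 1) * (real n - 2)) \<ge> 2 / 9 * (real v / real n)\<^sup>2"
  proof -
    have "(2 / 3 * real v) * (1 / 3 * real v) \<le> (real m - 1) * (real m - 2)"
      using m by (intro mult_mono) auto
    then have "(2 / 3 * real v) * (1 / 3 * real v) / (real n * real n) \<le> (real m - 1) * (real m - 2) / ((real n - 1) * (real n - 2))"
      using n m by (intro frac_le mult_mono) auto
    then show ?thesis by (simp add: power2_eq_square)
  qed
  have c: "1 / 2 \<le> 1 - (real m - 2) * (real k + real l - 2) / (real n - 2)"
  proof -
    have "(real m - 2) * (real k + real l - 2) \<le> (3 * real v) * (real k + real l)" using m kl by (intro mult_mono) auto
    also have "\<dots> \<le> real n / 3" using kl(3) by simp
    also have "\<dots> \<le> (real n - 2) / 2" using n by (simp add: field_simps)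
    finally have "(real m - 2) * (real k + real l - 2) / (real n - 2) \<le> 1 / 2" using n by (simp add: divide_le_eq)
    then show ?thesis by simp
  qed
  have "(real v / real n)\<^sup>2 / 20 \<le> 1 / 2 * (2 / 9 * (real v / real n)\<^sup>2) * (1 / 2)" by simp
  also have "\<dots> \<le> 1 / 2 * ((real m - 1) * (real m - 2) / ((real n - 1) * (real n - 2))) * (1 - (real m - 2) * (real k + real l - 2) / (real n - 2))"
    using b c m n by (intro mult_mono) auto
  finally show ?thesis using a unfolding m_def by (rule order_trans)
qed

lemma ln_le_harmonic:
  assumes "1 \<le> m" "m \<le> N"
  shows "ln (real (Suc N) / real m) \<le> (\<Sum>k=m..N. 1 / real k)"
  using assms(2)
proof (induction N rule: dec_induct)
  case base
  have "ln (real (Suc m) / real m) \<le> real (Suc m) / real m - 1" using assms by (intro ln_le_minus_one) auto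
  then show ?case using assms by (simp add: field_simps)
next
  case (step N)
  have "ln (real (Suc (Suc N)) / real (Suc N)) \<le> real (Suc (Suc N)) / real (Suc N) - 1" by (intro ln_le_minus_one) auto
  also have "\<dots> = 1 / real (Suc N)" by (simp add: field_simps)
  finally have "ln (real (Suc (Suc N))) - ln (real (Suc N)) \<le> 1 / real (Suc N)" by (simp add: ln_div)
  then show ?case using step assms by (simp add: ln_div)
qed

text \<open>
  Adds up the flat density over the pairs with \<open>\<kappa> \<le> k \<le> y / 2\<close> and \<open>k * l \<le> y\<^sup>2 / 2\<close>, for which
  \<open>k * (k + l) \<le> y\<^sup>2\<close>. The bound \<open>\<kappa>\<close> keeps \<open>l\<close> in the range in which the density is flat. The
  number of pairs is a harmonic sum.
\<close>

lemma jordan2_small_prob_lower: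
  assumes v: "1 \<le> v" "v \<le> n" and n: "6 \<le> n" and \<kappa>: "1 \<le> \<kappa>" "9 * real v * y\<^sup>2 \<le> real n * \<kappa>"
    and y: "0 < y" "9 * real v * y \<le> real n" and ratio: "4 * \<kappa> \<le> y"
  shows "(real v / real n)\<^sup>2 * y\<^sup>2 / 80 * ln (y / (4 * \<kappa>)) \<le> pr n (\<lambda>f. real (jordan2 (tree_of f n) v) \<le> y\<^sup>2)"
proof -
  let ?k = "\<lambda>f. card (cluster f (max v 3) {v} n)" and ?l = "\<lambda>f. card (cluster f (max v 3) (near_colour v f) n)"
  define k1 where "k1 = nat \<lceil>\<kappa>\<rceil>"
  define k2 where "k2 = nat \<lfloor>y / 2\<rfloor>"
  have k1: "\<kappa> \<le> real k1" "real k1 \<le> 2 * \<kappa>" "1 \<le> k1" using \<kappa>(1) unfolding k1_def by linarith+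
  have k2: "real k2 \<le> y / 2" "y / 2 \<le> real (Suc k2)" using y(1) unfolding k2_def by linarith+
  have k12: "k1 \<le> k2" using k1 k2 ratio unfolding k2_def by (intro le_nat_floor) linarith
  define R where "R = (SIGMA k:{k1..k2}. {1..nat \<lfloor>y\<^sup>2 / (2 * real k)\<rfloor>})"
  define q where "q = (real v / real n)\<^sup>2 / 20"
  have q0: "0 \<le> q" by (simp add: q_def)
  have R: "k \<in> {k1..k2} \<and> 1 \<le> l \<and> real k \<le> y / 2 \<and> real k * real l \<le> y\<^sup>2 / 2" if "(k, l) \<in> R" for k l
  proof -
    have k: "k \<in> {k1..k2}" and l: "1 \<le> l" "l \<le> nat \<lfloor>y\<^sup>2 / (2 * real k)\<rfloor>" using that by (auto simp: R_def)
    have "real l \<le> real (nat \<lfloor>y\<^sup>2 / (2 * real k)\<rfloor>)" using l by simp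
    also have "\<dots> \<le> y\<^sup>2 / (2 * real k)" by (intro of_nat_floor) simp
    finally have "real k * real l \<le> y\<^sup>2 / 2" using k k1 by (simp add: field_simps)
    moreover have "real k \<le> real k2" using k by simp
    ultimately show ?thesis using k l k2 by auto
  qed
  have "(real v / real n)\<^sup>2 * y\<^sup>2 / 80 * ln (y / (4 * \<kappa>)) = q * (y\<^sup>2 / 4 * ln (y / (4 * \<kappa>)))" by (simp add: q_def)
  also have "\<dots> \<le> q * real (card R)"
  proof (intro mult_left_mono q0)
    have "y\<^sup>2 / 4 * ln (y / (4 * \<kappa>)) \<le> y\<^sup>2 / 4 * ln (real (Suc k2) / real k1)"
    proof (intro mult_left_mono ln_mono)
      have "y / (4 * \<kappa>) = (y / 2) / (2 * \<kappa>)" by simp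
      also have "\<dots> \<le> real (Suc k2) / real k1" using k1 k2 y by (intro frac_le) auto
      finally show "y / (4 * \<kappa>) \<le> real (Suc k2) / real k1" .
    qed (use y \<kappa> in auto)
    also have "\<dots> \<le> y\<^sup>2 / 4 * (\<Sum>k=k1..k2. 1 / real k)" using k1 k12 by (intro mult_left_mono ln_le_harmonic) auto
    also have "\<dots> = (\<Sum>k=k1..k2. y\<^sup>2 / (4 * real k))" by (simp add: sum_distrib_left)
    also have "\<dots> \<le> (\<Sum>k=k1..k2. real (nat \<lfloor>y\<^sup>2 / (2 * real k)\<rfloor>))"
    proof (rule sum_mono)
      fix k assume k: "k \<in> {k1..k2}"
      then have k0: "0 < real k" "real k \<le> y / 2" using k1 k2 of_nat_mono[of k k2, where 'a=real] by auto
      have y4: "4 \<le> y" using ratio \<kappa>(1) by linarith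
      have "2 * (2 * real k) \<le> y * y" using k0 y4 mult_mono[of 2 y "2 * real k" y] by simp
      then have "2 \<le> y\<^sup>2 / (2 * real k)" using k0 by (simp add: le_divide_eq power2_eq_square)
      moreover have "x / 2 \<le> real (nat \<lfloor>x\<rfloor>)" if "2 \<le> x" for x :: real using that by linarith
      ultimately have "y\<^sup>2 / (2 * real k) / 2 \<le> real (nat \<lfloor>y\<^sup>2 / (2 * real k)\<rfloor>)" by blast
      then show "y\<^sup>2 / (4 * real k) \<le> real (nat \<lfloor>y\<^sup>2 / (2 * real k)\<rfloor>)" by simp
    qed
    also have "\<dots> = real (card R)" by (simp add: R_def)
    finally show "y\<^sup>2 / 4 * ln (y / (4 * \<kappa>)) \<le> real (card R)" .
  qed
  also have "\<dots> = (\<Sum>r\<in>R. q)" by simp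
  also have "\<dots> \<le> (\<Sum>r\<in>R. pr n (\<lambda>f. colour_event v f \<and> ?k f = fst r \<and> ?l f = snd r))"
  proof (rule sum_mono)
    fix r assume "r \<in> R"
    then obtain k l where r: "r = (k, l)" "(k, l) \<in> R" by (cases r) auto
    have k: "k1 \<le> k" "1 \<le> l" "real k \<le> y / 2" "real k * real l \<le> y\<^sup>2 / 2" using R[OF r(2)] by auto
    have "\<kappa> * real l \<le> real k * real l" using k k1 by (intro mult_right_mono) auto
    then have "\<kappa> * real l \<le> y\<^sup>2 / 2" using k by linarith
    then have "9 * real v * (\<kappa> * real l) \<le> 9 * real v * (y\<^sup>2 / 2)" by (rule mult_left_mono) simp
    also have "\<dots> \<le> real n * \<kappa> / 2" using \<kappa>(2) by simp
    finally have "\<kappa> * (9 * real v * real l) \<le> \<kappa> * (real n / 2)" by (simp add: mult_ac)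
    then have "9 * real v * real l \<le> real n / 2" using \<kappa>(1) by (simp add: mult_le_cancel_left)
    moreover have "9 * real v * real k \<le> real n / 2"
    proof -
      have "9 * real v * real k \<le> 9 * real v * (y / 2)" using k by (intro mult_left_mono) auto
      moreover have "9 * real v * (y / 2) = 9 * real v * y / 2" by simp
      ultimately show ?thesis using y by linarith
    qed
    ultimately have "9 * real v * (real k + real l) \<le> real n" by (simp add: distrib_left)
    then show "q \<le> pr n (\<lambda>f. colour_event v f \<and> ?k f = fst r \<and> ?l f = snd r)"
      using colour_density[OF v n, of k l] k k1 by (simp add: q_def r(1))
  qed
  also have "\<dots> = ev n (\<lambda>f. \<Sum>r\<in>R. of_bool (colour_event v f \<and> ?k f = fst r \<and> ?l f = snd r))"
    by (subst ev_sum) (auto simp: R_def)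
  also have "\<dots> \<le> pr n (\<lambda>f. real (jordan2 (tree_of f n) v) \<le> y\<^sup>2)"
  proof (rule ev_mono)
    fix f assume f: "valid n f"
    have "(\<Sum>r\<in>R. of_bool (colour_event v f \<and> ?k f = fst r \<and> ?l f = snd r) :: real)
       \<le> (\<Sum>r\<in>R. if r = (?k f, ?l f) then of_bool (real (jordan2 (tree_of f n) v) \<le> y\<^sup>2) else 0)"
    proof (rule sum_mono)
      fix r assume r: "r \<in> R"
      show "(of_bool (colour_event v f \<and> ?k f = fst r \<and> ?l f = snd r) :: real)
         \<le> (if r = (?k f, ?l f) then of_bool (real (jordan2 (tree_of f n) v) \<le> y\<^sup>2) else 0)"
      proof (cases "colour_event v f \<and> ?k f = fst r \<and> ?l f = snd r")
        case True
        then have rk: "r = (?k f, ?l f)" by (simp add: prod_eq_iff)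
        have n3: "3 \<le> n" using n by simp
        have kl: "real (?k f) \<le> y / 2" "real (?k f) * real (?l f) \<le> y\<^sup>2 / 2" using R[of "?k f" "?l f"] r rk by auto
        have "real (jordan2 (tree_of f n) v) \<le> real (?k f * (?k f + ?l f))"
          using True by (intro of_nat_mono jordan2_upper_colours[OF f n3 v]) auto
        also have "\<dots> = real (?k f) * real (?k f) + real (?k f) * real (?l f)" by (simp add: distrib_left)
        also have "real (?k f) * real (?k f) \<le> (y / 2) * (y / 2)" using kl y by (intro mult_mono) auto
        finally have "real (jordan2 (tree_of f n) v) \<le> y * y / 4 + y\<^sup>2 / 2" using kl by simp
        also have "\<dots> \<le> y\<^sup>2" by (simp add: power2_eq_square)
        finally show ?thesis using rk by simp
      next
        case False
        then have "of_bool (colour_event v f \<and> ?k f = fst r \<and> ?l f = snd r) = (0 :: real)" by (simp only: of_bool_eq_0_iff not_False_eq_True)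
        then show ?thesis by (rule ord_eq_le_trans) simp
      qed
    qed
    also have "\<dots> \<le> of_bool (real (jordan2 (tree_of f n) v) \<le> y\<^sup>2)" by (subst sum.delta) (auto simp: R_def)
    finally show "(\<Sum>r\<in>R. of_bool (colour_event v f \<and> ?k f = fst r \<and> ?l f = snd r)) \<le> (of_bool (real (jordan2 (tree_of f n) v) \<le> y\<^sup>2) :: real)" .
  qed
  finally show ?thesis .
qed

text \<open>
  Splits the bound of \<open>few_central_prob\<close> at \<open>M = A * K\<close> into a power of \<open>1 / A\<close>, to be made small
  by the choice of \<open>A\<close>, and an inverse square of \<open>K\<close>.
\<close>

lemma few_central_decay:
  assumes A: "24 \<le> A" and K: "2 \<le> K"
  shows "(12 / real A) ^ (3 * K) \<le> (12 / real A) ^ 6 * (4 / (real K)\<^sup>2)"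
  using K
proof (induction K rule: dec_induct)
  case (step K)
  have "12 / real A \<le> 1 / 2" using A by (simp add: field_simps)
  then have "(12 / real A) ^ 3 \<le> (1 / 2) ^ 3" by (intro power_mono) auto
  then have "(12 / real A) ^ 3 * (12 / real A) ^ (3 * K) \<le> 1 / 8 * ((12 / real A) ^ 6 * (4 / (real K)\<^sup>2))"
    using step by (intro mult_mono) (auto simp: power_divide)
  also have "\<dots> \<le> (12 / real A) ^ 6 * (4 / (real (Suc K))\<^sup>2)"
  proof -
    have "real (Suc K) \<le> 2 * real K" using step by simp
    then have "(real (Suc K))\<^sup>2 \<le> (2 * real K)\<^sup>2" by (intro power_mono) auto
    then have "(real (Suc K))\<^sup>2 \<le> 4 * (real K)\<^sup>2" by (simp add: power_mult_distrib)
    then have "(real (Suc K))\<^sup>2 \<le> 8 * (real K)\<^sup>2" using zero_le_power2[of "real K"] by linarith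
    then have "4 / (8 * (real K)\<^sup>2) \<le> 4 / (real (Suc K))\<^sup>2" using step by (intro divide_left_mono) auto
    then have "(12 / real A) ^ 6 * (4 / (8 * (real K)\<^sup>2)) \<le> (12 / real A) ^ 6 * (4 / (real (Suc K))\<^sup>2)" by (intro mult_left_mono) auto
    then show ?thesis by simp
  qed
  finally show ?case by (simp add: power_add)
qed auto

text \<open>
  Let \<open>y = \<alpha> * n / (S * v)\<close>. The condition on \<open>S\<close> makes the argument of the logarithm in
  \<open>jordan2_small_prob_lower\<close> at least \<open>4 * S powr \<epsilon>\<close>, so the Jordan-2 centrality of \<open>v\<close> is at most
  \<open>y\<^sup>2\<close> with probability at least \<open>\<alpha>\<^sup>2 * \<epsilon> / 80 * (1 + ln S) / S\<^sup>2\<close>. If moreover \<open>K \<ge> S * v\<close>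
  vertices have Jordan centrality at least \<open>n / (4 * A * K) > y\<close>, all of them are above \<open>v\<close>. For
  this to fail costs a factor of order \<open>A ^ (- 6)\<close>, whereas \<open>\<alpha>\<^sup>2\<close> is of order \<open>A ^ (- 2)\<close>: a large
  \<open>A\<close> makes the failure probability at most one half of the main term.
\<close>

lemma upper_tail_lower:
  assumes \<epsilon>: "0 < \<epsilon>" "\<epsilon> \<le> 1 / 2"
  shows "\<exists>c::real. 0 < c \<and> c < 1 \<and> (\<forall>n v S. 1 \<le> v \<longrightarrow> v \<le> n \<longrightarrow> 1 \<le> S \<longrightarrow> S \<le> c * (real n / real v) powr (1 - \<epsilon>) \<longrightarrow>
     c * ((1 + ln S) / S\<^sup>2) \<le> measure_pmf.prob (jordan2_ordering n) {\<sigma>. real (\<sigma> v) \<ge> S * real v})"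
proof -
  (* A is taken so large that the probability of few_central, of order A^(-6), is at most c
     times the target. *)
  define N where "N = 4 * 12 ^ 6 * 160 * 144\<^sup>2 / \<epsilon>"
  define A where "A = nat \<lceil>N\<rceil>"
  define \<alpha> where "\<alpha> = 1 / (144 * real A)"
  define c where "c = \<alpha>\<^sup>2 * \<epsilon> / 160"
  have N: "24 \<le> N" using \<epsilon> by (simp add: N_def field_simps)
  have A: "N \<le> real A" "24 \<le> A" using N unfolding A_def by linarith+
  have \<alpha>: "0 < \<alpha>" "\<alpha> \<le> 1 / 144" using A by (auto simp: \<alpha>_def field_simps)
  have \<alpha>2: "\<alpha>\<^sup>2 \<le> \<alpha>" using \<alpha> mult_left_mono[of \<alpha> 1 \<alpha>] by (simp add: power2_eq_square)
  have c: "0 < c" "c \<le> \<alpha> / 160"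
  proof -
    show "0 < c" using \<alpha> \<epsilon> by (simp add: c_def)
    have "\<alpha>\<^sup>2 * \<epsilon> \<le> \<alpha> * 1" using \<alpha>2 \<epsilon> \<alpha> by (intro mult_mono) auto
    then show "c \<le> \<alpha> / 160" by (simp add: c_def)
  qed
  have c1: "c \<le> 1 / 160" "c < 1" using c \<alpha> by auto
  show ?thesis
  proof (rule exI[of _ c], intro conjI allI impI)
    fix n v :: nat and S :: real
    assume v: "1 \<le> v" "v \<le> n" and S: "1 \<le> S" "S \<le> c * (real n / real v) powr (1 - \<epsilon>)"
    define h where "h = real n / real v"
    have h1: "1 \<le> h" using v by (simp add: h_def)
    have hp: "h powr (1 - \<epsilon>) \<le> h" using powr_mono[of "1 - \<epsilon>" 1 h] \<epsilon> h1 by simp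
    have Sc: "S / c \<le> h powr (1 - \<epsilon>)" using S c by (simp add: h_def divide_le_eq mult.commute)
    then have Sch: "S / c \<le> h" using hp by linarith
    have "S * 160 \<le> S / c"
    proof -
      have "S * (160 * c) \<le> S * 1" using c1 S by (intro mult_left_mono) auto
      then show ?thesis using c by (simp add: le_divide_eq mult_ac)
    qed
    then have Sh: "S * 160 \<le> h" using Sch by linarith
    have n6: "6 \<le> n"
    proof -
      have "160 * 1 \<le> h * 1" using Sh S by linarith
      also have "h * 1 \<le> h * real v" using v h1 by (intro mult_left_mono) auto
      also have "\<dots> = real n" using v by (simp add: h_def)
      finally show ?thesis by simp
    qed
    define y where "y = \<alpha> * h / S"
    have y0: "0 < y" using \<alpha> h1 S by (simp add: y_def)
    (* The smallest kappa \<ge> 1 for which kappa * l \<le> y^2 / 2 implies 9 * v * l \<le> n / 2. *)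
    define \<kappa> where "\<kappa> = max 1 (9 * \<alpha> * y / S)"
    have \<kappa>1: "1 \<le> \<kappa>" by (simp add: \<kappa>_def)
    have n_eq: "real n = h * real v" using v by (simp add: h_def)
    have \<kappa>2: "9 * real v * y\<^sup>2 \<le> real n * \<kappa>"
    proof -
      have "9 * real v * y\<^sup>2 = real n * (9 * \<alpha> * y / S)" unfolding n_eq by (simp add: y_def power2_eq_square)
      also have "\<dots> \<le> real n * \<kappa>" by (intro mult_left_mono) (auto simp: \<kappa>_def)
      finally show ?thesis .
    qed
    have yv: "9 * real v * y \<le> real n"
    proof -
      have "9 * \<alpha> / S \<le> 1" using \<alpha> S by (simp add: divide_le_eq)
      then have "real v * h * (9 * \<alpha> / S) \<le> real v * h * 1" using h1 by (intro mult_left_mono) auto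
      then show ?thesis unfolding n_eq by (simp add: y_def mult_ac)
    qed
    have ySe: "16 * S powr \<epsilon> \<le> y"
    proof -
      have "S powr \<epsilon> \<le> h powr \<epsilon>" using Sh S \<epsilon> by (intro powr_mono2) auto
      moreover have "h = h powr \<epsilon> * h powr (1 - \<epsilon>)" using h1 by (simp add: powr_add[symmetric])
      moreover have "h powr \<epsilon> * (S / c) \<le> h powr \<epsilon> * h powr (1 - \<epsilon>)" using Sc by (intro mult_left_mono) auto
      ultimately have "S powr \<epsilon> * (S / c) \<le> h"
        using S c mult_right_mono[of "S powr \<epsilon>" "h powr \<epsilon>" "S / c"] by simp
      then have "\<alpha> * (S powr \<epsilon> * (S / c)) / S \<le> y" unfolding y_def using \<alpha> S by (intro divide_right_mono mult_left_mono) auto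
      moreover have "\<alpha> * (S powr \<epsilon> * (S / c)) / S = (\<alpha> / c) * S powr \<epsilon>" using S by simp
      moreover have "16 \<le> \<alpha> / c" using c \<alpha> by (simp add: le_divide_eq)
      then have "16 * S powr \<epsilon> \<le> (\<alpha> / c) * S powr \<epsilon>" by (intro mult_right_mono) auto
      ultimately show ?thesis by linarith
    qed
    have Se: "1 \<le> S powr \<epsilon>" "S powr \<epsilon> \<le> S"
      using S \<epsilon> ge_one_powr_ge_zero[of S \<epsilon>] powr_mono[of \<epsilon> 1 S] by auto
    have ratio: "4 * S powr \<epsilon> \<le> y / (4 * \<kappa>)"
    proof (cases "\<kappa> = 1")
      case True
      then show ?thesis using ySe by simp
    next
      case False
      then have "\<kappa> = 9 * \<alpha> * y / S" by (auto simp: \<kappa>_def max_def split: if_splits)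
      then have "y / (4 * \<kappa>) = S / (36 * \<alpha>)" using y0 by simp
      moreover have "4 * S \<le> S / (36 * \<alpha>)" using \<alpha> S by (simp add: le_divide_eq)
      ultimately show ?thesis using Se by linarith
    qed
    have "4 * 1 \<le> y / (4 * \<kappa>)" using ratio Se by linarith
    then have r4: "4 * \<kappa> \<le> y" using \<kappa>1 y0 by (simp add: le_divide_eq)
    have lnr: "\<epsilon> * (1 + ln S) \<le> ln (y / (4 * \<kappa>))"
    proof -
      have "ln (4 * S powr \<epsilon>) \<le> ln (y / (4 * \<kappa>))" using ratio Se by (intro ln_mono) auto
      moreover have "ln (4 * S powr \<epsilon>) = ln 4 + \<epsilon> * ln S" using S by (simp add: ln_mult ln_powr)
      moreover have "\<epsilon> \<le> ln (4::real)"
      proof -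
        have "1 \<le> ln (4::real)" using ln_le_minus_one[of "1/4 :: real"] ln2_ge_two_thirds
          ln_mult[of 2 "2::real"] by simp
        then show ?thesis using \<epsilon> by simp
      qed
      ultimately show ?thesis by (simp add: distrib_left)
    qed
    have low: "2 * (c * ((1 + ln S) / S\<^sup>2)) \<le> pr n (\<lambda>f. real (jordan2 (tree_of f n) v) \<le> y\<^sup>2)"
    proof -
      have "(real v / real n)\<^sup>2 * y\<^sup>2 = \<alpha>\<^sup>2 / S\<^sup>2"
        unfolding n_eq y_def using v h1 by (simp add: power_divide power_mult_distrib)
      then have "(real v / real n)\<^sup>2 * y\<^sup>2 / 80 * (\<epsilon> * (1 + ln S)) = 2 * (c * ((1 + ln S) / S\<^sup>2))"
        by (simp add: c_def mult_ac)
      moreover have "(real v / real n)\<^sup>2 * y\<^sup>2 / 80 * (\<epsilon> * (1 + ln S)) \<le> (real v / real n)\<^sup>2 * y\<^sup>2 / 80 * ln (y / (4 * \<kappa>))"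
        by (intro mult_left_mono lnr) auto
      ultimately show ?thesis using jordan2_small_prob_lower[OF v n6 \<kappa>1 \<kappa>2 y0 yv r4] by linarith
    qed
    define K where "K = max 2 (nat \<lceil>S * real v\<rceil>)"
    have Sv: "1 \<le> S * real v" using S v mult_mono[of 1 S 1 "real v"] by simp
    have K: "2 \<le> K" "S * real v \<le> real K" "real K \<le> 2 * (S * real v)" using Sv unfolding K_def by (auto simp: max_def) linarith+
    have K0: "S \<le> real K"
    proof -
      have "S * 1 \<le> S * real v" using S v by (intro mult_left_mono) auto
      then show ?thesis using K by linarith
    qed
    define M where "M = A * K"
    have AK: "K \<le> M" using A by (simp add: M_def)
    have Mn: "M \<le> n"
    proof -
      have "real M \<le> real A * (2 * (S * real v))" using mult_left_mono[OF K(3), of "real A"] by (simp add: M_def)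
      also have "\<dots> \<le> real A * (2 * (c * h * real v))"
      proof (intro mult_left_mono mult_right_mono)
        show "S \<le> c * h" using Sch c by (simp add: divide_le_eq mult.commute)
      qed auto
      also have "\<dots> = (2 * real A * c) * real n" unfolding n_eq by simp
      also have "\<dots> \<le> 1 * real n"
      proof (intro mult_right_mono)
        have "2 * real A * c \<le> 2 * real A * (\<alpha> / 160)" using c by (intro mult_left_mono) auto
        also have "\<dots> \<le> 1" using A by (simp add: \<alpha>_def)
        finally show "2 * real A * c \<le> 1" .
      qed auto
      finally show ?thesis by simp
    qed
    have few: "pr n (few_central n M K) \<le> c * ((1 + ln S) / S\<^sup>2)"
    proof -
      have "pr n (few_central n M K) \<le> (12 * real K / real M) ^ (3 * K)" by (rule few_central_prob[OF K(1) AK Mn])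
      also have "12 * real K / real M = 12 / real A" using K by (simp add: M_def)
      also have "(12 / real A) ^ (3 * K) \<le> (12 / real A) ^ 6 * (4 / (real K)\<^sup>2)" by (rule few_central_decay[OF A(2) K(1)])
      also have "\<dots> \<le> (12 / real A) ^ 6 * (4 / S\<^sup>2)"
        using K0 S by (intro mult_left_mono divide_left_mono power_mono) auto
      also have "\<dots> = 4 * 12 ^ 6 / real A ^ 4 * (1 / (real A)\<^sup>2) / S\<^sup>2" by (simp add: power_divide flip: power_add)
      also have "\<dots> \<le> \<epsilon> / (160 * 144\<^sup>2) * (1 / (real A)\<^sup>2) / S\<^sup>2"
      proof (intro divide_right_mono mult_right_mono)
        have "real A * 1 \<le> real A * real A ^ 3" using A by (intro mult_left_mono one_le_power) auto
        moreover have "real A * real A ^ 3 = real A ^ 4" by (simp add: power4_eq_xxxx power3_eq_cube)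
        ultimately have "N \<le> real A ^ 4" using A by linarith
        then have "4 * 12 ^ 6 * 160 * 144\<^sup>2 \<le> real A ^ 4 * \<epsilon>" using \<epsilon> by (simp add: N_def divide_le_eq)
        then show "4 * 12 ^ 6 / real A ^ 4 \<le> \<epsilon> / (160 * 144\<^sup>2)" using A by (simp add: field_simps)
      qed auto
      also have "\<dots> = c * (1 / S\<^sup>2)" by (simp add: c_def \<alpha>_def power_divide power_mult_distrib)
      also have "\<dots> \<le> c * ((1 + ln S) / S\<^sup>2)" using c S by (intro mult_left_mono divide_right_mono) auto
      finally show ?thesis .
    qed
    have half: "x \<le> a" if "2 * x \<le> a + b" "b \<le> x" for x a b :: real using that by linarith
    have "2 * (c * ((1 + ln S) / S\<^sup>2)) \<le> pr n (\<lambda>f. (real (jordan2 (tree_of f n) v) \<le> y\<^sup>2 \<and> \<not> few_central n M K f) \<or> few_central n M K f)"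
      by (rule order_trans[OF low pr_mono]) auto
    also have "\<dots> \<le> pr n (\<lambda>f. real (jordan2 (tree_of f n) v) \<le> y\<^sup>2 \<and> \<not> few_central n M K f) + pr n (few_central n M K)" by (rule pr_disj)
    finally have "c * ((1 + ln S) / S\<^sup>2) \<le> pr n (\<lambda>f. real (jordan2 (tree_of f n) v) \<le> y\<^sup>2 \<and> \<not> few_central n M K f)"
      using few half by blast
    also have "\<dots> \<le> measure_pmf.prob (jordan2_ordering n) {\<sigma>. real (\<sigma> v) \<ge> S * real v}"
    proof (rule ordering_prob_ge)
      fix f \<sigma> assume f: "valid n f" and \<sigma>: "\<sigma> \<in> jordan2_rankings n (tree_of f n)"
        and J: "real (jordan2 (tree_of f n) v) \<le> y\<^sup>2 \<and> \<not> few_central n M K f"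
      have n2: "2 \<le> n" using n6 by simp
      have "y < real n / (4 * real M)"
      proof -
        have "real A * real K \<le> real A * (2 * (S * real v))" using K by (intro mult_left_mono) auto
        then have "4 * real M * y \<le> 4 * (real A * (2 * (S * real v))) * y" using y0 by (intro mult_right_mono) (simp_all add: M_def mult_ac)
        also have "\<dots> = 1 / 18 * real n" using S A by (simp add: y_def n_eq \<alpha>_def)
        also have "\<dots> < real n" using n6 by simp
        finally have "4 * real M * y < real n" .
        moreover have "0 < 4 * real M" using AK K(1) by simp
        ultimately show ?thesis by (simp add: less_divide_eq mult.commute)
      qed
      then have y4: "4 * real M * y < real n" using AK K(1) by (simp add: less_divide_eq mult.commute)
      have "{w \<in> {1..n}. n \<le> 4 * M * jordan (tree_of f n) w} \<subseteq> {w \<in> {1..n}. jordan2 (tree_of f n) v < jordan2 (tree_of f n) w}"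
      proof clarify
        fix w assume w: "w \<in> {1..n}" "n \<le> 4 * M * jordan (tree_of f n) w"
        have "real n \<le> real (4 * M * jordan (tree_of f n) w)" using w(2) by (rule of_nat_mono)
        then have "4 * real M * y < 4 * real M * real (jordan (tree_of f n) w)" using y4 by simp
        then have yw: "y < real (jordan (tree_of f n) w)" by (simp add: mult_less_cancel_left)
        then have "y\<^sup>2 < real (jordan (tree_of f n) w) * real (jordan (tree_of f n) w)"
          using y0 by (simp add: power2_eq_square mult_strict_mono)
        also have "\<dots> = real (jordan (tree_of f n) w * jordan (tree_of f n) w)" by simp
        also have "\<dots> \<le> real (jordan2 (tree_of f n) w)" by (intro of_nat_mono jordan2_ge_square[OF f n2 w(1)])
        finally show "jordan2 (tree_of f n) v < jordan2 (tree_of f n) w" using J by simp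
      qed
      then have "card {w \<in> {1..n}. n \<le> 4 * M * jordan (tree_of f n) w} \<le> card {w \<in> {1..n}. jordan2 (tree_of f n) v < jordan2 (tree_of f n) w}"
        by (intro card_mono) auto
      moreover have "K \<le> card {w \<in> {1..n}. n \<le> 4 * M * jordan (tree_of f n) w}" using J by (simp add: few_central_def)
      moreover have "card {w \<in> {1..n}. jordan2 (tree_of f n) v < jordan2 (tree_of f n) w} < \<sigma> v"
        using v by (intro rank_ge[OF \<sigma>]) auto
      ultimately have "real K \<le> real (\<sigma> v)" by simp
      then show "S * real v \<le> real (\<sigma> v)" using K by linarith
    qed
    finally show "c * ((1 + ln S) / S\<^sup>2) \<le> measure_pmf.prob (jordan2_ordering n) {\<sigma>. real (\<sigma> v) \<ge> S * real v}" .
  qed (use c c1 in auto)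
qed

section \<open>The tails of the rank\<close>

theorem theorem1p3:
  shows "(\<forall>\<epsilon>::real. \<epsilon> > 0 \<longrightarrow>
     (\<exists>c C::real. c > 0 \<and> C > 0 \<and>
       (\<forall>n::nat. \<forall>v::nat. \<forall>S::real. 1 \<le> n \<longrightarrow> v \<in> {1..n} \<longrightarrow> 1 \<le> S \<longrightarrow>
          (S \<le> c * (real n / real v) powr (1 - \<epsilon>) \<longrightarrow>
             c * ((1 + ln S) / S ^ 2)
               \<le> measure_pmf.prob (jordan2_ordering n) {\<sigma>. real (\<sigma> v) \<ge> S * real v}) \<and>
          measure_pmf.prob (jordan2_ordering n) {\<sigma>. real (\<sigma> v) \<ge> S * real v}
            \<le> C * ((1 + ln S) / S ^ 2))))
   \<and>
   (\<exists>c' C' \<delta>::real. c' > 0 \<and> C' > 0 \<and> \<delta> > 0 \<and>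
      (\<forall>n::nat. \<forall>v::nat. \<forall>S::real.
         1 \<le> n \<longrightarrow> 1 \<le> v \<longrightarrow> real v \<le> real n / 4 \<longrightarrow> 1 \<le> S \<longrightarrow>
         (S \<le> \<delta> * sqrt (real v) \<longrightarrow>
            c' / S ^ 2
              \<le> measure_pmf.prob (jordan2_ordering n) {\<sigma>. real (\<sigma> v) \<le> 1 / S * real v}) \<and>
         measure_pmf.prob (jordan2_ordering n) {\<sigma>. real (\<sigma> v) \<le> 1 / S * real v}
           \<le> C' / S ^ 2))"
proof (intro conjI allI impI)
  fix \<epsilon> :: real assume \<epsilon>: "\<epsilon> > 0"
  (* The lower bound is proved for small exponents; n / v \<ge> 1 makes the condition on S monotone in epsilon. *)
  define \<eta> where "\<eta> = min \<epsilon> (1 / 2)"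
  have \<eta>: "0 < \<eta>" "\<eta> \<le> 1 / 2" using \<epsilon> by (auto simp: \<eta>_def)
  obtain c where c: "0 < c"
    and low: "\<And>n v S. 1 \<le> v \<Longrightarrow> v \<le> n \<Longrightarrow> 1 \<le> S \<Longrightarrow> S \<le> c * (real n / real v) powr (1 - \<eta>) \<Longrightarrow>
       c * ((1 + ln S) / S\<^sup>2) \<le> measure_pmf.prob (jordan2_ordering n) {\<sigma>. real (\<sigma> v) \<ge> S * real v}"
    using upper_tail_lower[OF \<eta>] by blast
  have main: "(S \<le> c * (real n / real v) powr (1 - \<epsilon>) \<longrightarrow>
         c * ((1 + ln S) / S ^ 2) \<le> measure_pmf.prob (jordan2_ordering n) {\<sigma>. real (\<sigma> v) \<ge> S * real v}) \<and>
      measure_pmf.prob (jordan2_ordering n) {\<sigma>. real (\<sigma> v) \<ge> S * real v} \<le> (144 * lam\<^sup>2 + 7376) * ((1 + ln S) / S ^ 2)"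
    if v: "v \<in> {1..n}" and S: "1 \<le> S" for n v :: nat and S :: real
  proof (intro conjI impI)
    assume "S \<le> c * (real n / real v) powr (1 - \<epsilon>)"
    also have "\<dots> \<le> c * (real n / real v) powr (1 - \<eta>)"
      using c v by (intro mult_left_mono powr_mono) (auto simp: \<eta>_def)
    finally show "c * ((1 + ln S) / S ^ 2) \<le> measure_pmf.prob (jordan2_ordering n) {\<sigma>. real (\<sigma> v) \<ge> S * real v}"
      using v S by (intro low) auto
  qed (rule upper_tail_upper[OF v S])
  moreover have "0 < 144 * lam\<^sup>2 + 7376" by (simp add: lam_def)
  ultimately show "\<exists>c C::real. c > 0 \<and> C > 0 \<and>
       (\<forall>n::nat. \<forall>v::nat. \<forall>S::real. 1 \<le> n \<longrightarrow> v \<in> {1..n} \<longrightarrow> 1 \<le> S \<longrightarrow>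
          (S \<le> c * (real n / real v) powr (1 - \<epsilon>) \<longrightarrow>
             c * ((1 + ln S) / S ^ 2)
               \<le> measure_pmf.prob (jordan2_ordering n) {\<sigma>. real (\<sigma> v) \<ge> S * real v}) \<and>
          measure_pmf.prob (jordan2_ordering n) {\<sigma>. real (\<sigma> v) \<ge> S * real v}
            \<le> C * ((1 + ln S) / S ^ 2))"
    using c by blast
next
  obtain c \<delta> :: real where c: "0 < c" "0 < \<delta>"
    and low: "\<And>n v S. 1 \<le> v \<Longrightarrow> v \<le> n \<Longrightarrow> 1 \<le> S \<Longrightarrow> S \<le> \<delta> * sqrt (real v) \<Longrightarrow>
       c / S\<^sup>2 \<le> measure_pmf.prob (jordan2_ordering n) {\<sigma>. real (\<sigma> v) \<le> 1 / S * real v}"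
    using lower_tail_lower by blast
  have "(S \<le> \<delta> * sqrt (real v) \<longrightarrow>
         c / S ^ 2 \<le> measure_pmf.prob (jordan2_ordering n) {\<sigma>. real (\<sigma> v) \<le> 1 / S * real v}) \<and>
      measure_pmf.prob (jordan2_ordering n) {\<sigma>. real (\<sigma> v) \<le> 1 / S * real v} \<le> 1600000000 / S ^ 2"
    if v: "1 \<le> v" "real v \<le> real n / 4" and S: "1 \<le> S" for n v :: nat and S :: real
  proof -
    have "v \<le> n" using v by simp
    then show ?thesis using low[of v n S] lower_tail_upper[of v n S] v S by auto
  qed
  moreover have "(0 :: real) < 1600000000" by simp
  ultimately show "\<exists>c' C' \<delta>::real. c' > 0 \<and> C' > 0 \<and> \<delta> > 0 \<and>
      (\<forall>n::nat. \<forall>v::nat. \<forall>S::real.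
         1 \<le> n \<longrightarrow> 1 \<le> v \<longrightarrow> real v \<le> real n / 4 \<longrightarrow> 1 \<le> S \<longrightarrow>
         (S \<le> \<delta> * sqrt (real v) \<longrightarrow>
            c' / S ^ 2
              \<le> measure_pmf.prob (jordan2_ordering n) {\<sigma>. real (\<sigma> v) \<le> 1 / S * real v}) \<and>
         measure_pmf.prob (jordan2_ordering n) {\<sigma>. real (\<sigma> v) \<le> 1 / S * real v}
           \<le> C' / S ^ 2)"
    using c by blast
qed

end
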